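(* Let $R$ be a ring whose right socle $S_r$ is finitely generated (as a right ideal). If $F$ is a finitely generated flat right $R$-module which has a projective $\delta$-cover, then $F$ is projective.
   Context: Rings are associative with identity; modules are unitary right modules. $S_r=\operatorname{Soc}(R_R)$ is the right socle of $R$. A submodule $N$ of a module $M$ is $\delta$-small in $M$, written $N\ll_\delta M$, if $N+K\neq M$ for every proper submodule $K$ of $M$ with $M/K$ singular (a module is singular if each of its elements is annihilated by some essential right ideal of $R$). A projective $\delta$-cover of $M$ is an epimorphism $f:P\to M$ with $P$ projective and $\operatorname{Ker}(f)\ll_\delta P$. *)

theory Defs
  imports "HOL-Algebra.Algebra"
begin

section \<open>Modules over a noncommutative ring\<close>

text \<open>
  The library locale \<open>module\<close> assumes a commutative ring, so left and right modules are introduced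
  here on the same record type, and submodules are those of the library locale \<open>submodule\<close>.
  The scalar is always written on the left: in a right module,
  \<open>a \<odot>\<^bsub>M\<^esub> x\<close> stands for the product \<open>x a\<close>, whence the order of the factors in
  \<open>smult_assoc\<close>. The fields \<open>mult\<close> and \<open>one\<close> of a module record are never used.
\<close>

locale right_module = R?: ring R + M?: abelian_group M
  for R :: "('a, 'r) ring_scheme" (structure) and M :: "('a, 'b, 'm) module_scheme" (structure) +
  assumes smult_closed [simp, intro]:
      "\<lbrakk>a \<in> carrier R; x \<in> carrier M\<rbrakk> \<Longrightarrow> a \<odot>\<^bsub>M\<^esub> x \<in> carrier M"
    and smult_add_scalar:
      "\<lbrakk>a \<in> carrier R; b \<in> carrier R; x \<in> carrier M\<rbrakk> \<Longrightarrow>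
        (a \<oplus> b) \<odot>\<^bsub>M\<^esub> x = a \<odot>\<^bsub>M\<^esub> x \<oplus>\<^bsub>M\<^esub> b \<odot>\<^bsub>M\<^esub> x"
    and smult_add_vector:
      "\<lbrakk>a \<in> carrier R; x \<in> carrier M; y \<in> carrier M\<rbrakk> \<Longrightarrow>
        a \<odot>\<^bsub>M\<^esub> (x \<oplus>\<^bsub>M\<^esub> y) = a \<odot>\<^bsub>M\<^esub> x \<oplus>\<^bsub>M\<^esub> a \<odot>\<^bsub>M\<^esub> y"
    and smult_assoc:
      "\<lbrakk>a \<in> carrier R; b \<in> carrier R; x \<in> carrier M\<rbrakk> \<Longrightarrow>
        (a \<otimes> b) \<odot>\<^bsub>M\<^esub> x = b \<odot>\<^bsub>M\<^esub> (a \<odot>\<^bsub>M\<^esub> x)"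
    and smult_one [simp]:
      "x \<in> carrier M \<Longrightarrow> \<one> \<odot>\<^bsub>M\<^esub> x = x"

locale left_module = R?: ring R + M?: abelian_group M
  for R :: "('a, 'r) ring_scheme" (structure) and M :: "('a, 'b, 'm) module_scheme" (structure) +
  assumes smult_closed [simp, intro]:
      "\<lbrakk>a \<in> carrier R; x \<in> carrier M\<rbrakk> \<Longrightarrow> a \<odot>\<^bsub>M\<^esub> x \<in> carrier M"
    and smult_add_scalar:
      "\<lbrakk>a \<in> carrier R; b \<in> carrier R; x \<in> carrier M\<rbrakk> \<Longrightarrow>
        (a \<oplus> b) \<odot>\<^bsub>M\<^esub> x = a \<odot>\<^bsub>M\<^esub> x \<oplus>\<^bsub>M\<^esub> b \<odot>\<^bsub>M\<^esub> x"
    and smult_add_vector: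
      "\<lbrakk>a \<in> carrier R; x \<in> carrier M; y \<in> carrier M\<rbrakk> \<Longrightarrow>
        a \<odot>\<^bsub>M\<^esub> (x \<oplus>\<^bsub>M\<^esub> y) = a \<odot>\<^bsub>M\<^esub> x \<oplus>\<^bsub>M\<^esub> a \<odot>\<^bsub>M\<^esub> y"
    and smult_assoc:
      "\<lbrakk>a \<in> carrier R; b \<in> carrier R; x \<in> carrier M\<rbrakk> \<Longrightarrow>
        (a \<otimes> b) \<odot>\<^bsub>M\<^esub> x = a \<odot>\<^bsub>M\<^esub> (b \<odot>\<^bsub>M\<^esub> x)"
    and smult_one [simp]:
      "x \<in> carrier M \<Longrightarrow> \<one> \<odot>\<^bsub>M\<^esub> x = x"

definition linear_maps ::
  "('a, 'r) ring_scheme \<Rightarrow> ('a, 'b, 'm) module_scheme \<Rightarrow> ('a, 'c, 'n) module_scheme \<Rightarrow> ('b \<Rightarrow> 'c) set"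
  where "linear_maps R M N =
    {h \<in> carrier M \<rightarrow> carrier N.
      (\<forall>x\<in>carrier M. \<forall>y\<in>carrier M. h (x \<oplus>\<^bsub>M\<^esub> y) = h x \<oplus>\<^bsub>N\<^esub> h y) \<and>
      (\<forall>a\<in>carrier R. \<forall>x\<in>carrier M. h (a \<odot>\<^bsub>M\<^esub> x) = a \<odot>\<^bsub>N\<^esub> h x)}"

definition epimorphisms ::
  "('a, 'r) ring_scheme \<Rightarrow> ('a, 'b, 'm) module_scheme \<Rightarrow> ('a, 'c, 'n) module_scheme \<Rightarrow> ('b \<Rightarrow> 'c) set"
  where "epimorphisms R M N = {h \<in> linear_maps R M N. h ` carrier M = carrier N}"

definition monomorphisms ::
  "('a, 'r) ring_scheme \<Rightarrow> ('a, 'b, 'm) module_scheme \<Rightarrow> ('a, 'c, 'n) module_scheme \<Rightarrow> ('b \<Rightarrow> 'c) set"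
  where "monomorphisms R M N = {h \<in> linear_maps R M N. inj_on h (carrier M)}"

lemma linear_mapsD:
  assumes "h \<in> linear_maps R M N"
  shows "x \<in> carrier M \<Longrightarrow> h x \<in> carrier N"
    and "\<lbrakk>x \<in> carrier M; y \<in> carrier M\<rbrakk> \<Longrightarrow> h (x \<oplus>\<^bsub>M\<^esub> y) = h x \<oplus>\<^bsub>N\<^esub> h y"
    and "\<lbrakk>a \<in> carrier R; x \<in> carrier M\<rbrakk> \<Longrightarrow> h (a \<odot>\<^bsub>M\<^esub> x) = a \<odot>\<^bsub>N\<^esub> h x"
  using assms by (auto simp: linear_maps_def)

text \<open>The right module \<open>R\<^sub>R\<close>; its submodules are the right ideals of \<open>R\<close>.\<close>

definition right_regular :: "('a, 'r) ring_scheme \<Rightarrow> ('a, 'a) module"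
  where "right_regular R =
    \<lparr>carrier = carrier R, monoid.mult = monoid.mult R, one = \<one>\<^bsub>R\<^esub>, ring.zero = \<zero>\<^bsub>R\<^esub>, add = add R,
     smult = (\<lambda>a x. x \<otimes>\<^bsub>R\<^esub> a)\<rparr>"

lemma right_module_regular:
  assumes "ring R"
  shows "right_module R (right_regular R)"
proof -
  interpret ring R by fact
  have "abelian_group (right_regular R)"
    by (rule abelian_groupI) (auto simp: right_regular_def a_ac intro: l_neg)
  then show ?thesis
    unfolding right_module_def right_module_axioms_def
    using assms by (auto simp: right_regular_def l_distr r_distr m_assoc)
qed

definition submodule_span ::
  "('a, 'r) ring_scheme \<Rightarrow> ('a, 'b, 'm) module_scheme \<Rightarrow> 'b set \<Rightarrow> 'b set"
  where "submodule_span R M A = \<Inter>{H. submodule H R M \<and> A \<subseteq> H}"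

definition finitely_generated ::
  "('a, 'r) ring_scheme \<Rightarrow> ('a, 'b, 'm) module_scheme \<Rightarrow> 'b set \<Rightarrow> bool"
  where "finitely_generated R M N \<longleftrightarrow>
    (\<exists>A. finite A \<and> A \<subseteq> carrier M \<and> N = submodule_span R M A)"

definition quotient_module ::
  "('a, 'r) ring_scheme \<Rightarrow> ('a, 'b, 'm) module_scheme \<Rightarrow> 'b set \<Rightarrow> ('a, 'b set) module"
  where "quotient_module R M K =
    \<lparr>carrier = a_rcosets\<^bsub>M\<^esub> K, monoid.mult = undefined, one = undefined, ring.zero = K, add = set_add M,
     smult = (\<lambda>a C. \<Union>x\<in>C. K +>\<^bsub>M\<^esub> (a \<odot>\<^bsub>M\<^esub> x))\<rparr>"


section \<open>Socle, singular modules\<close>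

definition simple_submodule ::
  "('a, 'r) ring_scheme \<Rightarrow> ('a, 'b, 'm) module_scheme \<Rightarrow> 'b set \<Rightarrow> bool"
  where "simple_submodule R M S \<longleftrightarrow>
    submodule S R M \<and> S \<noteq> {\<zero>\<^bsub>M\<^esub>} \<and>
    (\<forall>H. submodule H R M \<and> H \<subseteq> S \<longrightarrow> H = {\<zero>\<^bsub>M\<^esub>} \<or> H = S)"

definition socle :: "('a, 'r) ring_scheme \<Rightarrow> ('a, 'b, 'm) module_scheme \<Rightarrow> 'b set"
  where "socle R M = submodule_span R M (\<Union>{S. simple_submodule R M S})"

definition right_socle :: "('a, 'r) ring_scheme \<Rightarrow> 'a set"
  where "right_socle R = socle R (right_regular R)"

definition essential_submodule ::
  "('a, 'r) ring_scheme \<Rightarrow> ('a, 'b, 'm) module_scheme \<Rightarrow> 'b set \<Rightarrow> bool"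
  where "essential_submodule R M N \<longleftrightarrow>
    submodule N R M \<and>
    (\<forall>H. submodule H R M \<and> H \<noteq> {\<zero>\<^bsub>M\<^esub>} \<longrightarrow> N \<inter> H \<noteq> {\<zero>\<^bsub>M\<^esub>})"

definition singular_module ::
  "('a, 'r) ring_scheme \<Rightarrow> ('a, 'b, 'm) module_scheme \<Rightarrow> bool"
  where "singular_module R M \<longleftrightarrow>
    (\<forall>x\<in>carrier M. \<exists>I. essential_submodule R (right_regular R) I \<and>
      (\<forall>a\<in>I. a \<odot>\<^bsub>M\<^esub> x = \<zero>\<^bsub>M\<^esub>))"

definition delta_small ::
  "('a, 'r) ring_scheme \<Rightarrow> ('a, 'b, 'm) module_scheme \<Rightarrow> 'b set \<Rightarrow> bool"
  where "delta_small R M N \<longleftrightarrow>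
    submodule N R M \<and>
    (\<forall>K. submodule K R M \<and> K \<noteq> carrier M \<and> singular_module R (quotient_module R M K) \<longrightarrow>
      N <+>\<^bsub>M\<^esub> K \<noteq> carrier M)"


section \<open>Projective modules\<close>

text \<open>
  A definition cannot quantify over all types, so the lifting property is required of epimorphisms
  \<open>M \<rightarrow> N\<close> with \<open>N\<close> on the type of \<open>P\<close> and \<open>M\<close> on the function type that carries the free module
  with basis \<open>carrier P\<close>. Lemma \<open>projective_lifting\<close> below shows that this entails the
  lifting property for modules on arbitrary types.
\<close>

definition projective_module :: "('a, 'r) ring_scheme \<Rightarrow> ('a, 'b) module \<Rightarrow> bool"
  where "projective_module R P \<longleftrightarrow>
    right_module R P \<and>
    (\<forall>(M :: ('a, 'b \<Rightarrow> 'a) module) (N :: ('a, 'b) module) g f.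
      right_module R M \<and> right_module R N \<and> g \<in> epimorphisms R M N \<and> f \<in> linear_maps R P N \<longrightarrow>
      (\<exists>h\<in>linear_maps R P M. \<forall>x\<in>carrier P. g (h x) = f x))"

lemma (in right_module) smult_zero_scalar:
  assumes "x \<in> carrier M"
  shows "\<zero> \<odot>\<^bsub>M\<^esub> x = \<zero>\<^bsub>M\<^esub>"
proof -
  have "\<zero> \<odot>\<^bsub>M\<^esub> x \<oplus>\<^bsub>M\<^esub> \<zero> \<odot>\<^bsub>M\<^esub> x = \<zero> \<odot>\<^bsub>M\<^esub> x"
    using smult_add_scalar [of \<zero> \<zero> x] assms by simp
  then show ?thesis
    using assms M.add.l_cancel_one [of "\<zero> \<odot>\<^bsub>M\<^esub> x" "\<zero> \<odot>\<^bsub>M\<^esub> x"] by simp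
qed

lemma (in right_module) smult_zero_vector:
  assumes "a \<in> carrier R"
  shows "a \<odot>\<^bsub>M\<^esub> \<zero>\<^bsub>M\<^esub> = \<zero>\<^bsub>M\<^esub>"
proof -
  have "a \<odot>\<^bsub>M\<^esub> \<zero>\<^bsub>M\<^esub> \<oplus>\<^bsub>M\<^esub> a \<odot>\<^bsub>M\<^esub> \<zero>\<^bsub>M\<^esub> = a \<odot>\<^bsub>M\<^esub> \<zero>\<^bsub>M\<^esub>"
    using smult_add_vector [of a "\<zero>\<^bsub>M\<^esub>" "\<zero>\<^bsub>M\<^esub>"] assms by simp
  then show ?thesis
    using assms M.add.l_cancel_one [of "a \<odot>\<^bsub>M\<^esub> \<zero>\<^bsub>M\<^esub>" "a \<odot>\<^bsub>M\<^esub> \<zero>\<^bsub>M\<^esub>"] by simp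
qed

definition free_right_module :: "('a, 'r) ring_scheme \<Rightarrow> 'b set \<Rightarrow> ('a, 'b \<Rightarrow> 'a) module"
  where "free_right_module R B =
    \<lparr>carrier = {c. range c \<subseteq> carrier R \<and> finite {x. c x \<noteq> \<zero>\<^bsub>R\<^esub>} \<and> {x. c x \<noteq> \<zero>\<^bsub>R\<^esub>} \<subseteq> B},
     monoid.mult = undefined, one = undefined, ring.zero = (\<lambda>_. \<zero>\<^bsub>R\<^esub>),
     add = (\<lambda>c d x. c x \<oplus>\<^bsub>R\<^esub> d x), smult = (\<lambda>a c x. c x \<otimes>\<^bsub>R\<^esub> a)\<rparr>"

lemma right_module_free:
  fixes R :: "('a, 'r) ring_scheme" (structure)
  assumes "ring R"
  shows "right_module R (free_right_module R B)"
proof -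
  interpret ring R by fact
  let ?F = "free_right_module R B"
  have add: "c \<oplus>\<^bsub>?F\<^esub> d \<in> carrier ?F" if "c \<in> carrier ?F" "d \<in> carrier ?F" for c d
  proof -
    have *: "{x. c x \<oplus> d x \<noteq> \<zero>} \<subseteq> {x. c x \<noteq> \<zero>} \<union> {x. d x \<noteq> \<zero>}"
      by auto
    with that show ?thesis
      by (auto simp: free_right_module_def image_subset_iff intro: finite_subset [OF *])
  qed
  have smult: "a \<odot>\<^bsub>?F\<^esub> c \<in> carrier ?F" if "a \<in> carrier R" "c \<in> carrier ?F" for a c
  proof -
    have *: "{x. c x \<otimes> a \<noteq> \<zero>} \<subseteq> {x. c x \<noteq> \<zero>}"
      using that by auto
    with that show ?thesis
      by (auto simp: free_right_module_def image_subset_iff intro: finite_subset [OF *])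
  qed
  have ag: "abelian_group ?F"
  proof (rule abelian_groupI)
    fix c assume c: "c \<in> carrier ?F"
    then have "(\<lambda>x. \<ominus> c x) \<in> carrier ?F"
      by (auto simp: free_right_module_def image_subset_iff)
    moreover have "(\<lambda>x. \<ominus> c x) \<oplus>\<^bsub>?F\<^esub> c = \<zero>\<^bsub>?F\<^esub>"
      using c by (auto simp: free_right_module_def image_subset_iff l_neg)
    ultimately show "\<exists>d\<in>carrier ?F. d \<oplus>\<^bsub>?F\<^esub> c = \<zero>\<^bsub>?F\<^esub>"
      by blast
  qed (auto intro: add, auto simp: free_right_module_def image_subset_iff a_ac)
  show ?thesis
    unfolding right_module_def right_module_axioms_def
    using assms ag smult
    by (auto, auto simp: free_right_module_def image_subset_iff l_distr r_distr m_assoc)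
qed

definition linear_combination ::
  "('a, 'r) ring_scheme \<Rightarrow> ('a, 'c, 'n) module_scheme \<Rightarrow> ('b \<Rightarrow> 'c) \<Rightarrow> ('b \<Rightarrow> 'a) \<Rightarrow> 'c"
  where "linear_combination R M m c = (\<Oplus>\<^bsub>M\<^esub>x\<in>{x. c x \<noteq> \<zero>\<^bsub>R\<^esub>}. c x \<odot>\<^bsub>M\<^esub> m x)"

lemma linear_combination_superset:
  assumes "right_module R M" "c \<in> carrier (free_right_module R B)" "m \<in> B \<rightarrow> carrier M"
    and "finite S" "{x. c x \<noteq> \<zero>\<^bsub>R\<^esub>} \<subseteq> S" "S \<subseteq> B"
  shows "linear_combination R M m c = (\<Oplus>\<^bsub>M\<^esub>x\<in>S. c x \<odot>\<^bsub>M\<^esub> m x)"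
proof -
  interpret right_module R M by fact
  have "c x \<in> carrier R" for x
    using assms(2) by (auto simp: free_right_module_def)
  moreover have "m x \<in> carrier M" if "x \<in> S" for x
    using that assms(3,6) by auto
  ultimately show ?thesis
    unfolding linear_combination_def using assms(4,5)
    by (intro M.add.finprod_mono_neutral_cong_left) (auto simp: smult_zero_scalar)
qed

lemma linear_combination_linear:
  fixes R :: "('a, 'r) ring_scheme" (structure)
    and M :: "('a, 'd, 'm) module_scheme" and B :: "'b set"
  assumes M: "right_module R M" and m: "m \<in> B \<rightarrow> carrier M"
  shows "linear_combination R M m \<in> linear_maps R (free_right_module R B) M"
proof -
  interpret right_module R M by fact
  let ?F = "free_right_module R B"
  interpret F: right_module R ?F
    by (rule right_module_free [OF R.ring_axioms])
  note sup = linear_combination_superset [OF M _ m]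
  have cR: "c x \<in> carrier R" if "c \<in> carrier ?F" for c x
    using that by (auto simp: free_right_module_def)
  have fin: "finite {x. c x \<noteq> \<zero>}" "{x. c x \<noteq> \<zero>} \<subseteq> B" if "c \<in> carrier ?F" for c
    using that by (auto simp: free_right_module_def)
  have smult_sum: "a \<odot>\<^bsub>M\<^esub> (\<Oplus>\<^bsub>M\<^esub>x\<in>S. k x) = (\<Oplus>\<^bsub>M\<^esub>x\<in>S. a \<odot>\<^bsub>M\<^esub> k x)"
    if "finite S" "k \<in> S \<rightarrow> carrier M" "a \<in> carrier R" for a S and k :: "'b \<Rightarrow> 'd"
    using that by (induction S) (auto simp: smult_zero_vector smult_add_vector Pi_def)
  have 1: "linear_combination R M m c \<in> carrier M" if "c \<in> carrier ?F" for c
    unfolding linear_combination_def using that cR [OF that] fin [OF that] m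
    by (intro M.finsum_closed) auto
  have 2: "linear_combination R M m (c \<oplus>\<^bsub>?F\<^esub> d) =
      linear_combination R M m c \<oplus>\<^bsub>M\<^esub> linear_combination R M m d"
    if c: "c \<in> carrier ?F" and d: "d \<in> carrier ?F" for c d
  proof -
    let ?S = "{x. c x \<noteq> \<zero>} \<union> {x. d x \<noteq> \<zero>}"
    have S: "finite ?S" "?S \<subseteq> B"
      using fin [OF c] fin [OF d] by auto
    have mS: "m x \<in> carrier M" if "x \<in> ?S" for x
      using that S(2) m by auto
    have "linear_combination R M m (c \<oplus>\<^bsub>?F\<^esub> d) = (\<Oplus>\<^bsub>M\<^esub>x\<in>?S. (c \<oplus>\<^bsub>?F\<^esub> d) x \<odot>\<^bsub>M\<^esub> m x)"
      using S by (intro sup F.add.m_closed c d) (auto simp: free_right_module_def)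
    also have "\<dots> = (\<Oplus>\<^bsub>M\<^esub>x\<in>?S. c x \<odot>\<^bsub>M\<^esub> m x \<oplus>\<^bsub>M\<^esub> d x \<odot>\<^bsub>M\<^esub> m x)"
      using cR [OF c] cR [OF d] mS
      by (intro M.finsum_cong') (auto simp: free_right_module_def smult_add_scalar)
    also have "\<dots> = (\<Oplus>\<^bsub>M\<^esub>x\<in>?S. c x \<odot>\<^bsub>M\<^esub> m x) \<oplus>\<^bsub>M\<^esub> (\<Oplus>\<^bsub>M\<^esub>x\<in>?S. d x \<odot>\<^bsub>M\<^esub> m x)"
      using cR [OF c] cR [OF d] mS by (intro M.finsum_addf) auto
    also have "\<dots> = linear_combination R M m c \<oplus>\<^bsub>M\<^esub> linear_combination R M m d"
      using sup [OF c S(1) _ S(2)] sup [OF d S(1) _ S(2)] by simp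
    finally show ?thesis .
  qed
  have 3: "linear_combination R M m (a \<odot>\<^bsub>?F\<^esub> c) = a \<odot>\<^bsub>M\<^esub> linear_combination R M m c"
    if a: "a \<in> carrier R" and c: "c \<in> carrier ?F" for a c
  proof -
    let ?S = "{x. c x \<noteq> \<zero>}"
    have mS: "m x \<in> carrier M" if "x \<in> ?S" for x
      using that fin(2) [OF c] m by auto
    have "linear_combination R M m (a \<odot>\<^bsub>?F\<^esub> c) = (\<Oplus>\<^bsub>M\<^esub>x\<in>?S. (a \<odot>\<^bsub>?F\<^esub> c) x \<odot>\<^bsub>M\<^esub> m x)"
      using fin [OF c] a by (intro sup F.smult_closed a c) (auto simp: free_right_module_def)
    also have "\<dots> = (\<Oplus>\<^bsub>M\<^esub>x\<in>?S. a \<odot>\<^bsub>M\<^esub> (c x \<odot>\<^bsub>M\<^esub> m x))"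
      using cR [OF c] a mS
      by (intro M.finsum_cong') (auto simp: free_right_module_def smult_assoc)
    also have "\<dots> = a \<odot>\<^bsub>M\<^esub> linear_combination R M m c"
      unfolding linear_combination_def
      using fin(1) [OF c] cR [OF c] a mS by (intro smult_sum [symmetric]) auto
    finally show ?thesis .
  qed
  show ?thesis
    using 1 2 3 by (simp add: linear_maps_def)
qed

lemma linear_map_linear_combination:
  fixes M :: "('a, 'd, 'm) module_scheme" and B :: "'b set"
  assumes M: "right_module R M" and N: "right_module R N" and g: "g \<in> linear_maps R M N"
    and m: "m \<in> B \<rightarrow> carrier M" and c: "c \<in> carrier (free_right_module R B)"
  shows "g (linear_combination R M m c) = linear_combination R N (g \<circ> m) c"
proof -
  interpret M: right_module R M by fact
  interpret N: right_module R N by fact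
  note gD = linear_mapsD [OF g]
  have "g \<zero>\<^bsub>M\<^esub> \<oplus>\<^bsub>N\<^esub> g \<zero>\<^bsub>M\<^esub> = g \<zero>\<^bsub>M\<^esub>"
    using gD(2) [of "\<zero>\<^bsub>M\<^esub>" "\<zero>\<^bsub>M\<^esub>"] by simp
  then have g0: "g \<zero>\<^bsub>M\<^esub> = \<zero>\<^bsub>N\<^esub>"
    using N.add.l_cancel_one [of "g \<zero>\<^bsub>M\<^esub>" "g \<zero>\<^bsub>M\<^esub>"] gD(1) by simp
  have g_sum: "g (\<Oplus>\<^bsub>M\<^esub>x\<in>S. k x) = (\<Oplus>\<^bsub>N\<^esub>x\<in>S. g (k x))"
    if "finite S" "k \<in> S \<rightarrow> carrier M" for S and k :: "'b \<Rightarrow> 'd"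
    using that by (induction S) (auto simp: g0 gD Pi_def)
  have cR: "c x \<in> carrier R" for x
    using c by (auto simp: free_right_module_def)
  have fin: "finite {x. c x \<noteq> \<zero>\<^bsub>R\<^esub>}" "{x. c x \<noteq> \<zero>\<^bsub>R\<^esub>} \<subseteq> B"
    using c by (auto simp: free_right_module_def)
  then have mS: "m x \<in> carrier M" if "c x \<noteq> \<zero>\<^bsub>R\<^esub>" for x
    using that m by auto
  have "g (linear_combination R M m c) = (\<Oplus>\<^bsub>N\<^esub>x\<in>{x. c x \<noteq> \<zero>\<^bsub>R\<^esub>}. g (c x \<odot>\<^bsub>M\<^esub> m x))"
    unfolding linear_combination_def using cR mS by (intro g_sum fin) auto
  also have "\<dots> = linear_combination R N (g \<circ> m) c"
    unfolding linear_combination_def using cR mS by (intro N.finsum_cong') (auto simp: gD)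
  finally show ?thesis .
qed

lemma projective_lifting:
  fixes P :: "('a, 'b) module"
  assumes P: "projective_module R P" and M: "right_module R M" and N: "right_module R N"
    and g: "g \<in> epimorphisms R M N" and f: "f \<in> linear_maps R P N"
  shows "\<exists>h\<in>linear_maps R P M. \<forall>x\<in>carrier P. g (h x) = f x"
proof -
  interpret P: right_module R P
    using P by (simp add: projective_module_def)
  interpret N: right_module R N by fact
  let ?F = "free_right_module R (carrier P)"
  have F: "right_module R ?F"
    by (rule right_module_free [OF P.R.ring_axioms])
  let ?e = "linear_combination R P id"
  have e: "?e \<in> linear_maps R ?F P"
    by (rule linear_combination_linear [OF P.right_module_axioms]) auto
  have "x \<in> ?e ` carrier ?F" if x: "x \<in> carrier P" for x
  proof
    let ?c = "\<lambda>y. if y = x then \<one>\<^bsub>R\<^esub> else \<zero>\<^bsub>R\<^esub>"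
    show c: "?c \<in> carrier ?F"
      using x by (auto simp: free_right_module_def)
    have "?e ?c = (\<Oplus>\<^bsub>P\<^esub>y\<in>{x}. ?c y \<odot>\<^bsub>P\<^esub> id y)"
      by (rule linear_combination_superset [OF P.right_module_axioms c]) (use x in auto)
    also have "\<dots> = x"
      using x by simp
    finally show "x = ?e ?c" ..
  qed
  then have "?e \<in> epimorphisms R ?F P"
    using linear_mapsD(1) [OF e] e by (auto simp: epimorphisms_def)
  moreover have "(\<lambda>x. x) \<in> linear_maps R P P"
    by (simp add: linear_maps_def)
  ultimately obtain s where s: "s \<in> linear_maps R P ?F" "\<And>x. x \<in> carrier P \<Longrightarrow> ?e (s x) = x"
    using P F P.right_module_axioms unfolding projective_module_def by blast
  have gl: "g \<in> linear_maps R M N" and onto: "g ` carrier M = carrier N"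
    using g by (auto simp: epimorphisms_def)
  define m where "m x = (SOME y. y \<in> carrier M \<and> g y = f x)" for x
  have m: "m x \<in> carrier M \<and> g (m x) = f x" if "x \<in> carrier P" for x
  proof -
    have "f x \<in> g ` carrier M"
      using onto linear_mapsD(1) [OF f that] by simp
    then obtain y where "y \<in> carrier M \<and> g y = f x"
      by (elim imageE) simp
    then show ?thesis
      unfolding m_def by (rule someI)
  qed
  then have mc: "m \<in> carrier P \<rightarrow> carrier M"
    by auto
  let ?h = "\<lambda>x. linear_combination R M m (s x)"
  note lD = linear_mapsD [OF linear_combination_linear [OF M mc]]
  note sD = linear_mapsD [OF s(1)]
  have "?h \<in> linear_maps R P M"
    unfolding linear_maps_def using lD sD by auto
  moreover have "g (?h x) = f x" if x: "x \<in> carrier P" for x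
  proof -
    have sx: "s x \<in> carrier ?F"
      by (rule sD(1) [OF x])
    have "g (?h x) = linear_combination R N (g \<circ> m) (s x)"
      by (rule linear_map_linear_combination [OF M N gl mc sx])
    also have "\<dots> = linear_combination R N (f \<circ> id) (s x)"
    proof -
      have "{y. s x y \<noteq> \<zero>\<^bsub>R\<^esub>} \<subseteq> carrier P" "s x y \<in> carrier R" for y
        using sx by (auto simp: free_right_module_def)
      then show ?thesis
        unfolding linear_combination_def using m linear_mapsD(1) [OF f]
        by (intro N.finsum_cong') auto
    qed
    also have "\<dots> = f (?e (s x))"
      by (rule linear_map_linear_combination [OF P.right_module_axioms N f _ sx, symmetric]) auto
    also have "\<dots> = f x"
      using s(2) [OF x] by simp
    finally show ?thesis .
  qed
  ultimately show ?thesis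
    by (intro bexI [of _ ?h] ballI)
qed

definition projective_delta_cover ::
  "('a, 'r) ring_scheme \<Rightarrow> ('a, 'c) module \<Rightarrow> ('a, 'b) module \<Rightarrow> ('c \<Rightarrow> 'b) \<Rightarrow> bool"
  where "projective_delta_cover R P M f \<longleftrightarrow>
    projective_module R P \<and> f \<in> epimorphisms R P M \<and> delta_small R P (a_kernel P M f)"


section \<open>Tensor products and flat modules\<close>

definition tensor_relators ::
  "('a, 'r) ring_scheme \<Rightarrow> ('a, 'b, 'm) module_scheme \<Rightarrow> ('a, 'c, 'n) module_scheme \<Rightarrow>
    ('b \<times> 'c \<Rightarrow>\<^sub>0 int) set"
  where "tensor_relators R M N =
    {frag_of (x \<oplus>\<^bsub>M\<^esub> x', y) - frag_of (x, y) - frag_of (x', y) | x x' y.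
      x \<in> carrier M \<and> x' \<in> carrier M \<and> y \<in> carrier N} \<union>
    {frag_of (x, y \<oplus>\<^bsub>N\<^esub> y') - frag_of (x, y) - frag_of (x, y') | x y y'.
      x \<in> carrier M \<and> y \<in> carrier N \<and> y' \<in> carrier N} \<union>
    {frag_of (a \<odot>\<^bsub>M\<^esub> x, y) - frag_of (x, a \<odot>\<^bsub>N\<^esub> y) | a x y.
      a \<in> carrier R \<and> x \<in> carrier M \<and> y \<in> carrier N}"

definition tensor_relations ::
  "('a, 'r) ring_scheme \<Rightarrow> ('a, 'b, 'm) module_scheme \<Rightarrow> ('a, 'c, 'n) module_scheme \<Rightarrow>
    ('b \<times> 'c \<Rightarrow>\<^sub>0 int) set"
  where "tensor_relations R M N =
    generate (free_Abelian_group (carrier M \<times> carrier N)) (tensor_relators R M N)"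

text \<open>\<open>M \<otimes>\<^sub>R N\<close> for a right module \<open>M\<close> and a left module \<open>N\<close>, as an abelian group (written
  multiplicatively, as is usual in the library).\<close>

definition tensor_product ::
  "('a, 'r) ring_scheme \<Rightarrow> ('a, 'b, 'm) module_scheme \<Rightarrow> ('a, 'c, 'n) module_scheme \<Rightarrow>
    ('b \<times> 'c \<Rightarrow>\<^sub>0 int) set monoid"
  where "tensor_product R M N =
    free_Abelian_group (carrier M \<times> carrier N) Mod tensor_relations R M N"

definition pure_tensor ::
  "('a, 'r) ring_scheme \<Rightarrow> ('a, 'b, 'm) module_scheme \<Rightarrow> ('a, 'c, 'n) module_scheme \<Rightarrow>
    'b \<Rightarrow> 'c \<Rightarrow> ('b \<times> 'c \<Rightarrow>\<^sub>0 int) set"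
  where "pure_tensor R M N x y =
    tensor_relations R M N #>\<^bsub>free_Abelian_group (carrier M \<times> carrier N)\<^esub> frag_of (x, y)"

text \<open>\<open>M \<otimes> h : M \<otimes>\<^sub>R N \<rightarrow> M \<otimes>\<^sub>R N'\<close>, acting on cosets of formal sums; well-definedness and
  additivity are proved in \<open>tensor_map_hom\<close>, the value on pure tensors in
  \<open>tensor_map_pure_tensor\<close>.\<close>

definition formal_map :: "('c \<Rightarrow> 'd) \<Rightarrow> ('b \<times> 'c \<Rightarrow>\<^sub>0 int) \<Rightarrow> ('b \<times> 'd \<Rightarrow>\<^sub>0 int)"
  where "formal_map h = frag_extend (\<lambda>(x, y). frag_of (x, h y))"

definition tensor_map ::
  "('a, 'r) ring_scheme \<Rightarrow> ('a, 'b, 'm) module_scheme \<Rightarrow> ('a, 'd, 'n) module_scheme \<Rightarrow>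
    ('c \<Rightarrow> 'd) \<Rightarrow> ('b \<times> 'c \<Rightarrow>\<^sub>0 int) set \<Rightarrow> ('b \<times> 'd \<Rightarrow>\<^sub>0 int) set"
  where "tensor_map R M N' h C =
    the_elem ((\<lambda>u. tensor_relations R M N'
      #>\<^bsub>free_Abelian_group (carrier M \<times> carrier N')\<^esub> formal_map h u) ` C)"

lemma tensor_relators_closed:
  fixes M :: "('a, 'b, 'm) module_scheme" and N :: "('a, 'd, 'n) module_scheme"
  assumes "right_module R M" "left_module R N"
  shows "tensor_relators R M N \<subseteq> carrier (free_Abelian_group (carrier M \<times> carrier N))"
proof -
  interpret M: right_module R M by fact
  interpret N: left_module R N by fact
  show ?thesis
    unfolding tensor_relators_def by (auto dest!: subsetD [OF keys_diff])
qed

lemma tensor_relations_normal: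
  assumes "right_module R M" "left_module R N"
  shows "tensor_relations R M N \<lhd> free_Abelian_group (carrier M \<times> carrier N)"
  unfolding tensor_relations_def
  by (intro comm_group.subgroup_imp_normal abelian_free_Abelian_group
      group.generate_is_subgroup group_free_Abelian_group tensor_relators_closed assms)

lemma formal_map_add: "formal_map h (u + v) = formal_map h u + formal_map h v"
  and formal_map_diff: "formal_map h (u - v) = formal_map h u - formal_map h v"
  and formal_map_minus: "formal_map h (- u) = - formal_map h u"
  and formal_map_0: "formal_map h 0 = 0"
  and formal_map_of: "formal_map h (frag_of (x, y)) = frag_of (x, h y)"
  by (simp_all add: formal_map_def frag_extend_add frag_extend_diff frag_extend_minus)

lemma formal_map_closed:
  assumes "h \<in> carrier N \<rightarrow> carrier N'"
    and "u \<in> carrier (free_Abelian_group (carrier M \<times> carrier N))"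
  shows "formal_map h u \<in> carrier (free_Abelian_group (carrier M \<times> carrier N'))"
  using assms keys_frag_extend [of "\<lambda>(x, y). frag_of (x, h y)" u]
  unfolding formal_map_def by fastforce

lemma formal_map_relators:
  assumes h: "h \<in> linear_maps R N N'" and u: "u \<in> tensor_relators R M N"
  shows "formal_map h u \<in> tensor_relators R M N'"
proof -
  note hD = linear_mapsD [OF h]
  consider (1) x x' y where "x \<in> carrier M" "x' \<in> carrier M" "y \<in> carrier N"
      "u = frag_of (x \<oplus>\<^bsub>M\<^esub> x', y) - frag_of (x, y) - frag_of (x', y)"
    | (2) x y y' where "x \<in> carrier M" "y \<in> carrier N" "y' \<in> carrier N"
      "u = frag_of (x, y \<oplus>\<^bsub>N\<^esub> y') - frag_of (x, y) - frag_of (x, y')"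
    | (3) a x y where "a \<in> carrier R" "x \<in> carrier M" "y \<in> carrier N"
      "u = frag_of (a \<odot>\<^bsub>M\<^esub> x, y) - frag_of (x, a \<odot>\<^bsub>N\<^esub> y)"
    using u unfolding tensor_relators_def by blast
  then show ?thesis
  proof cases
    case 1
    with hD(1) show ?thesis
      unfolding tensor_relators_def by (simp add: formal_map_diff formal_map_of) blast
  next
    case 2
    with hD(1) show ?thesis
      unfolding tensor_relators_def by (simp add: formal_map_diff formal_map_of hD(2)) blast
  next
    case 3
    with hD(1) show ?thesis
      unfolding tensor_relators_def by (simp add: formal_map_diff formal_map_of hD(3)) blast
  qed
qed

lemma formal_map_relations:
  assumes "right_module R M" "left_module R N" "left_module R N'"
    and h: "h \<in> linear_maps R N N'" and u: "u \<in> tensor_relations R M N"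
  shows "formal_map h u \<in> tensor_relations R M N'"
  using u unfolding tensor_relations_def
proof induction
  case one
  show ?case
    using generate.one [of "free_Abelian_group (carrier M \<times> carrier N')" "tensor_relators R M N'"]
    by (simp add: formal_map_0)
next
  case (incl u)
  then show ?case
    by (intro generate.incl formal_map_relators [OF h])
next
  case (inv u)
  have r: "formal_map h u \<in> tensor_relators R M N'"
    by (rule formal_map_relators [OF h inv])
  have "Poly_Mapping.keys u \<subseteq> carrier M \<times> carrier N"
    "Poly_Mapping.keys (formal_map h u) \<subseteq> carrier M \<times> carrier N'"
    using tensor_relators_closed [OF assms(1,2)] tensor_relators_closed [OF assms(1,3)] inv r
    unfolding carrier_free_Abelian_group_iff [symmetric] by blast+
  then show ?case
    using generate.inv [OF r, of "free_Abelian_group (carrier M \<times> carrier N')"]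
    by (simp add: formal_map_minus)
next
  case (eng u v)
  then show ?case
    using generate.eng [OF eng.IH] by (simp add: formal_map_add)
qed

context
  fixes R :: "('a, 'r) ring_scheme" and M :: "('a, 'b, 'm) module_scheme"
    and N :: "('a, 'c, 'n) module_scheme" and N' :: "('a, 'd, 'k) module_scheme" and h
  assumes M: "right_module R M" and N: "left_module R N" and N': "left_module R N'"
    and h: "h \<in> linear_maps R N N'"
begin

interpretation G: normal "tensor_relations R M N" "free_Abelian_group (carrier M \<times> carrier N)"
  by (rule tensor_relations_normal [OF M N])

interpretation G': normal "tensor_relations R M N'" "free_Abelian_group (carrier M \<times> carrier N')"
  by (rule tensor_relations_normal [OF M N'])

lemma tensor_map_coset:
  assumes u: "u \<in> carrier (free_Abelian_group (carrier M \<times> carrier N))"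
  shows "tensor_map R M N' h
      (tensor_relations R M N #>\<^bsub>free_Abelian_group (carrier M \<times> carrier N)\<^esub> u) =
    tensor_relations R M N' #>\<^bsub>free_Abelian_group (carrier M \<times> carrier N')\<^esub> formal_map h u"
proof -
  have hc: "h \<in> carrier N \<rightarrow> carrier N'"
    using h by (simp add: linear_maps_def)
  have fu: "formal_map h u \<in> carrier (free_Abelian_group (carrier M \<times> carrier N'))"
    by (rule formal_map_closed [OF hc u])
  have eq: "tensor_relations R M N' #>\<^bsub>free_Abelian_group (carrier M \<times> carrier N')\<^esub> formal_map h v =
      tensor_relations R M N' #>\<^bsub>free_Abelian_group (carrier M \<times> carrier N')\<^esub> formal_map h u"
    if v: "v \<in> tensor_relations R M N #>\<^bsub>free_Abelian_group (carrier M \<times> carrier N)\<^esub> u" for v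
  proof -
    obtain k where k: "k \<in> tensor_relations R M N" "v = k + u"
      using v by (auto simp: r_coset_def)
    have "formal_map h k \<in> tensor_relations R M N'"
      by (rule formal_map_relations [OF M N N' h k(1)])
    then have "formal_map h v \<in>
        tensor_relations R M N' #>\<^bsub>free_Abelian_group (carrier M \<times> carrier N')\<^esub> formal_map h u"
      using k(2) by (auto simp: r_coset_def formal_map_add)
    then show ?thesis
      by (rule G'.repr_independence [OF _ fu G'.subgroup_axioms, symmetric])
  qed
  have "u \<in> tensor_relations R M N #>\<^bsub>free_Abelian_group (carrier M \<times> carrier N)\<^esub> u"
    by (rule G.rcos_self [OF u G.subgroup_axioms])
  then have ne: "tensor_relations R M N #>\<^bsub>free_Abelian_group (carrier M \<times> carrier N)\<^esub> u \<noteq> {}"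
    by blast
  show ?thesis
    unfolding tensor_map_def by (rule the_elem_image_unique) (rule ne, erule eq)
qed

lemma tensor_map_pure_tensor:
  assumes "x \<in> carrier M" "y \<in> carrier N"
  shows "tensor_map R M N' h (pure_tensor R M N x y) = pure_tensor R M N' x (h y)"
  using assms unfolding pure_tensor_def by (subst tensor_map_coset) (simp_all add: formal_map_of)

lemma tensor_map_hom:
  "tensor_map R M N' h \<in> hom (tensor_product R M N) (tensor_product R M N')"
proof (rule homI)
  have hc: "h \<in> carrier N \<rightarrow> carrier N'"
    using h by (simp add: linear_maps_def)
  fix C assume "C \<in> carrier (tensor_product R M N)"
  then obtain u where u: "u \<in> carrier (free_Abelian_group (carrier M \<times> carrier N))"
      "C = tensor_relations R M N #>\<^bsub>free_Abelian_group (carrier M \<times> carrier N)\<^esub> u"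
    by (auto simp: tensor_product_def FactGroup_def RCOSETS_def)
  show "tensor_map R M N' h C \<in> carrier (tensor_product R M N')"
    using formal_map_closed [OF hc u(1)] unfolding u(2) tensor_map_coset [OF u(1)]
    by (auto simp: tensor_product_def FactGroup_def RCOSETS_def simp del: carrier_free_Abelian_group_iff)
  fix D assume "D \<in> carrier (tensor_product R M N)"
  then obtain v where v: "v \<in> carrier (free_Abelian_group (carrier M \<times> carrier N))"
      "D = tensor_relations R M N #>\<^bsub>free_Abelian_group (carrier M \<times> carrier N)\<^esub> v"
    by (auto simp: tensor_product_def FactGroup_def RCOSETS_def)
  have uv: "u \<otimes>\<^bsub>free_Abelian_group (carrier M \<times> carrier N)\<^esub> v
      \<in> carrier (free_Abelian_group (carrier M \<times> carrier N))"
    using u(1) v(1) by (rule G.m_closed)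
  show "tensor_map R M N' h (C \<otimes>\<^bsub>tensor_product R M N\<^esub> D) =
      tensor_map R M N' h C \<otimes>\<^bsub>tensor_product R M N'\<^esub> tensor_map R M N' h D"
    using G'.rcos_sum [OF formal_map_closed [OF hc u(1)] formal_map_closed [OF hc v(1)]]
    unfolding u(2) v(2) tensor_map_coset [OF u(1)] tensor_map_coset [OF v(1)]
    by (simp only: tensor_product_def FactGroup_def monoid.simps G.rcos_sum [OF u(1) v(1)]
        tensor_map_coset [OF uv [unfolded mult_free_Abelian_group]] mult_free_Abelian_group formal_map_add)
qed

end

text \<open>
  \<open>F\<close> is flat if \<open>F \<otimes>\<^sub>R _\<close> preserves monomorphisms of left modules. The test modules range over
  the type \<open>'a list\<close>, on which every finitely generated left \<open>R\<close>-module has an isomorphic copy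
  (represent each element by a list of coefficients with respect to fixed generators). Since
  an element of the kernel of \<open>F \<otimes>\<^sub>R L' \<rightarrow> F \<otimes>\<^sub>R L\<close>, and the relations witnessing this,
  involve only finitely many elements of \<open>L'\<close> and \<open>L\<close>, the property extends to modules on
  arbitrary types; see lemma \<open>flat_preserves_monomorphisms\<close> below.
\<close>

definition flat_module :: "('a, 'r) ring_scheme \<Rightarrow> ('a, 'b, 'm) module_scheme \<Rightarrow> bool"
  where "flat_module R F \<longleftrightarrow>
    right_module R F \<and>
    (\<forall>(L' :: ('a, 'a list) module) (L :: ('a, 'a list) module) h.
      left_module R L' \<and> left_module R L \<and> h \<in> monomorphisms R L' L \<longrightarrow>
      inj_on (tensor_map R F L h) (carrier (tensor_product R F L')))"

lemma formal_map_compose: "formal_map g (formal_map h u) = formal_map (g \<circ> h) u"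
  by (rule frag_induction [of u UNIV])
    (auto simp: formal_map_of formal_map_diff formal_map_0)

lemma formal_map_id: "formal_map (\<lambda>y. y) u = u"
  by (rule frag_induction [of u UNIV])
    (auto simp: formal_map_of formal_map_diff formal_map_0)

lemma formal_map_cong:
  assumes "\<And>x y. (x, y) \<in> Poly_Mapping.keys u \<Longrightarrow> g y = h y"
  shows "formal_map g u = formal_map h u"
  unfolding formal_map_def by (rule frag_extend_eq) (auto simp: assms)

lemma inj_on_tensor_map_iff:
  assumes M: "right_module R M" and N: "left_module R N" and N': "left_module R N'"
    and h: "h \<in> linear_maps R N N'"
  shows "inj_on (tensor_map R M N' h) (carrier (tensor_product R M N)) \<longleftrightarrow>
    (\<forall>u\<in>carrier (free_Abelian_group (carrier M \<times> carrier N)).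
      formal_map h u \<in> tensor_relations R M N' \<longrightarrow> u \<in> tensor_relations R M N)"
    (is "?inj \<longleftrightarrow> ?refl")
proof -
  let ?G = "free_Abelian_group (carrier M \<times> carrier N)"
  let ?G' = "free_Abelian_group (carrier M \<times> carrier N')"
  interpret G: normal "tensor_relations R M N" ?G
    by (rule tensor_relations_normal [OF M N])
  interpret G': normal "tensor_relations R M N'" ?G'
    by (rule tensor_relations_normal [OF M N'])
  interpret T: group_hom "tensor_product R M N" "tensor_product R M N'" "tensor_map R M N' h"
    using tensor_map_hom [OF M N N' h] G.factorgroup_is_group G'.factorgroup_is_group
    by (simp add: group_hom_def group_hom_axioms_def tensor_product_def)
  have hc: "h \<in> carrier N \<rightarrow> carrier N'"
    using h by (simp add: linear_maps_def)
  have one: "\<one>\<^bsub>tensor_product R M N\<^esub> = tensor_relations R M N"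
    "\<one>\<^bsub>tensor_product R M N'\<^esub> = tensor_relations R M N'"
    by (simp_all add: tensor_product_def FactGroup_def)
  have coset: "tensor_relations R M N #>\<^bsub>?G\<^esub> u = tensor_relations R M N \<longleftrightarrow> u \<in> tensor_relations R M N"
    if "u \<in> carrier ?G" for u
    using G.rcos_self [OF that G.subgroup_axioms] G.rcos_const [of u] by auto
  have coset': "tensor_relations R M N' #>\<^bsub>?G'\<^esub> u = tensor_relations R M N' \<longleftrightarrow> u \<in> tensor_relations R M N'"
    if "u \<in> carrier ?G'" for u
    using G'.rcos_self [OF that G'.subgroup_axioms] G'.rcos_const [of u] by auto
  have "?inj \<longleftrightarrow> (\<forall>C\<in>carrier (tensor_product R M N).
      tensor_map R M N' h C = \<one>\<^bsub>tensor_product R M N'\<^esub> \<longrightarrow> C = \<one>\<^bsub>tensor_product R M N\<^esub>)"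
    using T.inj_on_one_iff by auto
  also have "\<dots> \<longleftrightarrow> (\<forall>u\<in>carrier ?G.
      tensor_map R M N' h (tensor_relations R M N #>\<^bsub>?G\<^esub> u) = tensor_relations R M N' \<longrightarrow>
      tensor_relations R M N #>\<^bsub>?G\<^esub> u = tensor_relations R M N)"
    unfolding one unfolding tensor_product_def FactGroup_def RCOSETS_def by auto
  also have "\<dots> \<longleftrightarrow> ?refl"
    by (rule ball_cong [OF refl])
      (simp only: tensor_map_coset [OF M N N' h] coset coset' formal_map_closed [OF hc])
  finally show ?thesis .
qed

lemma (in left_module) smult_uminus_one:
  assumes x: "x \<in> carrier M"
  shows "(\<ominus> \<one>) \<odot>\<^bsub>M\<^esub> x = \<ominus>\<^bsub>M\<^esub> x"
proof -
  have "\<zero> \<odot>\<^bsub>M\<^esub> x \<oplus>\<^bsub>M\<^esub> \<zero> \<odot>\<^bsub>M\<^esub> x = \<zero> \<odot>\<^bsub>M\<^esub> x"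
    using smult_add_scalar [of \<zero> \<zero> x] x by simp
  then have "\<zero> \<odot>\<^bsub>M\<^esub> x = \<zero>\<^bsub>M\<^esub>"
    using x M.add.l_cancel_one [of "\<zero> \<odot>\<^bsub>M\<^esub> x" "\<zero> \<odot>\<^bsub>M\<^esub> x"] by simp
  then have "(\<ominus> \<one>) \<odot>\<^bsub>M\<^esub> x \<oplus>\<^bsub>M\<^esub> x = \<zero>\<^bsub>M\<^esub>"
    using smult_add_scalar [of "\<ominus> \<one>" \<one> x] x by (simp add: R.l_neg)
  then show ?thesis
    using x by (intro M.minus_equality [symmetric]) auto
qed

lemma (in left_module) left_submoduleI:
  assumes "H \<subseteq> carrier M" "\<zero>\<^bsub>M\<^esub> \<in> H"
    and add: "\<And>x y. \<lbrakk>x \<in> H; y \<in> H\<rbrakk> \<Longrightarrow> x \<oplus>\<^bsub>M\<^esub> y \<in> H"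
    and smult: "\<And>a x. \<lbrakk>a \<in> carrier R; x \<in> H\<rbrakk> \<Longrightarrow> a \<odot>\<^bsub>M\<^esub> x \<in> H"
  shows "submodule H R M"
proof -
  have "\<ominus>\<^bsub>M\<^esub> x \<in> H" if "x \<in> H" for x
    using smult [of "\<ominus> \<one>" x] smult_uminus_one [of x] that assms(1) by auto
  then have "subgroup H (add_monoid M)"
    using assms by (intro M.add.subgroupI) (auto simp: a_inv_def)
  then show ?thesis
    using smult by (simp add: submodule_def submodule_axioms_def)
qed

lemma (in left_module) left_submodule_module:
  assumes "submodule H R M"
  shows "left_module R (M\<lparr>carrier := H\<rparr>)"
proof -
  interpret H: submodule H R M by fact
  have HM: "x \<in> carrier M" if "x \<in> H" for x
    using that H.subset by auto
  have "abelian_group (M\<lparr>carrier := H\<rparr>)"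
  proof (rule abelian_groupI)
    fix x assume "x \<in> carrier (M\<lparr>carrier := H\<rparr>)"
    then show "\<exists>y\<in>carrier (M\<lparr>carrier := H\<rparr>). y \<oplus>\<^bsub>M\<lparr>carrier := H\<rparr>\<^esub> x = \<zero>\<^bsub>M\<lparr>carrier := H\<rparr>\<^esub>"
      using H.m_inv_closed [of x] HM by (intro bexI [of _ "\<ominus>\<^bsub>M\<^esub> x"]) (auto simp: a_inv_def [symmetric] M.l_neg)
  qed (use H.m_closed H.one_closed HM in \<open>auto simp: M.a_ac\<close>)
  then show ?thesis
    unfolding left_module_def left_module_axioms_def
    using R.ring_axioms HM H.smult_closed
    by (auto simp: smult_add_scalar smult_add_vector smult_assoc)
qed

definition module_image :: "('b \<Rightarrow> 'c) \<Rightarrow> ('a, 'b, 'm) module_scheme \<Rightarrow> ('a, 'c) module"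
  where "module_image k M =
    \<lparr>carrier = k ` carrier M, monoid.mult = undefined, one = undefined, ring.zero = k \<zero>\<^bsub>M\<^esub>,
     add = (\<lambda>x y. k (inv_into (carrier M) k x \<oplus>\<^bsub>M\<^esub> inv_into (carrier M) k y)),
     smult = (\<lambda>a x. k (a \<odot>\<^bsub>M\<^esub> inv_into (carrier M) k x))\<rparr>"

lemma (in left_module) module_image:
  assumes k: "inj_on k (carrier M)"
  shows "left_module R (module_image k M)"
    and "k \<in> linear_maps R M (module_image k M)"
    and "inv_into (carrier M) k \<in> linear_maps R (module_image k M) M"
proof -
  have [simp]: "inv_into (carrier M) k (k x) = x" if "x \<in> carrier M" for x
    using that k by simp
  have "abelian_group (module_image k M)"
  proof (rule abelian_groupI)
    fix x assume "x \<in> carrier (module_image k M)"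
    then obtain y where y: "y \<in> carrier M" "x = k y"
      by (auto simp: module_image_def)
    then show "\<exists>z\<in>carrier (module_image k M). z \<oplus>\<^bsub>module_image k M\<^esub> x = \<zero>\<^bsub>module_image k M\<^esub>"
      by (intro bexI [of _ "k (\<ominus>\<^bsub>M\<^esub> y)"]) (auto simp: module_image_def M.l_neg)
  qed (auto simp: module_image_def M.a_ac)
  then show "left_module R (module_image k M)"
    unfolding left_module_def left_module_axioms_def
    using R.ring_axioms
    by (auto simp: module_image_def smult_add_scalar smult_add_vector smult_assoc)
  show "k \<in> linear_maps R M (module_image k M)"
    "inv_into (carrier M) k \<in> linear_maps R (module_image k M) M"
    by (auto simp: linear_maps_def module_image_def)
qed

lemma (in left_module) finitely_generated_list_code:
  assumes "finite A" "A \<subseteq> carrier M"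
  shows "\<exists>H (k :: 'b \<Rightarrow> 'a list). submodule H R M \<and> A \<subseteq> H \<and> inj_on k H \<and>
    (\<forall>H'. submodule H' R M \<and> A \<subseteq> H' \<longrightarrow> H \<subseteq> H')"
  using assms
proof (induction A)
  case empty
  have "a \<odot>\<^bsub>M\<^esub> \<zero>\<^bsub>M\<^esub> = \<zero>\<^bsub>M\<^esub>" if "a \<in> carrier R" for a
    using smult_add_vector [of a "\<zero>\<^bsub>M\<^esub>" "\<zero>\<^bsub>M\<^esub>"] that
      M.add.l_cancel_one [of "a \<odot>\<^bsub>M\<^esub> \<zero>\<^bsub>M\<^esub>" "a \<odot>\<^bsub>M\<^esub> \<zero>\<^bsub>M\<^esub>"] by simp
  then have "submodule {\<zero>\<^bsub>M\<^esub>} R M"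
    by (intro left_submoduleI) auto
  moreover have "\<zero>\<^bsub>M\<^esub> \<in> H'" if "submodule H' R M" for H'
    using subgroup.one_closed [OF submodule.axioms(1) [OF that]] by simp
  ultimately show ?case
    by (intro exI [of _ "{\<zero>\<^bsub>M\<^esub>}"] exI) auto
next
  case (insert y A)
  then have "\<exists>H (k :: 'b \<Rightarrow> 'a list). submodule H R M \<and> A \<subseteq> H \<and> inj_on k H \<and>
      (\<forall>H'. submodule H' R M \<and> A \<subseteq> H' \<longrightarrow> H \<subseteq> H')"
    by simp
  then obtain H and k :: "'b \<Rightarrow> 'a list" where "submodule H R M \<and> A \<subseteq> H \<and> inj_on k H \<and>
      (\<forall>H'. submodule H' R M \<and> A \<subseteq> H' \<longrightarrow> H \<subseteq> H')"
    by (elim exE) (rule that)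
  then have H: "submodule H R M" "A \<subseteq> H" "inj_on k H"
      "\<And>H'. submodule H' R M \<Longrightarrow> A \<subseteq> H' \<Longrightarrow> H \<subseteq> H'"
    by simp_all
  interpret H: submodule H R M by fact
  have HM: "x \<in> carrier M" if "x \<in> H" for x
    using that H.subset by auto
  have y: "y \<in> carrier M"
    using insert.prems by simp
  have H0: "\<zero>\<^bsub>M\<^esub> \<in> H" and Hadd: "\<And>u v. u \<in> H \<Longrightarrow> v \<in> H \<Longrightarrow> u \<oplus>\<^bsub>M\<^esub> v \<in> H"
    using H.one_closed H.m_closed by simp_all
  define K where "K = {a \<odot>\<^bsub>M\<^esub> y \<oplus>\<^bsub>M\<^esub> x | a x. a \<in> carrier R \<and> x \<in> H}"
  have KI: "z \<in> K" if "a \<in> carrier R" "x \<in> H" "z = a \<odot>\<^bsub>M\<^esub> y \<oplus>\<^bsub>M\<^esub> x" for a x z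
    using that by (auto simp: K_def)
  have zy: "\<zero> \<odot>\<^bsub>M\<^esub> y = \<zero>\<^bsub>M\<^esub>"
    using smult_add_scalar [of \<zero> \<zero> y] y
      M.add.l_cancel_one [of "\<zero> \<odot>\<^bsub>M\<^esub> y" "\<zero> \<odot>\<^bsub>M\<^esub> y"] by simp
  have "submodule K R M"
  proof (rule left_submoduleI)
    show "K \<subseteq> carrier M"
      using y HM by (auto simp: K_def)
    show "\<zero>\<^bsub>M\<^esub> \<in> K"
      by (rule KI [of \<zero> "\<zero>\<^bsub>M\<^esub>"]) (auto simp: zy H0)
  next
    fix u v assume "u \<in> K" "v \<in> K"
    then obtain a x b z where *: "a \<in> carrier R" "x \<in> H" "u = a \<odot>\<^bsub>M\<^esub> y \<oplus>\<^bsub>M\<^esub> x"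
        "b \<in> carrier R" "z \<in> H" "v = b \<odot>\<^bsub>M\<^esub> y \<oplus>\<^bsub>M\<^esub> z"
      by (auto simp: K_def)
    show "u \<oplus>\<^bsub>M\<^esub> v \<in> K"
      by (rule KI [of "a \<oplus> b" "x \<oplus>\<^bsub>M\<^esub> z"])
        (use * y HM Hadd in \<open>auto simp: smult_add_scalar M.a_ac\<close>)
  next
    fix c u assume "c \<in> carrier R" "u \<in> K"
    then obtain a x where *: "a \<in> carrier R" "x \<in> H" "u = a \<odot>\<^bsub>M\<^esub> y \<oplus>\<^bsub>M\<^esub> x"
      by (auto simp: K_def)
    show "c \<odot>\<^bsub>M\<^esub> u \<in> K"
      by (rule KI [of "c \<otimes> a" "c \<odot>\<^bsub>M\<^esub> x"])
        (use * \<open>c \<in> carrier R\<close> y HM H.smult_closed in \<open>auto simp: smult_add_vector smult_assoc\<close>)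
  qed
  moreover have "insert y A \<subseteq> K"
  proof -
    have "y \<in> K"
      by (rule KI [of \<one> "\<zero>\<^bsub>M\<^esub>"]) (use y H0 in auto)
    moreover have "x \<in> K" if "x \<in> A" for x
      by (rule KI [of \<zero> x]) (use that H(2) HM in \<open>auto simp: zy\<close>)
    ultimately show ?thesis
      by blast
  qed
  moreover have "K \<subseteq> H'" if H': "submodule H' R M" "insert y A \<subseteq> H'" for H'
  proof -
    interpret H': submodule H' R M by fact
    have "H \<subseteq> H'"
      using H(4) H' by simp
    then show ?thesis
      using H'(2) H'.m_closed H'.smult_closed by (auto simp: K_def)
  qed
  moreover have "\<exists>k' :: 'b \<Rightarrow> 'a list. inj_on k' K"
  proof -
    define k' where "k' z = (SOME l. \<exists>a x. a \<in> carrier R \<and> x \<in> H \<and> z = a \<odot>\<^bsub>M\<^esub> y \<oplus>\<^bsub>M\<^esub> x \<and> l = a # k x)" for z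
    have k': "\<exists>a x. a \<in> carrier R \<and> x \<in> H \<and> z = a \<odot>\<^bsub>M\<^esub> y \<oplus>\<^bsub>M\<^esub> x \<and> k' z = a # k x"
      if "z \<in> K" for z
      unfolding k'_def by (rule someI_ex) (use that in \<open>auto simp: K_def\<close>)
    have "inj_on k' K"
    proof (rule inj_onI)
      fix u v assume uv: "u \<in> K" "v \<in> K" "k' u = k' v"
      obtain a x where 1: "x \<in> H" "u = a \<odot>\<^bsub>M\<^esub> y \<oplus>\<^bsub>M\<^esub> x" "k' u = a # k x"
        using k' [OF uv(1)] by auto
      obtain b z where 2: "z \<in> H" "v = b \<odot>\<^bsub>M\<^esub> y \<oplus>\<^bsub>M\<^esub> z" "k' v = b # k z"
        using k' [OF uv(2)] by auto
      have "a = b" "k x = k z"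
        using uv(3) 1(3) 2(3) by auto
      then show "u = v"
        using inj_onD [OF H(3), of x z] 1 2 by simp
    qed
    then show ?thesis
      by (intro exI [of _ k'])
  qed
  then obtain k' :: "'b \<Rightarrow> 'a list" where "inj_on k' K"
    by (elim exE) (rule that)
  ultimately show ?case
    by (intro exI [of _ K] exI [of _ k']) simp
qed

lemma tensor_relators_finite_support:
  assumes "w \<in> tensor_relators R M N"
  shows "\<exists>A. finite A \<and> A \<subseteq> carrier N \<and>
    (\<forall>H. A \<subseteq> H \<longrightarrow> w \<in> tensor_relators R M (N\<lparr>carrier := H\<rparr>))"
proof -
  consider (1) x x' y where "x \<in> carrier M" "x' \<in> carrier M" "y \<in> carrier N"
      "w = frag_of (x \<oplus>\<^bsub>M\<^esub> x', y) - frag_of (x, y) - frag_of (x', y)"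
    | (2) x y y' where "x \<in> carrier M" "y \<in> carrier N" "y' \<in> carrier N"
      "w = frag_of (x, y \<oplus>\<^bsub>N\<^esub> y') - frag_of (x, y) - frag_of (x, y')"
    | (3) a x y where "a \<in> carrier R" "x \<in> carrier M" "y \<in> carrier N"
      "w = frag_of (a \<odot>\<^bsub>M\<^esub> x, y) - frag_of (x, a \<odot>\<^bsub>N\<^esub> y)"
    using assms unfolding tensor_relators_def by blast
  then show ?thesis
  proof cases
    case 1
    then show ?thesis
      unfolding tensor_relators_def by (intro exI [of _ "{y}"]) (simp, blast)
  next
    case 2
    then show ?thesis
      unfolding tensor_relators_def by (intro exI [of _ "{y, y'}"]) (simp, blast)
  next
    case 3
    then show ?thesis
      unfolding tensor_relators_def by (intro exI [of _ "{y}"]) (simp, blast)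
  qed
qed

lemma tensor_relations_finite_support:
  assumes M: "right_module R M" and N: "left_module R N"
    and w: "w \<in> tensor_relations R M N"
  shows "\<exists>A. finite A \<and> A \<subseteq> carrier N \<and>
    (\<forall>H. submodule H R N \<and> A \<subseteq> H \<longrightarrow> w \<in> tensor_relations R M (N\<lparr>carrier := H\<rparr>))"
  using w unfolding tensor_relations_def [of R M N]
proof induction
  case one
  have "0 \<in> tensor_relations R M (N\<lparr>carrier := H\<rparr>)" for H
    unfolding tensor_relations_def
    using generate.one [of "free_Abelian_group (carrier M \<times> carrier (N\<lparr>carrier := H\<rparr>))"]
    by (simp only: one_free_Abelian_group)
  then show ?case
    by (intro exI [of _ "{}"]) simp
next
  case (incl w)
  obtain A where A: "finite A" "A \<subseteq> carrier N"
      "\<And>H. A \<subseteq> H \<Longrightarrow> w \<in> tensor_relators R M (N\<lparr>carrier := H\<rparr>)"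
    using tensor_relators_finite_support [OF incl] by auto
  then show ?case
    unfolding tensor_relations_def by (intro exI [of _ A] conjI allI impI generate.incl) simp_all
next
  case (inv w)
  obtain A where A: "finite A" "A \<subseteq> carrier N"
      "\<And>H. A \<subseteq> H \<Longrightarrow> w \<in> tensor_relators R M (N\<lparr>carrier := H\<rparr>)"
    using tensor_relators_finite_support [OF inv] by auto
  have minus: "inv\<^bsub>free_Abelian_group (carrier M \<times> carrier N)\<^esub> w = - w"
    by (rule inv_free_Abelian_group, unfold carrier_free_Abelian_group_iff [symmetric])
      (rule subsetD [OF tensor_relators_closed [OF M N] inv])
  have "- w \<in> tensor_relations R M (N\<lparr>carrier := H\<rparr>)" if H: "submodule H R N" "A \<subseteq> H" for H
  proof -
    note NH = left_module.left_submodule_module [OF N H(1)]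
    note wH = A(3) [OF H(2)]
    have "inv\<^bsub>free_Abelian_group (carrier M \<times> carrier (N\<lparr>carrier := H\<rparr>))\<^esub> w = - w"
      by (rule inv_free_Abelian_group, unfold carrier_free_Abelian_group_iff [symmetric])
        (rule subsetD [OF tensor_relators_closed [OF M NH] wH])
    then show ?thesis
      unfolding tensor_relations_def
      using generate.inv [OF wH, of "free_Abelian_group (carrier M \<times> carrier (N\<lparr>carrier := H\<rparr>))"]
      by simp
  qed
  with A(1,2) show ?case
    unfolding minus by (intro exI [of _ A]) simp
next
  case (eng v w)
  from eng.IH(1) obtain A where A: "finite A \<and> A \<subseteq> carrier N \<and>
      (\<forall>H. submodule H R N \<and> A \<subseteq> H \<longrightarrow> v \<in> tensor_relations R M (N\<lparr>carrier := H\<rparr>))"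
    by (elim exE) (rule that)
  from eng.IH(2) obtain B where B: "finite B \<and> B \<subseteq> carrier N \<and>
      (\<forall>H. submodule H R N \<and> B \<subseteq> H \<longrightarrow> w \<in> tensor_relations R M (N\<lparr>carrier := H\<rparr>))"
    by (elim exE) (rule that)
  have "v + w \<in> tensor_relations R M (N\<lparr>carrier := H\<rparr>)"
    if H: "submodule H R N" "A \<union> B \<subseteq> H" for H
  proof -
    have "v \<in> tensor_relations R M (N\<lparr>carrier := H\<rparr>)" "w \<in> tensor_relations R M (N\<lparr>carrier := H\<rparr>)"
      using A B H by simp_all
    from generate.eng [OF this [unfolded tensor_relations_def]] show ?thesis
      unfolding tensor_relations_def mult_free_Abelian_group .
  qed
  with A B show ?case
    unfolding mult_free_Abelian_group by (intro exI [of _ "A \<union> B"]) simp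
qed

lemma flat_preserves_monomorphisms:
  fixes F :: "('a, 'b, 'm) module_scheme" and L' :: "('a, 'c, 'k) module_scheme"
    and L :: "('a, 'd, 'n) module_scheme"
  assumes flat: "flat_module R F" and L': "left_module R L'" and L: "left_module R L"
    and h: "h \<in> monomorphisms R L' L"
  shows "inj_on (tensor_map R F L h) (carrier (tensor_product R F L'))"
proof -
  have F: "right_module R F"
    using flat by (simp add: flat_module_def)
  have hl: "h \<in> linear_maps R L' L" and h_inj: "inj_on h (carrier L')"
    using h by (auto simp: monomorphisms_def)
  note hD = linear_mapsD [OF hl]
  interpret L': left_module R L' by fact
  interpret L: left_module R L by fact
  have "u \<in> tensor_relations R F L'"
    if u: "u \<in> carrier (free_Abelian_group (carrier F \<times> carrier L'))"
      and hu: "formal_map h u \<in> tensor_relations R F L" for u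
  proof -
    define A where "A = snd ` Poly_Mapping.keys u"
    have keys: "Poly_Mapping.keys u \<subseteq> carrier F \<times> A" and A: "finite A" "A \<subseteq> carrier L'"
      using u by (force simp: A_def)+
    obtain B where B: "finite B" "B \<subseteq> carrier L"
      "\<And>H. submodule H R L \<Longrightarrow> B \<subseteq> H \<Longrightarrow> formal_map h u \<in> tensor_relations R F (L\<lparr>carrier := H\<rparr>)"
      using tensor_relations_finite_support [OF F L hu] by blast
    from L'.finitely_generated_list_code [OF A] obtain H' and k' :: "'c \<Rightarrow> 'a list"
      where *: "submodule H' R L' \<and> A \<subseteq> H' \<and> inj_on k' H' \<and>
        (\<forall>K. submodule K R L' \<and> A \<subseteq> K \<longrightarrow> H' \<subseteq> K)"
      by (elim exE) (rule that)
    then have H': "submodule H' R L'" "A \<subseteq> H'" "inj_on k' H'"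
      "\<And>K. submodule K R L' \<Longrightarrow> A \<subseteq> K \<Longrightarrow> H' \<subseteq> K"
      by simp_all
    have "finite (B \<union> h ` A)" "B \<union> h ` A \<subseteq> carrier L"
      using A B(1,2) hD(1) by auto
    from L.finitely_generated_list_code [OF this] obtain H and k :: "'d \<Rightarrow> 'a list"
      where *: "submodule H R L \<and> B \<union> h ` A \<subseteq> H \<and> inj_on k H \<and>
        (\<forall>K. submodule K R L \<and> B \<union> h ` A \<subseteq> K \<longrightarrow> H \<subseteq> K)"
      by (elim exE) (rule that)
    then have H: "submodule H R L" "B \<union> h ` A \<subseteq> H" "inj_on k H"
      by simp_all
    interpret H': submodule H' R L' by fact
    interpret H: submodule H R L by fact
    have H'L: "x \<in> carrier L'" if "x \<in> H'" for x
      using that H'.subset by auto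
    have hH: "h x \<in> H" if "x \<in> H'" for x
    proof -
      have "h \<zero>\<^bsub>L'\<^esub> \<oplus>\<^bsub>L\<^esub> h \<zero>\<^bsub>L'\<^esub> = h \<zero>\<^bsub>L'\<^esub>"
        using hD(2) [of "\<zero>\<^bsub>L'\<^esub>" "\<zero>\<^bsub>L'\<^esub>"] by simp
      then have h0: "h \<zero>\<^bsub>L'\<^esub> = \<zero>\<^bsub>L\<^esub>"
        using L.M.add.l_cancel_one [of "h \<zero>\<^bsub>L'\<^esub>" "h \<zero>\<^bsub>L'\<^esub>"] hD(1) by simp
      have "submodule {x \<in> carrier L'. h x \<in> H} R L'"
        using H.one_closed H.m_closed H.smult_closed by (intro L'.left_submoduleI) (auto simp: h0 hD)
      then show ?thesis
        using H'(4) [of "{x \<in> carrier L'. h x \<in> H}"] A(2) H(2) that by blast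
    qed
    let ?L' = "L'\<lparr>carrier := H'\<rparr>" and ?L = "L\<lparr>carrier := H\<rparr>"
    let ?T' = "module_image k' ?L'" and ?T = "module_image k ?L"
    interpret S': left_module R ?L'
      by (rule L'.left_submodule_module [OF H'(1)])
    interpret S: left_module R ?L
      by (rule L.left_submodule_module [OF H(1)])
    have "inj_on k' (carrier ?L')" "inj_on k (carrier ?L)"
      using H'(3) H(3) by simp_all
    note T' = S'.module_image [OF this(1)] and T = S.module_image [OF this(2)]
    define i where "i = inv_into H' k'"
    have i: "i \<in> linear_maps R ?T' ?L'"
      using T'(3) by (simp add: i_def)
    have ik: "i (k' x) = x" if "x \<in> H'" for x
      using that H'(3) by (simp add: i_def)
    let ?g = "k \<circ> (h \<circ> i)"
    have g: "?g \<in> linear_maps R ?T' ?T"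
    proof -
      have "h \<in> linear_maps R ?L' ?L"
        using hH hD H'L by (auto simp: linear_maps_def)
      then show ?thesis
        using i T(2) unfolding linear_maps_def by (auto simp: Pi_iff)
    qed
    have "inj_on ?g (carrier ?T')"
    proof (rule inj_onI)
      fix x y assume xy: "x \<in> carrier ?T'" "y \<in> carrier ?T'" "?g x = ?g y"
      then obtain x' y' where *: "x' \<in> H'" "x = k' x'" "y' \<in> H'" "y = k' y'"
        by (auto simp: module_image_def)
      then have "h x' = h y'"
        using xy(3) inj_onD [OF H(3), of "h x'" "h y'"] hH by (simp add: ik)
      then show "x = y"
        using inj_onD [OF h_inj, of x' y'] * H'L by simp
    qed
    then have inj: "inj_on (tensor_map R F ?T ?g) (carrier (tensor_product R F ?T'))"
      using flat T'(1) T(1) g unfolding flat_module_def monomorphisms_def by simp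
    have kc: "k' \<in> carrier ?L' \<rightarrow> carrier ?T'"
      using T'(2) by (simp add: linear_maps_def)
    have "u \<in> carrier (free_Abelian_group (carrier F \<times> carrier ?L'))"
      using keys H'(2) by auto
    then have u': "formal_map k' u \<in> carrier (free_Abelian_group (carrier F \<times> carrier ?T'))"
      by (rule formal_map_closed [OF kc])
    have keysH: "y \<in> H'" if "(x, y) \<in> Poly_Mapping.keys u" for x y
      using that keys H'(2) by auto
    have "formal_map ?g (formal_map k' u) = formal_map k (formal_map h u)"
      unfolding formal_map_compose by (rule formal_map_cong) (simp add: ik keysH)
    moreover have "formal_map h u \<in> tensor_relations R F ?L"
      using B(3) [OF H(1)] H(2) by simp
    then have "formal_map k (formal_map h u) \<in> tensor_relations R F ?T"
      by (rule formal_map_relations [OF F S.left_module_axioms T(1) T(2)])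
    ultimately have "formal_map k' u \<in> tensor_relations R F ?T'"
      using inj u' unfolding inj_on_tensor_map_iff [OF F T'(1) T(1) g] by simp
    moreover have "i \<in> linear_maps R ?T' L'"
      using i H'L by (auto simp: linear_maps_def)
    ultimately have "formal_map i (formal_map k' u) \<in> tensor_relations R F L'"
      using formal_map_relations [OF F T'(1) L'] by blast
    moreover have "formal_map i (formal_map k' u) = formal_map (\<lambda>y. y) u"
      unfolding formal_map_compose by (rule formal_map_cong) (simp add: ik keysH)
    ultimately show ?thesis
      by (simp add: formal_map_id)
  qed
  then show ?thesis
    unfolding inj_on_tensor_map_iff [OF F L' L hl] by blast
qed

end

theory Submission
  imports Defs
begin

text \<open>
  Let \<open>f : P \<rightarrow> F\<close> be a projective \<open>\<delta>\<close>-cover with kernel \<open>K\<close>. It suffices to find an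
  endomorphism \<open>\<rho>\<close> of \<open>P\<close> that kills \<open>K\<close> and satisfies \<open>f \<circ> \<rho> = f\<close>: it induces a linear section of \<open>f\<close>,
  so that \<open>F\<close> is a retract of \<open>P\<close>.

  Flatness of \<open>F\<close> enters through Villamayor's criterion: every \<open>k \<in> K\<close> is fixed by some
  endomorphism \<open>\<theta>\<close> of \<open>P\<close> with image in \<open>K\<close> (\<open>flat_kernel_fixed\<close>). One such \<open>\<theta>\<close> serves finitely many
  elements of \<open>K\<close> at once, but \<open>K\<close> need not be finitely generated.

  The \<open>\<delta>\<close>-smallness of \<open>K\<close> gives two things. If \<open>V + K = P\<close>, then \<open>V\<close> is a direct summand with a
  complement inside \<open>K\<close> (\<open>delta_small_projection\<close>). Moreover \<open>K\<close> lies in the socle of \<open>P\<close>, in the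
  form that every linear form \<open>P \<rightarrow> R\<close> maps \<open>K\<close> into \<open>S\<^sub>r\<close> (\<open>delta_small_fixed_dual_in_socle\<close>):
  for \<open>\<theta>\<close> fixing \<open>k\<close>, the image of \<open>1 - \<theta>\<close> is a summand of \<open>P\<close>, hence projective, so the kernel of
  \<open>1 - \<theta>\<close> is a direct summand of \<open>P\<close> that contains \<open>k\<close> and is contained in \<open>K\<close>; an essential
  right ideal that misses the value of a linear form at \<open>k\<close> would yield a proper submodule with
  singular quotient which together with this summand spans \<open>P\<close>. And what lies in all essential
  right ideals lies in \<open>S\<^sub>r\<close> (\<open>essential_avoiding\<close>).

  Since \<open>F\<close> is finitely generated, a finitely generated \<open>V\<close> with \<open>V + K = P\<close> exists. Then
  \<open>K \<inter> V \<subseteq> V S\<^sub>r\<close>, and as \<open>V\<close> and \<open>S\<^sub>r\<close> are finitely generated, \<open>V S\<^sub>r\<close> is a sum of finitely many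
  simple modules. An induction on their number produces a single \<open>\<theta>\<close> with image in \<open>K\<close> that is the
  identity on \<open>K \<inter> V\<close> (\<open>endomorphism_fixing_atom_span\<close>). With \<open>e\<close> the projection onto \<open>V\<close> along a
  complement inside \<open>K\<close>, the endomorphism \<open>\<rho> = (1 - \<theta>) e\<close> is as required.
\<close>

section \<open>Submodules and linear maps\<close>

context right_module
begin

lemma smult_uminus_one:
  assumes x: "x \<in> carrier M"
  shows "(\<ominus> \<one>) \<odot>\<^bsub>M\<^esub> x = \<ominus>\<^bsub>M\<^esub> x"
proof -
  have "(\<ominus> \<one>) \<odot>\<^bsub>M\<^esub> x \<oplus>\<^bsub>M\<^esub> x = \<zero>\<^bsub>M\<^esub>"
    using smult_add_scalar [of "\<ominus> \<one>" \<one> x] x by (simp add: R.l_neg smult_zero_scalar)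
  then show ?thesis
    using x by (intro M.minus_equality [symmetric]) auto
qed

lemma smult_uminus:
  assumes "a \<in> carrier R" "x \<in> carrier M"
  shows "a \<odot>\<^bsub>M\<^esub> (\<ominus>\<^bsub>M\<^esub> x) = \<ominus>\<^bsub>M\<^esub> (a \<odot>\<^bsub>M\<^esub> x)"
proof -
  have "a \<odot>\<^bsub>M\<^esub> (\<ominus>\<^bsub>M\<^esub> x) \<oplus>\<^bsub>M\<^esub> a \<odot>\<^bsub>M\<^esub> x = \<zero>\<^bsub>M\<^esub>"
    using smult_add_vector [of a "\<ominus>\<^bsub>M\<^esub> x" x] assms by (simp add: M.l_neg smult_zero_vector)
  then show ?thesis
    using assms by (intro M.minus_equality [symmetric]) auto
qed

lemma smult_minus:
  assumes "a \<in> carrier R" "x \<in> carrier M" "y \<in> carrier M"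
  shows "a \<odot>\<^bsub>M\<^esub> (x \<ominus>\<^bsub>M\<^esub> y) = a \<odot>\<^bsub>M\<^esub> x \<ominus>\<^bsub>M\<^esub> a \<odot>\<^bsub>M\<^esub> y"
  using assms by (simp add: a_minus_def smult_add_vector smult_uminus)

lemma add_minus_swap:
  assumes "x \<in> carrier M" "y \<in> carrier M" "u \<in> carrier M" "v \<in> carrier M"
  shows "(x \<oplus>\<^bsub>M\<^esub> y) \<ominus>\<^bsub>M\<^esub> (u \<oplus>\<^bsub>M\<^esub> v) = (x \<ominus>\<^bsub>M\<^esub> u) \<oplus>\<^bsub>M\<^esub> (y \<ominus>\<^bsub>M\<^esub> v)"
  using assms by (simp add: a_minus_def M.minus_add M.a_ac)

lemma minus_add_cancel:
  assumes "x \<in> carrier M" "y \<in> carrier M"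
  shows "(x \<ominus>\<^bsub>M\<^esub> y) \<oplus>\<^bsub>M\<^esub> y = x" "y \<oplus>\<^bsub>M\<^esub> (x \<ominus>\<^bsub>M\<^esub> y) = x"
    "(x \<oplus>\<^bsub>M\<^esub> y) \<ominus>\<^bsub>M\<^esub> y = x" "(y \<oplus>\<^bsub>M\<^esub> x) \<ominus>\<^bsub>M\<^esub> y = x"
proof -
  show 1: "(x \<ominus>\<^bsub>M\<^esub> y) \<oplus>\<^bsub>M\<^esub> y = x"
    using assms by (simp add: a_minus_def M.a_assoc M.l_neg)
  then show "y \<oplus>\<^bsub>M\<^esub> (x \<ominus>\<^bsub>M\<^esub> y) = x"
    using assms by (simp add: M.a_comm)
  show 2: "(x \<oplus>\<^bsub>M\<^esub> y) \<ominus>\<^bsub>M\<^esub> y = x"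
    using assms by (simp add: a_minus_def M.a_assoc M.r_neg)
  then show "(y \<oplus>\<^bsub>M\<^esub> x) \<ominus>\<^bsub>M\<^esub> y = x"
    using assms by (simp add: M.a_comm)
qed

lemma minus_eq_zero_iff:
  assumes "x \<in> carrier M" "y \<in> carrier M"
  shows "x \<ominus>\<^bsub>M\<^esub> y = \<zero>\<^bsub>M\<^esub> \<longleftrightarrow> x = y"
  using assms minus_add_cancel(1) [of x y] by (auto simp: M.r_neg a_minus_def)

lemma submoduleI:
  assumes "H \<subseteq> carrier M" "\<zero>\<^bsub>M\<^esub> \<in> H"
    and add: "\<And>x y. \<lbrakk>x \<in> H; y \<in> H\<rbrakk> \<Longrightarrow> x \<oplus>\<^bsub>M\<^esub> y \<in> H"
    and smult: "\<And>a x. \<lbrakk>a \<in> carrier R; x \<in> H\<rbrakk> \<Longrightarrow> a \<odot>\<^bsub>M\<^esub> x \<in> H"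
  shows "submodule H R M"
proof -
  have "\<ominus>\<^bsub>M\<^esub> x \<in> H" if "x \<in> H" for x
    using smult [of "\<ominus> \<one>" x] smult_uminus_one [of x] that assms(1) by auto
  then have "subgroup H (add_monoid M)"
    using assms by (intro M.add.subgroupI) (auto simp: a_inv_def)
  then show ?thesis
    using smult by (simp add: submodule_def submodule_axioms_def)
qed

lemma submoduleD:
  assumes "submodule H R M"
  shows "\<And>x. x \<in> H \<Longrightarrow> x \<in> carrier M" "\<zero>\<^bsub>M\<^esub> \<in> H"
    and "\<And>x y. \<lbrakk>x \<in> H; y \<in> H\<rbrakk> \<Longrightarrow> x \<oplus>\<^bsub>M\<^esub> y \<in> H"
    and "\<And>a x. \<lbrakk>a \<in> carrier R; x \<in> H\<rbrakk> \<Longrightarrow> a \<odot>\<^bsub>M\<^esub> x \<in> H"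
    and "\<And>x y. \<lbrakk>x \<in> H; y \<in> H\<rbrakk> \<Longrightarrow> x \<ominus>\<^bsub>M\<^esub> y \<in> H"
proof -
  interpret H: submodule H R M by fact
  show 1: "x \<in> carrier M" if "x \<in> H" for x
    using that H.subset by auto
  show "\<zero>\<^bsub>M\<^esub> \<in> H"
    using H.one_closed by simp
  show add: "x \<oplus>\<^bsub>M\<^esub> y \<in> H" if "x \<in> H" "y \<in> H" for x y
    using H.m_closed that by simp
  show smult: "a \<odot>\<^bsub>M\<^esub> x \<in> H" if "a \<in> carrier R" "x \<in> H" for a x
    using that by simp
  show "x \<ominus>\<^bsub>M\<^esub> y \<in> H" if "x \<in> H" "y \<in> H" for x y
    using add [OF that(1) smult [OF _ that(2), of "\<ominus> \<one>"]] 1 that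
    by (simp add: smult_uminus_one a_minus_def)
qed

lemma submodule_carrier: "submodule (carrier M) R M"
  by (rule submoduleI) auto

lemma submodule_zero: "submodule {\<zero>\<^bsub>M\<^esub>} R M"
  by (rule submoduleI) (auto simp: smult_zero_vector)

lemma submodule_finsum:
  assumes "submodule H R M" "finite A" "\<And>i. i \<in> A \<Longrightarrow> f i \<in> H"
  shows "(\<Oplus>\<^bsub>M\<^esub>i\<in>A. f i) \<in> H"
  using assms(2,3)
proof (induction A)
  case empty
  then show ?case by (simp add: submoduleD(2) [OF assms(1)])
next
  case (insert i A)
  then have "f \<in> A \<rightarrow> carrier M" "f i \<in> carrier M"
    using submoduleD(1) [OF assms(1)] by auto
  with insert show ?case
    by (simp add: submoduleD(3) [OF assms(1)])
qed

lemma submodule_Inter: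
  assumes "\<A> \<noteq> {}" "\<And>H. H \<in> \<A> \<Longrightarrow> submodule H R M"
  shows "submodule (\<Inter>\<A>) R M"
proof (rule submoduleI)
  show "\<Inter>\<A> \<subseteq> carrier M"
    using assms submoduleD(1) by blast
qed (use assms(2) submoduleD in blast)+

lemma submodule_Union_chain:
  assumes "\<A> \<noteq> {}" "\<And>H. H \<in> \<A> \<Longrightarrow> submodule H R M"
    and chain: "\<And>H K. \<lbrakk>H \<in> \<A>; K \<in> \<A>\<rbrakk> \<Longrightarrow> H \<subseteq> K \<or> K \<subseteq> H"
  shows "submodule (\<Union>\<A>) R M"
proof (rule submoduleI)
  show "\<Union>\<A> \<subseteq> carrier M" "\<zero>\<^bsub>M\<^esub> \<in> \<Union>\<A>"
    using assms(1,2) submoduleD(1,2) by blast+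
next
  fix x y assume "x \<in> \<Union>\<A>" "y \<in> \<Union>\<A>"
  then obtain H where "H \<in> \<A>" "x \<in> H" "y \<in> H"
    using chain by blast
  then show "x \<oplus>\<^bsub>M\<^esub> y \<in> \<Union>\<A>"
    using submoduleD(3) [OF assms(2)] by blast
next
  fix a x assume "a \<in> carrier R" "x \<in> \<Union>\<A>"
  then show "a \<odot>\<^bsub>M\<^esub> x \<in> \<Union>\<A>"
    using submoduleD(4) [OF assms(2)] by blast
qed

lemma submodule_span:
  assumes "A \<subseteq> carrier M"
  shows "submodule (submodule_span R M A) R M"
  unfolding submodule_span_def
  by (rule submodule_Inter) (use submodule_carrier assms in auto)

lemma submodule_span_superset: "A \<subseteq> submodule_span R M A"
  by (auto simp: submodule_span_def)

lemma submodule_span_least: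
  assumes "submodule H R M" "A \<subseteq> H"
  shows "submodule_span R M A \<subseteq> H"
  using assms by (auto simp: submodule_span_def)

lemma submodule_span_mono:
  assumes "A \<subseteq> B" "B \<subseteq> carrier M"
  shows "submodule_span R M A \<subseteq> submodule_span R M B"
  using assms submodule_span_superset [of B] by (intro submodule_span_least submodule_span) blast+

lemma span_finite_support:
  assumes A: "A \<subseteq> carrier M" and x: "x \<in> submodule_span R M A"
  shows "\<exists>B. finite B \<and> B \<subseteq> A \<and> x \<in> submodule_span R M B"
proof -
  let ?H = "\<Union>(submodule_span R M ` {B. finite B \<and> B \<subseteq> A})"
  have "submodule ?H R M"
  proof (rule submoduleI)
    show "?H \<subseteq> carrier M"
      using A submoduleD(1) [OF submodule_span] by blast
    show "\<zero>\<^bsub>M\<^esub> \<in> ?H"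
      using submoduleD(2) [OF submodule_span, of "{}"] by blast
  next
    fix u v assume "u \<in> ?H" "v \<in> ?H"
    then obtain B C where *: "finite B" "B \<subseteq> A" "u \<in> submodule_span R M B"
        "finite C" "C \<subseteq> A" "v \<in> submodule_span R M C"
      by blast
    then have BC: "finite (B \<union> C)" "B \<union> C \<subseteq> A" "B \<union> C \<subseteq> carrier M"
      using A by auto
    have "u \<in> submodule_span R M (B \<union> C)" "v \<in> submodule_span R M (B \<union> C)"
      using * submodule_span_mono [OF _ BC(3)] by blast+
    then have "u \<oplus>\<^bsub>M\<^esub> v \<in> submodule_span R M (B \<union> C)"
      using BC(3) by (intro submoduleD(3) submodule_span)
    with BC show "u \<oplus>\<^bsub>M\<^esub> v \<in> ?H"
      by blast
  next
    fix a u assume a: "a \<in> carrier R" and "u \<in> ?H"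
    then obtain B where *: "finite B" "B \<subseteq> A" "u \<in> submodule_span R M B"
      by blast
    then have "a \<odot>\<^bsub>M\<^esub> u \<in> submodule_span R M B"
      using A a by (intro submoduleD(4) submodule_span) auto
    with * show "a \<odot>\<^bsub>M\<^esub> u \<in> ?H"
      by blast
  qed
  moreover have "A \<subseteq> ?H"
  proof
    fix x assume "x \<in> A"
    then have "x \<in> submodule_span R M {x}" "{x} \<in> {B. finite B \<and> B \<subseteq> A}"
      using submodule_span_superset [of "{x}"] by auto
    then show "x \<in> ?H"
      by blast
  qed
  ultimately have "submodule_span R M A \<subseteq> ?H"
    by (rule submodule_span_least)
  then show ?thesis
    using x by auto
qed

lemma set_add_iff: "x \<in> H <+>\<^bsub>M\<^esub> K \<longleftrightarrow> (\<exists>h\<in>H. \<exists>k\<in>K. x = h \<oplus>\<^bsub>M\<^esub> k)"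
  by (auto simp: set_add_def')

lemma submodule_sum:
  assumes H: "submodule H R M" and K: "submodule K R M"
  shows "submodule (H <+>\<^bsub>M\<^esub> K) R M" "H \<subseteq> H <+>\<^bsub>M\<^esub> K" "K \<subseteq> H <+>\<^bsub>M\<^esub> K"
proof -
  note HD = submoduleD [OF H] and KD = submoduleD [OF K]
  show "submodule (H <+>\<^bsub>M\<^esub> K) R M"
  proof (rule submoduleI)
    show "H <+>\<^bsub>M\<^esub> K \<subseteq> carrier M"
      using HD(1) KD(1) by (auto simp: set_add_iff)
    show "\<zero>\<^bsub>M\<^esub> \<in> H <+>\<^bsub>M\<^esub> K"
      unfolding set_add_iff by (intro bexI [of _ "\<zero>\<^bsub>M\<^esub>"]) (auto intro: HD(2) KD(2))
  next
    fix x y assume "x \<in> H <+>\<^bsub>M\<^esub> K" "y \<in> H <+>\<^bsub>M\<^esub> K"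
    then obtain h k h' k' where *: "h \<in> H" "k \<in> K" "h' \<in> H" "k' \<in> K"
        "x = h \<oplus>\<^bsub>M\<^esub> k" "y = h' \<oplus>\<^bsub>M\<^esub> k'"
      by (auto simp: set_add_iff)
    then have "x \<oplus>\<^bsub>M\<^esub> y = (h \<oplus>\<^bsub>M\<^esub> h') \<oplus>\<^bsub>M\<^esub> (k \<oplus>\<^bsub>M\<^esub> k')"
      using HD(1) KD(1) by (simp add: M.a_ac)
    then show "x \<oplus>\<^bsub>M\<^esub> y \<in> H <+>\<^bsub>M\<^esub> K"
      unfolding set_add_iff using HD(3) KD(3) * by blast
  next
    fix a x assume a: "a \<in> carrier R" and "x \<in> H <+>\<^bsub>M\<^esub> K"
    then obtain h k where *: "h \<in> H" "k \<in> K" "x = h \<oplus>\<^bsub>M\<^esub> k"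
      by (auto simp: set_add_iff)
    then have "a \<odot>\<^bsub>M\<^esub> x = a \<odot>\<^bsub>M\<^esub> h \<oplus>\<^bsub>M\<^esub> a \<odot>\<^bsub>M\<^esub> k"
      using HD(1) KD(1) a by (simp add: smult_add_vector)
    then show "a \<odot>\<^bsub>M\<^esub> x \<in> H <+>\<^bsub>M\<^esub> K"
      unfolding set_add_iff using HD(4) KD(4) * a by blast
  qed
  show "H \<subseteq> H <+>\<^bsub>M\<^esub> K"
  proof
    fix x assume "x \<in> H"
    then show "x \<in> H <+>\<^bsub>M\<^esub> K"
      unfolding set_add_iff using HD(1) KD(2)
      by (intro bexI [of _ x] bexI [of _ "\<zero>\<^bsub>M\<^esub>"]) auto
  qed
  show "K \<subseteq> H <+>\<^bsub>M\<^esub> K"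
  proof
    fix x assume "x \<in> K"
    then show "x \<in> H <+>\<^bsub>M\<^esub> K"
      unfolding set_add_iff using KD(1) HD(2)
      by (intro bexI [of _ x] bexI [of _ "\<zero>\<^bsub>M\<^esub>"]) auto
  qed
qed

lemma submodule_cyclic:
  assumes x: "x \<in> carrier M"
  shows "submodule ((\<lambda>a. a \<odot>\<^bsub>M\<^esub> x) ` carrier R) R M" "x \<in> (\<lambda>a. a \<odot>\<^bsub>M\<^esub> x) ` carrier R"
proof -
  show "x \<in> (\<lambda>a. a \<odot>\<^bsub>M\<^esub> x) ` carrier R"
    using x by (intro image_eqI [of _ _ \<one>]) auto
  show "submodule ((\<lambda>a. a \<odot>\<^bsub>M\<^esub> x) ` carrier R) R M"
  proof (rule submoduleI)
    show "\<zero>\<^bsub>M\<^esub> \<in> (\<lambda>a. a \<odot>\<^bsub>M\<^esub> x) ` carrier R"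
      using x by (intro image_eqI [of _ _ \<zero>]) (auto simp: smult_zero_scalar)
  next
    fix u v assume "u \<in> (\<lambda>a. a \<odot>\<^bsub>M\<^esub> x) ` carrier R" "v \<in> (\<lambda>a. a \<odot>\<^bsub>M\<^esub> x) ` carrier R"
    then obtain a b where "a \<in> carrier R" "b \<in> carrier R" "u = a \<odot>\<^bsub>M\<^esub> x" "v = b \<odot>\<^bsub>M\<^esub> x"
      by auto
    then show "u \<oplus>\<^bsub>M\<^esub> v \<in> (\<lambda>a. a \<odot>\<^bsub>M\<^esub> x) ` carrier R"
      using x by (intro image_eqI [of _ _ "a \<oplus> b"]) (auto simp: smult_add_scalar)
  next
    fix b u assume "b \<in> carrier R" "u \<in> (\<lambda>a. a \<odot>\<^bsub>M\<^esub> x) ` carrier R"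
    then obtain a where "a \<in> carrier R" "b \<in> carrier R" "u = a \<odot>\<^bsub>M\<^esub> x"
      by auto
    then show "b \<odot>\<^bsub>M\<^esub> u \<in> (\<lambda>a. a \<odot>\<^bsub>M\<^esub> x) ` carrier R"
      using x by (intro image_eqI [of _ _ "a \<otimes> b"]) (auto simp: smult_assoc)
  qed (use x in auto)
qed

end

lemma (in right_module) submodule_span_insert:
  assumes z: "z \<in> carrier M" and B: "B \<subseteq> carrier M"
  shows "submodule_span R M (insert z B) \<subseteq> submodule_span R M B <+>\<^bsub>M\<^esub> (\<lambda>a. a \<odot>\<^bsub>M\<^esub> z) ` carrier R"
proof (rule submodule_span_least)
  note S = submodule_sum [OF submodule_span [OF B] submodule_cyclic(1) [OF z]]
  show "submodule (submodule_span R M B <+>\<^bsub>M\<^esub> (\<lambda>a. a \<odot>\<^bsub>M\<^esub> z) ` carrier R) R M"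
    by (rule S(1))
  show "insert z B \<subseteq> submodule_span R M B <+>\<^bsub>M\<^esub> (\<lambda>a. a \<odot>\<^bsub>M\<^esub> z) ` carrier R"
    using S(2,3) submodule_span_superset [of B] submodule_cyclic(2) [OF z] by blast
qed

lemma (in right_module) right_submodule_module:
  assumes "submodule H R M"
  shows "right_module R (M\<lparr>carrier := H\<rparr>)"
proof -
  note HD = submoduleD [OF assms]
  have "abelian_group (M\<lparr>carrier := H\<rparr>)"
  proof (rule abelian_groupI)
    fix x assume x: "x \<in> carrier (M\<lparr>carrier := H\<rparr>)"
    then have "\<ominus>\<^bsub>M\<^esub> x \<in> H"
      using HD(5) [OF HD(2), of x] HD(1) [of x] by (simp add: a_minus_def)
    with x show "\<exists>y\<in>carrier (M\<lparr>carrier := H\<rparr>). y \<oplus>\<^bsub>M\<lparr>carrier := H\<rparr>\<^esub> x = \<zero>\<^bsub>M\<lparr>carrier := H\<rparr>\<^esub>"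
      using HD(1) by (intro bexI [of _ "\<ominus>\<^bsub>M\<^esub> x"]) (auto simp: M.l_neg)
  qed (use HD in \<open>auto simp: M.a_ac\<close>)
  then show ?thesis
    unfolding right_module_def right_module_axioms_def
    using R.ring_axioms HD
    by (auto simp: smult_add_scalar smult_add_vector smult_assoc)
qed

lemma linear_mapsI:
  assumes "\<And>x. x \<in> carrier M \<Longrightarrow> h x \<in> carrier N"
    and "\<And>x y. \<lbrakk>x \<in> carrier M; y \<in> carrier M\<rbrakk> \<Longrightarrow> h (x \<oplus>\<^bsub>M\<^esub> y) = h x \<oplus>\<^bsub>N\<^esub> h y"
    and "\<And>a x. \<lbrakk>a \<in> carrier R; x \<in> carrier M\<rbrakk> \<Longrightarrow> h (a \<odot>\<^bsub>M\<^esub> x) = a \<odot>\<^bsub>N\<^esub> h x"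
  shows "h \<in> linear_maps R M N"
  using assms by (auto simp: linear_maps_def)

lemma linear_maps_id: "(\<lambda>x. x) \<in> linear_maps R M M"
  by (simp add: linear_maps_def)

lemma linear_maps_compose:
  assumes "h \<in> linear_maps R M N" "g \<in> linear_maps R N L"
  shows "(\<lambda>x. g (h x)) \<in> linear_maps R M L"
  using linear_mapsD [OF assms(1)] linear_mapsD [OF assms(2)] by (intro linear_mapsI) auto

lemma linear_maps_add:
  assumes N: "right_module R N" and g: "g \<in> linear_maps R M N" and h: "h \<in> linear_maps R M N"
  shows "(\<lambda>x. g x \<oplus>\<^bsub>N\<^esub> h x) \<in> linear_maps R M N"
proof -
  interpret N: right_module R N by fact
  show ?thesis
    using linear_mapsD [OF g] linear_mapsD [OF h]
    by (intro linear_mapsI) (auto simp: N.M.a_ac N.smult_add_vector)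
qed

lemma linear_maps_minus:
  assumes N: "right_module R N" and g: "g \<in> linear_maps R M N" and h: "h \<in> linear_maps R M N"
  shows "(\<lambda>x. g x \<ominus>\<^bsub>N\<^esub> h x) \<in> linear_maps R M N"
proof -
  interpret N: right_module R N by fact
  show ?thesis
    using linear_mapsD [OF g] linear_mapsD [OF h]
    by (intro linear_mapsI) (auto simp: N.add_minus_swap N.smult_minus)
qed

lemma linear_map_zero:
  assumes M: "right_module R M" and N: "right_module R N" and h: "h \<in> linear_maps R M N"
  shows "h \<zero>\<^bsub>M\<^esub> = \<zero>\<^bsub>N\<^esub>"
proof -
  interpret M: right_module R M by fact
  interpret N: right_module R N by fact
  have "h (\<zero>\<^bsub>R\<^esub> \<odot>\<^bsub>M\<^esub> \<zero>\<^bsub>M\<^esub>) = \<zero>\<^bsub>R\<^esub> \<odot>\<^bsub>N\<^esub> h \<zero>\<^bsub>M\<^esub>"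
    by (rule linear_mapsD(3) [OF h]) auto
  then show ?thesis
    by (simp add: M.smult_zero_vector N.smult_zero_scalar linear_mapsD(1) [OF h])
qed

lemma linear_map_minus:
  assumes M: "right_module R M" and N: "right_module R N" and h: "h \<in> linear_maps R M N"
    and x: "x \<in> carrier M" and y: "y \<in> carrier M"
  shows "h (x \<ominus>\<^bsub>M\<^esub> y) = h x \<ominus>\<^bsub>N\<^esub> h y"
proof -
  interpret M: right_module R M by fact
  interpret N: right_module R N by fact
  note hD = linear_mapsD [OF h]
  have "h (\<ominus>\<^bsub>M\<^esub> y) = \<ominus>\<^bsub>N\<^esub> h y"
    using hD(3) [of "\<ominus>\<^bsub>R\<^esub> \<one>\<^bsub>R\<^esub>" y] hD(1) y by (simp add: M.smult_uminus_one N.smult_uminus_one)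
  then show ?thesis
    using hD x y by (simp add: a_minus_def)
qed

lemma linear_map_finsum:
  assumes M: "right_module R M" and N: "right_module R N" and h: "h \<in> linear_maps R M N"
    and A: "finite A" "\<And>i. i \<in> A \<Longrightarrow> f i \<in> carrier M"
  shows "h (\<Oplus>\<^bsub>M\<^esub>i\<in>A. f i) = (\<Oplus>\<^bsub>N\<^esub>i\<in>A. h (f i))"
proof -
  interpret M: right_module R M by fact
  interpret N: right_module R N by fact
  note hD = linear_mapsD [OF h]
  show ?thesis
    using A by (induction A) (auto simp: linear_map_zero [OF M N h] hD Pi_def)
qed

lemma submodule_vimage:
  assumes M: "right_module R M" and N: "right_module R N" and h: "h \<in> linear_maps R M N"
    and H: "submodule H R N"
  shows "submodule {x \<in> carrier M. h x \<in> H} R M"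
proof -
  interpret M: right_module R M by fact
  interpret N: right_module R N by fact
  note hD = linear_mapsD [OF h] and HD = N.submoduleD [OF H]
  show ?thesis
    using hD HD by (intro M.submoduleI) (auto simp: linear_map_zero [OF M N h])
qed

lemma submodule_image:
  assumes M: "right_module R M" and N: "right_module R N" and h: "h \<in> linear_maps R M N"
    and H: "submodule H R M"
  shows "submodule (h ` H) R N"
proof -
  interpret M: right_module R M by fact
  interpret N: right_module R N by fact
  note hD = linear_mapsD [OF h] and HD = M.submoduleD [OF H]
  show ?thesis
  proof (rule N.submoduleI)
    show "h ` H \<subseteq> carrier N"
      using hD HD by auto
    show "\<zero>\<^bsub>N\<^esub> \<in> h ` H"
      using linear_map_zero [OF M N h] HD(2) by force
    show "x \<oplus>\<^bsub>N\<^esub> y \<in> h ` H" if "x \<in> h ` H" "y \<in> h ` H" for x y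
      using that HD(1,3) hD(2) [symmetric] by auto
    show "a \<odot>\<^bsub>N\<^esub> x \<in> h ` H" if "a \<in> carrier R" "x \<in> h ` H" for a x
      using that HD(1,4) hD(3) [symmetric] by auto
  qed
qed

lemma epimorphism_section:
  assumes "f \<in> epimorphisms R M N"
  shows "\<exists>s. \<forall>y\<in>carrier N. s y \<in> carrier M \<and> f (s y) = y"
proof -
  have "f ` carrier M = carrier N"
    using assms by (simp add: epimorphisms_def)
  then show ?thesis
    using inv_into_into [of _ f "carrier M"] f_inv_into_f [of _ f "carrier M"]
    by (intro exI [of _ "inv_into (carrier M) f"]) simp
qed

lemma right_regular_simps [simp]:
  "carrier (right_regular R) = carrier R"
  "\<zero>\<^bsub>right_regular R\<^esub> = \<zero>\<^bsub>R\<^esub>"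
  "x \<oplus>\<^bsub>right_regular R\<^esub> y = x \<oplus>\<^bsub>R\<^esub> y"
  "a \<odot>\<^bsub>right_regular R\<^esub> x = x \<otimes>\<^bsub>R\<^esub> a"
  by (simp_all add: right_regular_def)

lemma (in right_module) linear_map_orbit:
  assumes "x \<in> carrier M"
  shows "(\<lambda>a. a \<odot>\<^bsub>M\<^esub> x) \<in> linear_maps R (right_regular R) M"
  using assms by (intro linear_mapsI) (auto simp: smult_add_scalar smult_assoc)

section \<open>Atoms, socle and essential submodules\<close>

text \<open>
  The generators of simple submodules, together with zero. Working with elements instead of simple
  submodules makes stability under linear maps immediate, and absorbs the case that a simple module
  is mapped to zero.
\<close>

definition atoms :: "('a, 'r) ring_scheme \<Rightarrow> ('a, 'b, 'm) module_scheme \<Rightarrow> 'b set"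
  where "atoms R M =
    {z \<in> carrier M. \<forall>r\<in>carrier R.
      r \<odot>\<^bsub>M\<^esub> z = \<zero>\<^bsub>M\<^esub> \<or> (\<exists>r'\<in>carrier R. r' \<odot>\<^bsub>M\<^esub> (r \<odot>\<^bsub>M\<^esub> z) = z)}"

lemma atoms_linear_image:
  assumes M: "right_module R M" and N: "right_module R N" and h: "h \<in> linear_maps R M N"
    and z: "z \<in> atoms R M"
  shows "h z \<in> atoms R N"
proof -
  interpret M: right_module R M by fact
  note hD = linear_mapsD [OF h]
  have zM: "z \<in> carrier M"
    using z by (simp add: atoms_def)
  have "r \<odot>\<^bsub>N\<^esub> h z = \<zero>\<^bsub>N\<^esub> \<or> (\<exists>r'\<in>carrier R. r' \<odot>\<^bsub>N\<^esub> (r \<odot>\<^bsub>N\<^esub> h z) = h z)"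
    if r: "r \<in> carrier R" for r
  proof (cases "r \<odot>\<^bsub>M\<^esub> z = \<zero>\<^bsub>M\<^esub>")
    case True
    then show ?thesis
      using hD(3) [OF r zM] linear_map_zero [OF M N h] by simp
  next
    case False
    then obtain r' where r': "r' \<in> carrier R" "r' \<odot>\<^bsub>M\<^esub> (r \<odot>\<^bsub>M\<^esub> z) = z"
      using z r by (auto simp: atoms_def)
    then have "r' \<odot>\<^bsub>N\<^esub> (r \<odot>\<^bsub>N\<^esub> h z) = h z"
      using hD(3) [OF r zM] hD(3) [of r' "r \<odot>\<^bsub>M\<^esub> z"] r zM by simp
    with r'(1) show ?thesis by blast
  qed
  with hD(1) [OF zM] show ?thesis
    by (simp add: atoms_def)
qed

context right_module
begin

lemma simple_submodule_atoms:
  assumes S: "simple_submodule R M S" and z: "z \<in> S"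
  shows "z \<in> atoms R M"
proof -
  have sub: "submodule S R M"
    and min: "\<And>H. submodule H R M \<Longrightarrow> H \<subseteq> S \<Longrightarrow> H = {\<zero>\<^bsub>M\<^esub>} \<or> H = S"
    using S by (auto simp: simple_submodule_def)
  note SD = submoduleD [OF sub]
  have "r \<odot>\<^bsub>M\<^esub> z = \<zero>\<^bsub>M\<^esub> \<or> (\<exists>r'\<in>carrier R. r' \<odot>\<^bsub>M\<^esub> (r \<odot>\<^bsub>M\<^esub> z) = z)"
    if r: "r \<in> carrier R" for r
  proof -
    have rz: "r \<odot>\<^bsub>M\<^esub> z \<in> S"
      by (rule SD(4) [OF r z])
    let ?C = "(\<lambda>a. a \<odot>\<^bsub>M\<^esub> (r \<odot>\<^bsub>M\<^esub> z)) ` carrier R"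
    note C = submodule_cyclic [OF SD(1) [OF rz]]
    have "?C \<subseteq> S"
      using SD(4) rz by auto
    with min [OF C(1)] have "?C = {\<zero>\<^bsub>M\<^esub>} \<or> ?C = S"
      by simp
    then show ?thesis
    proof
      assume "?C = {\<zero>\<^bsub>M\<^esub>}"
      then show ?thesis
        using C(2) by simp
    next
      assume "?C = S"
      then have "z \<in> ?C"
        using z by simp
      then obtain r' where "r' \<in> carrier R" "z = r' \<odot>\<^bsub>M\<^esub> (r \<odot>\<^bsub>M\<^esub> z)"
        by (rule imageE)
      then show ?thesis
        by metis
    qed
  qed
  with z SD(1) show ?thesis
    by (auto simp: atoms_def)
qed

lemma simple_submodule_cyclic_atom:
  assumes z: "z \<in> atoms R M" and nz: "z \<noteq> \<zero>\<^bsub>M\<^esub>"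
  shows "simple_submodule R M ((\<lambda>a. a \<odot>\<^bsub>M\<^esub> z) ` carrier R)" (is "simple_submodule R M ?C")
proof -
  have zM: "z \<in> carrier M"
    using z by (simp add: atoms_def)
  note C = submodule_cyclic [OF zM]
  have "H = {\<zero>\<^bsub>M\<^esub>} \<or> H = ?C" if H: "submodule H R M" "H \<subseteq> ?C" for H
  proof (cases "H = {\<zero>\<^bsub>M\<^esub>}")
    case False
    note HD = submoduleD [OF H(1)]
    obtain u where u: "u \<in> H" "u \<noteq> \<zero>\<^bsub>M\<^esub>"
      using False HD(2) by blast
    have "u \<in> ?C"
      using u(1) H(2) by blast
    then obtain r where r: "r \<in> carrier R" "u = r \<odot>\<^bsub>M\<^esub> z"
      by (rule imageE)
    then obtain r' where "r' \<in> carrier R" "r' \<odot>\<^bsub>M\<^esub> u = z"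
      using z u(2) by (auto simp: atoms_def)
    then have "z \<in> H"
      using HD(4) u(1) by blast
    then have "?C \<subseteq> H"
      using HD(4) by auto
    with H(2) show ?thesis by blast
  qed simp
  with C nz show ?thesis
    by (auto simp: simple_submodule_def)
qed

lemma simple_submodules_closed: "\<Union>{S. simple_submodule R M S} \<subseteq> carrier M"
  using submoduleD(1) by (auto simp: simple_submodule_def)

lemma submodule_socle: "submodule (socle R M) R M"
  unfolding socle_def by (rule submodule_span [OF simple_submodules_closed])

lemma atoms_closed: "atoms R M \<subseteq> carrier M"
  by (auto simp: atoms_def)

lemma socle_eq_span_atoms: "socle R M = submodule_span R M (atoms R M)"
proof
  show "socle R M \<subseteq> submodule_span R M (atoms R M)"
    unfolding socle_def
    using simple_submodule_atoms submodule_span_superset [of "atoms R M"]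
    by (intro submodule_span_least submodule_span atoms_closed) blast
  have "z \<in> socle R M" if "z \<in> atoms R M" for z
  proof (cases "z = \<zero>\<^bsub>M\<^esub>")
    case True
    then show ?thesis
      using submoduleD(2) [OF submodule_socle] by simp
  next
    case False
    have "z \<in> carrier M"
      using that atoms_closed by blast
    then have "z \<in> \<Union>{S. simple_submodule R M S}"
      using simple_submodule_cyclic_atom [OF that False] submodule_cyclic(2) by blast
    then show ?thesis
      unfolding socle_def by (rule subsetD [OF submodule_span_superset])
  qed
  then show "submodule_span R M (atoms R M) \<subseteq> socle R M"
    by (intro submodule_span_least submodule_socle) blast
qed

lemma atoms_in_socle: "atoms R M \<subseteq> socle R M"
  unfolding socle_eq_span_atoms by (rule submodule_span_superset)

text \<open>
  Each of the finitely many generators lies in the span of finitely many atoms.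
\<close>

lemma finitely_generated_socle:
  assumes "finitely_generated R M (socle R M)"
  shows "\<exists>T. finite T \<and> T \<subseteq> atoms R M \<and> socle R M = submodule_span R M T"
proof -
  obtain A where A: "finite A" "A \<subseteq> carrier M" "socle R M = submodule_span R M A"
    using assms unfolding finitely_generated_def by (elim exE conjE) (rule that)
  have "\<exists>B. finite B \<and> B \<subseteq> atoms R M \<and> x \<in> submodule_span R M B" if "x \<in> A" for x
    using that A(3) submodule_span_superset [of A]
    by (intro span_finite_support atoms_closed) (auto simp: socle_eq_span_atoms)
  then obtain B where B: "\<And>x. x \<in> A \<Longrightarrow> finite (B x) \<and> B x \<subseteq> atoms R M \<and> x \<in> submodule_span R M (B x)"
    by metis
  let ?T = "\<Union>(B ` A)"
  have T: "finite ?T" "?T \<subseteq> atoms R M"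
    using A(1) B by auto
  then have TM: "?T \<subseteq> carrier M"
    using atoms_closed by blast
  have "x \<in> submodule_span R M ?T" if "x \<in> A" for x
    using B [OF that] submodule_span_mono [OF _ TM, of "B x"] that by blast
  then have "socle R M \<subseteq> submodule_span R M ?T"
    unfolding A(3) by (intro submodule_span_least submodule_span TM) blast
  moreover have "submodule_span R M ?T \<subseteq> socle R M"
    using T(2) atoms_in_socle by (intro submodule_span_least submodule_socle) blast
  ultimately show ?thesis
    using T by blast
qed

text \<open>
  Zorn's lemma in the form needed both for essential submodules missing a given element and for
  complements inside a given submodule \<open>N\<close>; in the latter use, \<open>D\<close> contains everything outside \<open>N\<close>.
\<close>

lemma exists_maximal_submodule:
  assumes B: "submodule B R M" "B \<inter> D = {}"
  shows "\<exists>L. submodule L R M \<and> B \<subseteq> L \<and> L \<inter> D = {} \<and>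
    (\<forall>H. submodule H R M \<and> L \<subseteq> H \<and> H \<inter> D = {} \<longrightarrow> H = L)"
proof -
  let ?\<A> = "{H. submodule H R M \<and> B \<subseteq> H \<and> H \<inter> D = {}}"
  have "\<exists>L\<in>?\<A>. \<forall>H\<in>?\<A>. L \<subseteq> H \<longrightarrow> H = L"
  proof (rule subset_Zorn_nonempty)
    show "?\<A> \<noteq> {}"
      using B by blast
    fix \<C> assume C: "\<C> \<noteq> {}" "subset.chain ?\<A> \<C>"
    then have sub: "\<C> \<subseteq> ?\<A>" and ch: "\<And>H K. \<lbrakk>H \<in> \<C>; K \<in> \<C>\<rbrakk> \<Longrightarrow> H \<subseteq> K \<or> K \<subseteq> H"
      by (auto simp: subset_chain_def)
    have "submodule (\<Union>\<C>) R M"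
      by (rule submodule_Union_chain) (use C(1) sub ch in auto)
    moreover obtain H where "H \<in> \<C>"
      using C(1) by blast
    then have "B \<subseteq> \<Union>\<C>"
      using sub by blast
    moreover have "\<Union>\<C> \<inter> D = {}"
      using sub by auto
    ultimately show "\<Union>\<C> \<in> ?\<A>"
      by simp
  qed
  then obtain L where L: "L \<in> ?\<A>" "\<forall>H\<in>?\<A>. L \<subseteq> H \<longrightarrow> H = L"
    by (rule bexE)
  have "H = L" if "submodule H R M" "L \<subseteq> H" "H \<inter> D = {}" for H
  proof -
    have "H \<in> ?\<A>"
      using that L(1) by auto
    with L(2) that(2) show ?thesis
      by simp
  qed
  with L(1) show ?thesis
    by (intro exI [of _ L]) simp
qed

text \<open>
  Take \<open>L\<close> maximal among the submodules that contain the socle but not \<open>x\<close>. If a nonzero submodule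
  \<open>H\<close> met \<open>L\<close> trivially, then \<open>x \<in> L + h R\<close> for every nonzero \<open>h \<in> H\<close>. As the sum of \<open>L\<close> and \<open>H\<close> is
  direct, the \<open>H\<close>-component \<open>a\<close> of \<open>x\<close> lies in every nonzero cyclic submodule of \<open>H\<close>; so \<open>a\<close> is an
  atom, which puts \<open>a\<close> and then \<open>x\<close> into \<open>L\<close>.
\<close>

lemma essential_avoiding:
  assumes x: "x \<in> carrier M" "x \<notin> socle R M"
  shows "\<exists>L. essential_submodule R M L \<and> x \<notin> L"
proof -
  obtain L where L: "submodule L R M" "socle R M \<subseteq> L" "x \<notin> L"
    and max: "\<And>H. submodule H R M \<Longrightarrow> L \<subseteq> H \<Longrightarrow> x \<notin> H \<Longrightarrow> H = L"
    using exists_maximal_submodule [OF submodule_socle, of "{x}"] x(2) by blast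
  note LD = submoduleD [OF L(1)]
  have "L \<inter> H \<noteq> {\<zero>\<^bsub>M\<^esub>}" if H: "submodule H R M" "H \<noteq> {\<zero>\<^bsub>M\<^esub>}" for H
  proof
    assume LH: "L \<inter> H = {\<zero>\<^bsub>M\<^esub>}"
    note HD = submoduleD [OF H(1)]
    have reach: "\<exists>l\<in>L. \<exists>r\<in>carrier R. x = l \<oplus>\<^bsub>M\<^esub> r \<odot>\<^bsub>M\<^esub> h" if h: "h \<in> H" "h \<noteq> \<zero>\<^bsub>M\<^esub>" for h
    proof -
      let ?C = "(\<lambda>a. a \<odot>\<^bsub>M\<^esub> h) ` carrier R"
      note C = submodule_cyclic [OF HD(1) [OF h(1)]]
      note S = submodule_sum [OF L(1) C(1)]
      have "h \<notin> L"
        using h LH by blast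
      then have "L <+>\<^bsub>M\<^esub> ?C \<noteq> L"
        using S(3) C(2) by blast
      then have "x \<in> L <+>\<^bsub>M\<^esub> ?C"
        using max [OF S(1,2)] by blast
      then show ?thesis
        unfolding set_add_iff by blast
    qed
    obtain h where "h \<in> H" "h \<noteq> \<zero>\<^bsub>M\<^esub>"
      using H(2) HD(2) by blast
    then obtain l r where "l \<in> L" "r \<in> carrier R" "x = l \<oplus>\<^bsub>M\<^esub> r \<odot>\<^bsub>M\<^esub> h" "r \<odot>\<^bsub>M\<^esub> h \<in> H"
      using reach HD(4) by blast
    then obtain a where a: "a \<in> H" "l \<in> L" "x = l \<oplus>\<^bsub>M\<^esub> a"
      by blast
    have aM: "a \<in> carrier M" and lM: "l \<in> carrier M"
      using a HD(1) LD(1) by auto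
    have "a \<in> atoms R M"
      unfolding atoms_def
    proof (intro CollectI conjI ballI aM)
      fix r assume r: "r \<in> carrier R"
      show "r \<odot>\<^bsub>M\<^esub> a = \<zero>\<^bsub>M\<^esub> \<or> (\<exists>r'\<in>carrier R. r' \<odot>\<^bsub>M\<^esub> (r \<odot>\<^bsub>M\<^esub> a) = a)"
      proof (cases "r \<odot>\<^bsub>M\<^esub> a = \<zero>\<^bsub>M\<^esub>")
        case False
        then obtain l' r' where 1: "l' \<in> L" "r' \<in> carrier R" "x = l' \<oplus>\<^bsub>M\<^esub> r' \<odot>\<^bsub>M\<^esub> (r \<odot>\<^bsub>M\<^esub> a)"
          using reach [OF HD(4) [OF r a(1)]] by blast
        let ?b = "r' \<odot>\<^bsub>M\<^esub> (r \<odot>\<^bsub>M\<^esub> a)"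
        have b: "?b \<in> H" "?b \<in> carrier M"
          using 1(2) r a(1) HD by auto
        have l'M: "l' \<in> carrier M"
          using 1 LD(1) by auto
        have "(l \<ominus>\<^bsub>M\<^esub> l') \<oplus>\<^bsub>M\<^esub> (a \<ominus>\<^bsub>M\<^esub> ?b) = x \<ominus>\<^bsub>M\<^esub> x"
          using add_minus_swap [OF lM aM l'M b(2)] a(3) 1(3) by simp
        also have "\<dots> = \<zero>\<^bsub>M\<^esub>"
          using x(1) by (simp add: minus_eq_zero_iff)
        finally have "l \<ominus>\<^bsub>M\<^esub> l' = \<ominus>\<^bsub>M\<^esub> (a \<ominus>\<^bsub>M\<^esub> ?b)"
          using lM l'M aM b(2) by (intro M.minus_equality [symmetric]) auto
        also have "\<dots> = (\<ominus> \<one>) \<odot>\<^bsub>M\<^esub> (a \<ominus>\<^bsub>M\<^esub> ?b)"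
          using aM b(2) by (simp add: smult_uminus_one)
        also have "\<dots> \<in> H"
          using HD(4,5) a(1) b(1) by blast
        finally have "l \<ominus>\<^bsub>M\<^esub> l' \<in> L \<inter> H"
          using LD(5) a(2) 1(1) by blast
        then have "l \<ominus>\<^bsub>M\<^esub> l' = \<zero>\<^bsub>M\<^esub>"
          using LH by simp
        then have "l = l'"
          using lM l'M by (simp add: minus_eq_zero_iff)
        then have "?b = a"
          using a(3) 1(3) lM aM b(2) by (metis M.add.l_cancel)
        then show ?thesis
          using 1(2) by blast
      qed simp
    qed
    then have "a \<in> L"
      using atoms_in_socle L(2) by blast
    then show False
      using a LD(3) L(3) by blast
  qed
  with L show ?thesis
    by (auto simp: essential_submodule_def)
qed

section \<open>Singular quotients and \<open>\<delta>\<close>-small submodules\<close>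

lemma submodule_residual:
  assumes "x \<in> carrier M" "submodule L R M"
  shows "submodule {r \<in> carrier R. r \<odot>\<^bsub>M\<^esub> x \<in> L} R (right_regular R)"
  using submodule_vimage [OF right_module_regular [OF R.ring_axioms] right_module_axioms
      linear_map_orbit [OF assms(1)] assms(2)] by simp

text \<open>
  A nonzero right ideal \<open>J\<close> either annihilates \<open>x\<close>, and then lies in the residual, or \<open>x J\<close> is a nonzero
  submodule of \<open>x R\<close>. Hence \<open>L\<close> need only meet the nonzero submodules of \<open>x R\<close>, which is weaker
  than being essential.
\<close>

lemma essential_residual:
  assumes x: "x \<in> carrier M" and L: "submodule L R M"
    and meets: "\<And>H. \<lbrakk>submodule H R M; H \<subseteq> (\<lambda>a. a \<odot>\<^bsub>M\<^esub> x) ` carrier R; H \<noteq> {\<zero>\<^bsub>M\<^esub>}\<rbrakk> \<Longrightarrow> L \<inter> H \<noteq> {\<zero>\<^bsub>M\<^esub>}"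
  shows "essential_submodule R (right_regular R) {r \<in> carrier R. r \<odot>\<^bsub>M\<^esub> x \<in> L}"
proof -
  let ?I = "{r \<in> carrier R. r \<odot>\<^bsub>M\<^esub> x \<in> L}"
  note RR = right_module_regular [OF R.ring_axioms]
  interpret RR: right_module R "right_regular R" by (rule RR)
  note LD = submoduleD [OF L]
  have "?I \<inter> J \<noteq> {\<zero>}" if J: "submodule J R (right_regular R)" "J \<noteq> {\<zero>}" for J
  proof -
    note JD = RR.submoduleD [OF J(1), simplified]
    let ?H = "(\<lambda>a. a \<odot>\<^bsub>M\<^esub> x) ` J"
    have H: "submodule ?H R M"
      by (rule submodule_image [OF RR right_module_axioms linear_map_orbit [OF x] J(1)])
    have "\<exists>r\<in>J. r \<noteq> \<zero> \<and> r \<odot>\<^bsub>M\<^esub> x \<in> L"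
    proof (cases "?H = {\<zero>\<^bsub>M\<^esub>}")
      case True
      obtain r where "r \<in> J" "r \<noteq> \<zero>"
        using J(2) JD(2) by blast
      moreover from this have "r \<odot>\<^bsub>M\<^esub> x = \<zero>\<^bsub>M\<^esub>"
        using True by blast
      ultimately show ?thesis
        using LD(2) by auto
    next
      case False
      have "?H \<subseteq> (\<lambda>a. a \<odot>\<^bsub>M\<^esub> x) ` carrier R"
        using JD(1) by blast
      with False have "L \<inter> ?H \<noteq> {\<zero>\<^bsub>M\<^esub>}"
        using meets [OF H] by blast
      moreover have "\<zero>\<^bsub>M\<^esub> \<in> L \<inter> ?H"
        using LD(2) submoduleD(2) [OF H] by blast
      ultimately obtain u where "u \<in> L" "u \<in> ?H" "u \<noteq> \<zero>\<^bsub>M\<^esub>"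
        by blast
      moreover from this obtain r where "r \<in> J" "u = r \<odot>\<^bsub>M\<^esub> x"
        by blast
      ultimately show ?thesis
        using smult_zero_scalar [OF x] by (intro bexI [of _ r]) auto
    qed
    then show ?thesis
      using JD(1) by blast
  qed
  with submodule_residual [OF x L] show ?thesis
    by (simp add: essential_submodule_def)
qed

lemma singular_quotientI:
  assumes K: "submodule K R M"
    and ess: "\<And>x. x \<in> carrier M \<Longrightarrow>
      essential_submodule R (right_regular R) {r \<in> carrier R. r \<odot>\<^bsub>M\<^esub> x \<in> K}"
  shows "singular_module R (quotient_module R M K)"
  unfolding singular_module_def
proof
  interpret K: submodule K R M by fact
  note KD = submoduleD [OF K]
  have K0: "K +>\<^bsub>M\<^esub> k = K" if "k \<in> K" for k
    using M.a_coset_join2 [OF KD(1) [OF that] K.subgroup_axioms that] .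
  fix C assume "C \<in> carrier (quotient_module R M K)"
  then obtain x where x: "x \<in> carrier M" "C = K +>\<^bsub>M\<^esub> x"
    by (auto simp: quotient_module_def A_RCOSETS_def')
  have "r \<odot>\<^bsub>quotient_module R M K\<^esub> C = \<zero>\<^bsub>quotient_module R M K\<^esub>"
    if r: "r \<in> carrier R" "r \<odot>\<^bsub>M\<^esub> x \<in> K" for r
  proof -
    have "r \<odot>\<^bsub>M\<^esub> y \<in> K" if "y \<in> C" for y
    proof -
      from that obtain k where "k \<in> K" "y = k \<oplus>\<^bsub>M\<^esub> x"
        unfolding x(2) a_r_coset_def' by blast
      then show ?thesis
        using r x(1) KD by (simp add: smult_add_vector)
    qed
    moreover have "C \<noteq> {}"
      using x KD(2) by (auto simp: a_r_coset_def')
    ultimately show ?thesis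
      by (auto simp: quotient_module_def K0)
  qed
  then show "\<exists>I. essential_submodule R (right_regular R) I \<and>
      (\<forall>r\<in>I. r \<odot>\<^bsub>quotient_module R M K\<^esub> C = \<zero>\<^bsub>quotient_module R M K\<^esub>)"
    using ess [OF x(1)] by blast
qed

lemma direct_sum_projection:
  assumes V: "submodule V R M" and Y: "submodule Y R M"
    and int: "V \<inter> Y = {\<zero>\<^bsub>M\<^esub>}" and sum: "V <+>\<^bsub>M\<^esub> Y = carrier M"
  shows "\<exists>e\<in>linear_maps R M M. (\<forall>x\<in>carrier M. e x \<in> V \<and> x \<ominus>\<^bsub>M\<^esub> e x \<in> Y) \<and> (\<forall>x\<in>V. e x = x)"
proof -
  note VD = submoduleD [OF V] and YD = submoduleD [OF Y]
  have "\<exists>u. u \<in> V \<and> x \<ominus>\<^bsub>M\<^esub> u \<in> Y" if "x \<in> carrier M" for x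
  proof -
    have "x \<in> V <+>\<^bsub>M\<^esub> Y"
      using that sum by simp
    then obtain u v where *: "u \<in> V" "v \<in> Y" "x = u \<oplus>\<^bsub>M\<^esub> v"
      unfolding set_add_iff by blast
    have "x \<ominus>\<^bsub>M\<^esub> u = v"
      unfolding *(3) by (rule minus_add_cancel(4) [OF YD(1) [OF *(2)] VD(1) [OF *(1)]])
    with * show ?thesis
      by (intro exI [of _ u]) simp
  qed
  then have "\<forall>x\<in>carrier M. \<exists>u. u \<in> V \<and> x \<ominus>\<^bsub>M\<^esub> u \<in> Y"
    by (rule ballI)
  from bchoice [OF this] obtain e where e: "\<And>x. x \<in> carrier M \<Longrightarrow> e x \<in> V \<and> x \<ominus>\<^bsub>M\<^esub> e x \<in> Y"
    by (elim exE) (rule that, erule (1) bspec)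
  have uniq: "u = e x" if "x \<in> carrier M" "u \<in> V" "x \<ominus>\<^bsub>M\<^esub> u \<in> Y" for x u
  proof -
    have eV: "e x \<in> carrier M" "u \<in> carrier M"
      using e that VD(1) by auto
    have "(x \<ominus>\<^bsub>M\<^esub> e x) \<ominus>\<^bsub>M\<^esub> (x \<ominus>\<^bsub>M\<^esub> u) = u \<ominus>\<^bsub>M\<^esub> e x"
    proof -
      have "(x \<ominus>\<^bsub>M\<^esub> e x) \<ominus>\<^bsub>M\<^esub> (x \<ominus>\<^bsub>M\<^esub> u) = ((x \<ominus>\<^bsub>M\<^esub> u) \<oplus>\<^bsub>M\<^esub> (u \<ominus>\<^bsub>M\<^esub> e x)) \<ominus>\<^bsub>M\<^esub> (x \<ominus>\<^bsub>M\<^esub> u)"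
        using that(1) eV by (simp add: a_minus_def M.a_assoc M.r_neg1)
      then show ?thesis
        using that(1) eV by (simp add: minus_add_cancel)
    qed
    then have "u \<ominus>\<^bsub>M\<^esub> e x \<in> V \<inter> Y"
      using VD(5) [OF that(2)] YD(5) [OF _ that(3), of "x \<ominus>\<^bsub>M\<^esub> e x"] e [OF that(1)] by auto
    then show ?thesis
      using int eV minus_eq_zero_iff by auto
  qed
  have "e \<in> linear_maps R M M"
  proof (rule linear_mapsI)
    show "e x \<in> carrier M" if "x \<in> carrier M" for x
      using e [OF that] VD(1) by blast
    show "e (x \<oplus>\<^bsub>M\<^esub> y) = e x \<oplus>\<^bsub>M\<^esub> e y" if "x \<in> carrier M" "y \<in> carrier M" for x y
    proof (rule uniq [symmetric])
      show "x \<oplus>\<^bsub>M\<^esub> y \<ominus>\<^bsub>M\<^esub> (e x \<oplus>\<^bsub>M\<^esub> e y) \<in> Y"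
        using e [OF that(1)] e [OF that(2)] that VD(1) YD(3) by (simp add: add_minus_swap)
    qed (use e VD that in auto)
    show "e (a \<odot>\<^bsub>M\<^esub> x) = a \<odot>\<^bsub>M\<^esub> e x" if "a \<in> carrier R" "x \<in> carrier M" for a x
    proof (rule uniq [symmetric])
      show "a \<odot>\<^bsub>M\<^esub> x \<ominus>\<^bsub>M\<^esub> a \<odot>\<^bsub>M\<^esub> e x \<in> Y"
        using e [OF that(2)] that VD(1) YD(4) by (simp add: smult_minus [symmetric])
    qed (use e VD that in auto)
  qed
  moreover have "e x = x" if "x \<in> V" for x
    using that VD(1) YD(2) minus_eq_zero_iff [of x x] by (intro uniq [symmetric]) auto
  ultimately show ?thesis
    using e by blast
qed

text \<open>
  Let \<open>Y\<close> be maximal among the submodules of \<open>N\<close> that meet \<open>V\<close> trivially. Maximality forces \<open>V + Y\<close> to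
  meet every nonzero submodule of \<open>N\<close>, so that \<open>M / (V + Y)\<close>, a quotient of \<open>N\<close> because \<open>V + N = M\<close>,
  is singular. Now \<open>\<delta>\<close>-smallness of \<open>N\<close> gives \<open>V + Y = M\<close>.
\<close>

lemma delta_small_complement:
  assumes N: "delta_small R M N" and V: "submodule V R M" and VN: "V <+>\<^bsub>M\<^esub> N = carrier M"
  shows "\<exists>Y. submodule Y R M \<and> Y \<subseteq> N \<and> V \<inter> Y = {\<zero>\<^bsub>M\<^esub>} \<and> V <+>\<^bsub>M\<^esub> Y = carrier M"
proof -
  have Nsub: "submodule N R M"
    using N by (simp add: delta_small_def)
  note VD = submoduleD [OF V] and ND = submoduleD [OF Nsub]
  let ?D = "(V - {\<zero>\<^bsub>M\<^esub>}) \<union> - N"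
  have "{\<zero>\<^bsub>M\<^esub>} \<inter> ?D = {}"
    using ND(2) by auto
  from exists_maximal_submodule [OF submodule_zero this]
  obtain Y where *: "submodule Y R M \<and> {\<zero>\<^bsub>M\<^esub>} \<subseteq> Y \<and> Y \<inter> ?D = {} \<and>
      (\<forall>H. submodule H R M \<and> Y \<subseteq> H \<and> H \<inter> ?D = {} \<longrightarrow> H = Y)"
    by (rule exE)
  then have Y: "submodule Y R M" "Y \<inter> ?D = {}"
    by (simp_all only:)
  have max: "H = Y" if "submodule H R M" "Y \<subseteq> H" "H \<inter> ?D = {}" for H
    using * that by (simp only:)
  have YN: "Y \<subseteq> N"
    using Y(2) by blast
  note YD = submoduleD [OF Y(1)]
  have VY: "V \<inter> Y = {\<zero>\<^bsub>M\<^esub>}"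
    using Y(2) VD(2) YD(2) by blast
  let ?S = "V <+>\<^bsub>M\<^esub> Y"
  note S = submodule_sum [OF V Y(1)]
  note SD = submoduleD [OF S(1)]
  have meets: "?S \<inter> B \<noteq> {\<zero>\<^bsub>M\<^esub>}" if B: "submodule B R M" "B \<subseteq> N" "B \<noteq> {\<zero>\<^bsub>M\<^esub>}" for B
  proof
    assume SB: "?S \<inter> B = {\<zero>\<^bsub>M\<^esub>}"
    note BD = submoduleD [OF B(1)]
    note YB = submodule_sum [OF Y(1) B(1)]
    \<comment> \<open>\<open>Y + B\<close> competes with \<open>Y\<close>: an element \<open>y + b\<close> of \<open>V\<close> has \<open>b \<in> V + Y\<close>, hence \<open>b = 0\<close>\<close>
    have "(Y <+>\<^bsub>M\<^esub> B) \<inter> ?D = {}"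
    proof -
      have "u \<in> N \<and> (u \<in> V \<longrightarrow> u = \<zero>\<^bsub>M\<^esub>)" if u: "u \<in> Y <+>\<^bsub>M\<^esub> B" for u
      proof -
        obtain y b where yb: "y \<in> Y" "b \<in> B" "u = y \<oplus>\<^bsub>M\<^esub> b"
          using u by (auto simp: set_add_iff)
        have "u = \<zero>\<^bsub>M\<^esub>" if uV: "u \<in> V"
        proof -
          have "b = u \<ominus>\<^bsub>M\<^esub> y"
            using yb YD(1) BD(1) by (simp add: minus_add_cancel)
          then have "b \<in> ?S \<inter> B"
            using SD(5) S(2,3) uV yb by blast
          then have "b = \<zero>\<^bsub>M\<^esub>"
            using SB by blast
          then have "u = y"
            using yb YD(1) by simp
          then show ?thesis
            using VY uV yb(1) by blast
        qed
        moreover have "u \<in> N"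
          using yb YN B(2) ND(3) by auto
        ultimately show ?thesis by blast
      qed
      then show ?thesis by blast
    qed
    then have "Y <+>\<^bsub>M\<^esub> B = Y"
      by (rule max [OF YB(1,2)])
    then have "B \<subseteq> ?S"
      using YB(3) S(3) by blast
    then show False
      using SB B(3) by blast
  qed
  have "singular_module R (quotient_module R M ?S)"
  proof (rule singular_quotientI [OF S(1)])
    fix m assume "m \<in> carrier M"
    then have "m \<in> V <+>\<^bsub>M\<^esub> N"
      using VN by simp
    then obtain x n where xn: "x \<in> V" "n \<in> N" "m = x \<oplus>\<^bsub>M\<^esub> n"
      unfolding set_add_iff by blast
    have xM: "x \<in> carrier M" and nM: "n \<in> carrier M"
      using xn VD(1) ND(1) by auto
    \<comment> \<open>modulo \<open>V + Y\<close>, the element \<open>m\<close> may be replaced by its component \<open>n \<in> N\<close>\<close>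
    have "r \<odot>\<^bsub>M\<^esub> m \<in> ?S \<longleftrightarrow> r \<odot>\<^bsub>M\<^esub> n \<in> ?S" if r: "r \<in> carrier R" for r
    proof -
      have rx: "r \<odot>\<^bsub>M\<^esub> x \<in> ?S" "r \<odot>\<^bsub>M\<^esub> x \<in> carrier M" "r \<odot>\<^bsub>M\<^esub> n \<in> carrier M"
        using VD(4) [OF r xn(1)] S(2) r xM nM by auto
      have eq: "r \<odot>\<^bsub>M\<^esub> m = r \<odot>\<^bsub>M\<^esub> x \<oplus>\<^bsub>M\<^esub> r \<odot>\<^bsub>M\<^esub> n"
        using xn(3) r xM nM by (simp add: smult_add_vector)
      then have "r \<odot>\<^bsub>M\<^esub> n = r \<odot>\<^bsub>M\<^esub> m \<ominus>\<^bsub>M\<^esub> r \<odot>\<^bsub>M\<^esub> x"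
        using rx by (simp add: minus_add_cancel)
      then show ?thesis
        using SD(3) [OF rx(1)] SD(5) [OF _ rx(1)] eq by metis
    qed
    then have "{r \<in> carrier R. r \<odot>\<^bsub>M\<^esub> m \<in> ?S} = {r \<in> carrier R. r \<odot>\<^bsub>M\<^esub> n \<in> ?S}"
      by blast
    moreover have "essential_submodule R (right_regular R) {r \<in> carrier R. r \<odot>\<^bsub>M\<^esub> n \<in> ?S}"
    proof (rule essential_residual [OF nM S(1)])
      fix H assume H: "submodule H R M" "H \<subseteq> (\<lambda>a. a \<odot>\<^bsub>M\<^esub> n) ` carrier R" "H \<noteq> {\<zero>\<^bsub>M\<^esub>}"
      have "(\<lambda>a. a \<odot>\<^bsub>M\<^esub> n) ` carrier R \<subseteq> N"
        using ND(4) xn(2) by auto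
      then show "?S \<inter> H \<noteq> {\<zero>\<^bsub>M\<^esub>}"
        using meets [OF H(1) _ H(3)] H(2) by blast
    qed
    ultimately show "essential_submodule R (right_regular R) {r \<in> carrier R. r \<odot>\<^bsub>M\<^esub> m \<in> ?S}"
      by simp
  qed
  moreover have "N <+>\<^bsub>M\<^esub> ?S = carrier M"
  proof
    note NS = submodule_sum [OF Nsub S(1)]
    note NSD = submoduleD [OF NS(1)]
    show "N <+>\<^bsub>M\<^esub> ?S \<subseteq> carrier M"
      using NSD(1) by blast
    have "x \<oplus>\<^bsub>M\<^esub> n \<in> N <+>\<^bsub>M\<^esub> ?S" if "x \<in> V" "n \<in> N" for x n
      using that NSD(3) NS(2,3) S(2) by blast
    then show "carrier M \<subseteq> N <+>\<^bsub>M\<^esub> ?S"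
      unfolding VN [symmetric] by (auto simp: set_add_iff)
  qed
  ultimately have "?S = carrier M"
    using N S(1) unfolding delta_small_def by blast
  with Y(1) YN VY show ?thesis
    by blast
qed

lemma delta_small_projection:
  assumes N: "delta_small R M N" and V: "submodule V R M" and VN: "V <+>\<^bsub>M\<^esub> N = carrier M"
  shows "\<exists>e\<in>linear_maps R M M. (\<forall>x\<in>carrier M. e x \<in> V \<and> x \<ominus>\<^bsub>M\<^esub> e x \<in> N) \<and> (\<forall>x\<in>V. e x = x)"
proof -
  obtain Y where Y: "submodule Y R M \<and> Y \<subseteq> N \<and> V \<inter> Y = {\<zero>\<^bsub>M\<^esub>} \<and> V <+>\<^bsub>M\<^esub> Y = carrier M"
    using delta_small_complement [OF assms] by (rule exE)
  then have "\<exists>e\<in>linear_maps R M M. (\<forall>x\<in>carrier M. e x \<in> V \<and> x \<ominus>\<^bsub>M\<^esub> e x \<in> Y) \<and> (\<forall>x\<in>V. e x = x)"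
    by (intro direct_sum_projection V) simp_all
  with Y show ?thesis
    by blast
qed

end

section \<open>Projective modules\<close>

text \<open>
  The linear forms \<open>\<pi> y\<close> are the coordinates of a section of the canonical epimorphism from the free
  module with basis \<open>carrier P\<close> onto \<open>P\<close>.
\<close>

lemma projective_dual_basis:
  fixes P :: "('a, 'c) module"
  assumes P: "projective_module R P"
  shows "\<exists>\<pi>. (\<forall>y. \<pi> y \<in> linear_maps R P (right_regular R)) \<and>
    (\<forall>x\<in>carrier P. finite {y. \<pi> y x \<noteq> \<zero>\<^bsub>R\<^esub>} \<and> {y. \<pi> y x \<noteq> \<zero>\<^bsub>R\<^esub>} \<subseteq> carrier P \<and>
      (\<Oplus>\<^bsub>P\<^esub>y\<in>{y. \<pi> y x \<noteq> \<zero>\<^bsub>R\<^esub>}. \<pi> y x \<odot>\<^bsub>P\<^esub> y) = x)"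
proof -
  interpret P: right_module R P
    using P by (simp add: projective_module_def)
  let ?B = "free_right_module R (carrier P)"
  let ?e = "linear_combination R P (\<lambda>y. y)"
  have B: "right_module R ?B"
    by (rule right_module_free [OF P.R.ring_axioms])
  have e: "?e \<in> linear_maps R ?B P"
    by (rule linear_combination_linear [OF P.right_module_axioms]) auto
  have "x \<in> ?e ` carrier ?B" if x: "x \<in> carrier P" for x
  proof
    let ?c = "\<lambda>y. if y = x then \<one>\<^bsub>R\<^esub> else \<zero>\<^bsub>R\<^esub>"
    show c: "?c \<in> carrier ?B"
      using x by (auto simp: free_right_module_def)
    have "?e ?c = (\<Oplus>\<^bsub>P\<^esub>y\<in>{x}. ?c y \<odot>\<^bsub>P\<^esub> y)"
      by (rule linear_combination_superset [OF P.right_module_axioms c]) (use x in auto)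
    then show "x = ?e ?c"
      using x by simp
  qed
  then have "?e \<in> epimorphisms R ?B P"
    using linear_mapsD(1) [OF e] e by (auto simp: epimorphisms_def)
  from projective_lifting [OF P B P.right_module_axioms this linear_maps_id]
  obtain s where s: "s \<in> linear_maps R P ?B" "\<And>x. x \<in> carrier P \<Longrightarrow> ?e (s x) = x"
    by blast
  note sD = linear_mapsD [OF s(1)]
  have fin: "range (s x) \<subseteq> carrier R" "finite {y. s x y \<noteq> \<zero>\<^bsub>R\<^esub>}" "{y. s x y \<noteq> \<zero>\<^bsub>R\<^esub>} \<subseteq> carrier P"
    if "x \<in> carrier P" for x
    using sD(1) [OF that] by (simp_all add: free_right_module_def)
  have "(\<lambda>x. s x y) \<in> linear_maps R P (right_regular R)" for y
    using sD(2,3) fin(1) by (intro linear_mapsI) (auto simp: free_right_module_def image_subset_iff)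
  moreover have "(\<Oplus>\<^bsub>P\<^esub>y\<in>{y. s x y \<noteq> \<zero>\<^bsub>R\<^esub>}. s x y \<odot>\<^bsub>P\<^esub> y) = x" if "x \<in> carrier P" for x
    using s(2) [OF that] by (simp add: linear_combination_def)
  ultimately show ?thesis
    using fin(2,3) by (intro exI [of _ "\<lambda>y x. s x y"]) simp
qed

lemma projective_retract:
  fixes P :: "('a, 'c) module" and F :: "('a, 'b) module"
  assumes P: "projective_module R P" and F: "right_module R F"
    and f: "f \<in> linear_maps R P F" and \<sigma>: "\<sigma> \<in> linear_maps R F P"
    and inverse: "\<And>y. y \<in> carrier F \<Longrightarrow> f (\<sigma> y) = y"
  shows "projective_module R F"
  unfolding projective_module_def
proof (intro conjI allI impI F)
  fix M :: "('a, 'b \<Rightarrow> 'a) module" and N :: "('a, 'b) module" and g \<phi>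
  assume *: "right_module R M \<and> right_module R N \<and> g \<in> epimorphisms R M N \<and> \<phi> \<in> linear_maps R F N"
  then have M: "right_module R M" and N: "right_module R N" and g: "g \<in> epimorphisms R M N"
    and \<phi>: "\<phi> \<in> linear_maps R F N"
    by simp_all
  obtain h where h: "h \<in> linear_maps R P M" "\<forall>x\<in>carrier P. g (h x) = \<phi> (f x)"
    using projective_lifting [OF P M N g linear_maps_compose [OF f \<phi>]] by (elim bexE) (rule that)
  have "g (h (\<sigma> y)) = \<phi> y" if "y \<in> carrier F" for y
    using h(2) linear_mapsD(1) [OF \<sigma> that] inverse [OF that] by simp
  with linear_maps_compose [OF \<sigma> h(1)]
  show "\<exists>h\<in>linear_maps R F M. \<forall>x\<in>carrier F. g (h x) = \<phi> x"
    by (intro bexI [of _ "\<lambda>y. h (\<sigma> y)"]) simp_all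
qed

section \<open>Kernels of epimorphisms onto flat modules\<close>

definition left_regular :: "('a, 'r) ring_scheme \<Rightarrow> ('a, 'a) module"
  where "left_regular R =
    \<lparr>carrier = carrier R, monoid.mult = monoid.mult R, one = \<one>\<^bsub>R\<^esub>, ring.zero = \<zero>\<^bsub>R\<^esub>, add = add R,
     smult = (\<lambda>a x. a \<otimes>\<^bsub>R\<^esub> x)\<rparr>"

lemma left_regular_simps [simp]:
  "carrier (left_regular R) = carrier R"
  "\<zero>\<^bsub>left_regular R\<^esub> = \<zero>\<^bsub>R\<^esub>"
  "x \<oplus>\<^bsub>left_regular R\<^esub> y = x \<oplus>\<^bsub>R\<^esub> y"
  "a \<odot>\<^bsub>left_regular R\<^esub> x = a \<otimes>\<^bsub>R\<^esub> x"
  by (simp_all add: left_regular_def)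

lemma left_module_regular:
  assumes "ring R"
  shows "left_module R (left_regular R)"
proof -
  interpret ring R by fact
  have "abelian_group (left_regular R)"
    by (rule abelian_groupI) (auto simp: a_ac intro: l_neg)
  then show ?thesis
    unfolding left_module_def left_module_axioms_def
    using assms by (auto simp: l_distr r_distr m_assoc)
qed

lemma tensor_relations_diff:
  assumes M: "right_module R M" and N: "left_module R N"
    and u: "u \<in> tensor_relations R M N" and v: "v \<in> tensor_relations R M N"
  shows "u - v \<in> tensor_relations R M N"
proof -
  let ?G = "free_Abelian_group (carrier M \<times> carrier N)"
  interpret N: normal "tensor_relations R M N" ?G
    by (rule tensor_relations_normal [OF M N])
  have "v \<in> carrier ?G"
    using N.subset v by blast
  then have "inv\<^bsub>?G\<^esub> v = - v"
    by (intro inv_free_Abelian_group) (simp only: carrier_free_Abelian_group_iff [symmetric])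
  then show ?thesis
    using subgroup.m_closed [OF N.subgroup_axioms u subgroup.m_inv_closed [OF N.subgroup_axioms v]] by simp
qed

lemma tensor_relators_in_relations: "w \<in> tensor_relators R M N \<Longrightarrow> w \<in> tensor_relations R M N"
  unfolding tensor_relations_def by (rule generate.incl)

text \<open>
  In the tensor product with \<open>R\<close>, the tensor of \<open>x i\<close> with \<open>c i\<close> equals the tensor of \<open>x i c i\<close>
  with \<open>1\<close>; so a sum of such tensors vanishes as soon as the sum of the \<open>x i c i\<close> does.
\<close>

lemma tensor_regular_collapse:
  assumes F: "right_module R F" and A: "finite A"
    and x: "\<And>i. i \<in> A \<Longrightarrow> x i \<in> carrier F" and c: "\<And>i. i \<in> A \<Longrightarrow> c i \<in> carrier R"
  shows "(\<Sum>i\<in>A. frag_of (x i, c i)) - frag_of (\<Oplus>\<^bsub>F\<^esub>i\<in>A. c i \<odot>\<^bsub>F\<^esub> x i, \<one>\<^bsub>R\<^esub>)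
    \<in> tensor_relations R F (left_regular R)"
proof -
  interpret F: right_module R F by fact
  note L = left_module_regular [OF F.R.ring_axioms]
  note diff = tensor_relations_diff [OF F L]
  have sum_rel: "frag_of (y \<oplus>\<^bsub>F\<^esub> z, \<one>\<^bsub>R\<^esub>) - frag_of (y, \<one>\<^bsub>R\<^esub>) - frag_of (z, \<one>\<^bsub>R\<^esub>)
      \<in> tensor_relations R F (left_regular R)" if "y \<in> carrier F" "z \<in> carrier F" for y z
    by (rule tensor_relators_in_relations) (use that in \<open>auto simp: tensor_relators_def\<close>)
  have smult_rel: "frag_of (a \<odot>\<^bsub>F\<^esub> y, \<one>\<^bsub>R\<^esub>) - frag_of (y, a) \<in> tensor_relations R F (left_regular R)"
    if "a \<in> carrier R" "y \<in> carrier F" for a y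
  proof (rule tensor_relators_in_relations)
    have "frag_of (a \<odot>\<^bsub>F\<^esub> y, \<one>\<^bsub>R\<^esub>) - frag_of (y, a) =
        frag_of (a \<odot>\<^bsub>F\<^esub> y, \<one>\<^bsub>R\<^esub>) - frag_of (y, a \<odot>\<^bsub>left_regular R\<^esub> \<one>\<^bsub>R\<^esub>)"
      using that by simp
    then show "frag_of (a \<odot>\<^bsub>F\<^esub> y, \<one>\<^bsub>R\<^esub>) - frag_of (y, a) \<in> tensor_relators R F (left_regular R)"
      unfolding tensor_relators_def using that
      by (intro UnI2 CollectI exI [of _ a] exI [of _ y] exI [of _ "\<one>\<^bsub>R\<^esub>"] conjI) auto
  qed
  show ?thesis
    using A x c
  proof (induction A)
    case empty
    then show ?case
      \<comment> \<open>the relator of \<open>0 + 0 = 0\<close> is minus the generator \<open>(0, 1)\<close>\<close>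
      using sum_rel [of "\<zero>\<^bsub>F\<^esub>" "\<zero>\<^bsub>F\<^esub>"] by simp
  next
    case (insert j A)
    let ?s = "\<Oplus>\<^bsub>F\<^esub>i\<in>A. c i \<odot>\<^bsub>F\<^esub> x i"
    have j: "c j \<in> carrier R" "x j \<in> carrier F"
      using insert.prems by auto
    have s: "?s \<in> carrier F"
      using insert.prems by (intro F.M.finsum_closed) auto
    have "(\<Oplus>\<^bsub>F\<^esub>i\<in>insert j A. c i \<odot>\<^bsub>F\<^esub> x i) = c j \<odot>\<^bsub>F\<^esub> x j \<oplus>\<^bsub>F\<^esub> ?s"
      using insert by (intro F.M.finsum_insert) auto
    moreover have "((\<Sum>i\<in>A. frag_of (x i, c i)) - frag_of (?s, \<one>\<^bsub>R\<^esub>))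
        - (frag_of (c j \<odot>\<^bsub>F\<^esub> x j \<oplus>\<^bsub>F\<^esub> ?s, \<one>\<^bsub>R\<^esub>) - frag_of (c j \<odot>\<^bsub>F\<^esub> x j, \<one>\<^bsub>R\<^esub>) - frag_of (?s, \<one>\<^bsub>R\<^esub>))
        - (frag_of (c j \<odot>\<^bsub>F\<^esub> x j, \<one>\<^bsub>R\<^esub>) - frag_of (x j, c j))
      \<in> tensor_relations R F (left_regular R)"
      using insert j s by (intro diff sum_rel smult_rel insert.IH) auto
    ultimately show ?case
      using insert.hyps by (simp add: algebra_simps)
  qed
qed

text \<open>
  For the kernel \<open>K\<close> of \<open>f\<close> and a left ideal \<open>I\<close>, this is the inclusion \<open>K \<inter> P I \<subseteq> K I\<close>, with \<open>K I\<close>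
  replaced by any additive subgroup \<open>T\<close> that contains the products of \<open>K\<close> and \<open>I\<close>. Choose a section
  \<open>s\<close> of \<open>f\<close> as a map of sets. It is linear modulo \<open>K\<close>, so sending the pair of \<open>x\<close> and \<open>b\<close> to \<open>s x b\<close>
  defines an additive map \<open>h\<close> on formal sums which takes the relations of \<open>F \<otimes> I\<close> into \<open>T\<close>. The
  tensor that belongs to the given sum vanishes in \<open>F \<otimes> R\<close>, hence by flatness in \<open>F \<otimes> I\<close>; and its
  value under \<open>h\<close> differs from the given sum by an element of \<open>T\<close>.
\<close>

lemma flat_kernel_ideal_sums:
  fixes P :: "('a, 'c) module" and F :: "('a, 'b) module"
  assumes Pm: "right_module R P" and flat: "flat_module R F" and f: "f \<in> epimorphisms R P F"
    and I: "submodule I R (left_regular R)"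
    and T: "subgroup T (add_monoid P)"
    and T_smult: "\<And>b \<kappa>. \<lbrakk>b \<in> I; \<kappa> \<in> carrier P; f \<kappa> = \<zero>\<^bsub>F\<^esub>\<rbrakk> \<Longrightarrow> b \<odot>\<^bsub>P\<^esub> \<kappa> \<in> T"
    and S: "finite S" "\<And>i. i \<in> S \<Longrightarrow> p i \<in> carrier P" "\<And>i. i \<in> S \<Longrightarrow> c i \<in> I"
    and ker: "f (\<Oplus>\<^bsub>P\<^esub>i\<in>S. c i \<odot>\<^bsub>P\<^esub> p i) = \<zero>\<^bsub>F\<^esub>"
  shows "(\<Oplus>\<^bsub>P\<^esub>i\<in>S. c i \<odot>\<^bsub>P\<^esub> p i) \<in> T"
proof -
  interpret P: right_module R P by (rule Pm)
  interpret F: right_module R F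
    using flat by (simp add: flat_module_def)
  note Fm = F.right_module_axioms
  interpret L: left_module R "left_regular R"
    by (rule left_module_regular [OF P.R.ring_axioms])
  have fl: "f \<in> linear_maps R P F"
    using f by (simp add: epimorphisms_def)
  note fD = linear_mapsD [OF fl]
  let ?L = "left_regular R" and ?L' = "(left_regular R)\<lparr>carrier := I\<rparr>"
  have L': "left_module R ?L'"
    by (rule L.left_submodule_module [OF I])
  have I_group: "subgroup I (add_monoid ?L)"
    using I by (rule submodule.axioms(1))
  have IR: "b \<in> carrier R" if "b \<in> I" for b
    using that subgroup.subset [OF I_group] by auto
  have I_add: "b \<oplus>\<^bsub>R\<^esub> b' \<in> I" if "b \<in> I" "b' \<in> I" for b b'
    using subgroup.m_closed [OF I_group that] by simp
  have incl: "(\<lambda>b. b) \<in> linear_maps R ?L' ?L"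
    using IR by (intro linear_mapsI) auto
  have TP: "t \<in> carrier P" if "t \<in> T" for t
    using that subgroup.subset [OF T] by auto
  have T0: "\<zero>\<^bsub>P\<^esub> \<in> T"
    using subgroup.one_closed [OF T] by simp
  have T_add: "t \<oplus>\<^bsub>P\<^esub> t' \<in> T" if "t \<in> T" "t' \<in> T" for t t'
    using subgroup.m_closed [OF T that] by simp
  have T_minus: "t \<ominus>\<^bsub>P\<^esub> t' \<in> T" if "t \<in> T" "t' \<in> T" for t t'
    using T_add [OF that(1) subgroup.m_inv_closed [OF T that(2)]] by (simp add: a_minus_def a_inv_def)
  have T_sum: "(\<Oplus>\<^bsub>P\<^esub>i\<in>A. t i) \<in> T" if "finite A" "\<And>i. i \<in> A \<Longrightarrow> t i \<in> T" for A and t :: "'i \<Rightarrow> 'c"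
    using that by (induction A) (auto simp: T0 T_add TP Pi_def)

  note SP = S(2)
  have cR: "c i \<in> carrier R" if "i \<in> S" for i
    using IR [OF S(3) [OF that]] .
  obtain s where s: "\<forall>y\<in>carrier F. s y \<in> carrier P \<and> f (s y) = y"
    using epimorphism_section [OF f] by (rule exE)
  then have sP: "s y \<in> carrier P" and fs: "f (s y) = y" if "y \<in> carrier F" for y
    using that by simp_all

  let ?G = "free_Abelian_group (carrier F \<times> I)"
  have "(\<lambda>(x, b). b \<odot>\<^bsub>P\<^esub> s x) ` (carrier F \<times> I) \<subseteq> carrier (add_monoid P)"
    using sP IR by auto
  from comm_group.free_Abelian_group_universal [OF P.M.a_comm_group this]
  obtain h where h: "h \<in> hom ?G (add_monoid P)"
    and h_of': "\<And>p. p \<in> carrier F \<times> I \<Longrightarrow> h (frag_of p) = (case p of (x, b) \<Rightarrow> b \<odot>\<^bsub>P\<^esub> s x)"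
    by blast
  have h_of: "h (frag_of (x, b)) = b \<odot>\<^bsub>P\<^esub> s x" if "x \<in> carrier F" "b \<in> I" for x b
    using h_of' [of "(x, b)"] that by simp
  have hP: "h u \<in> carrier P" if "u \<in> carrier ?G" for u
    using h that by (auto simp: hom_def)
  have h_add: "h (u + v) = h u \<oplus>\<^bsub>P\<^esub> h v" if "u \<in> carrier ?G" "v \<in> carrier ?G" for u v
    using h that unfolding hom_def by simp
  have G_diff: "u - v \<in> carrier ?G" if "u \<in> carrier ?G" "v \<in> carrier ?G" for u v
    using that keys_diff [of u v] by auto
  have h_diff: "h (u - v) = h u \<ominus>\<^bsub>P\<^esub> h v" if "u \<in> carrier ?G" "v \<in> carrier ?G" for u v
    using h_add [OF G_diff [OF that] that(2)] hP that G_diff [OF that]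
    by (simp add: P.minus_add_cancel)
  have G_of: "frag_of (x, b) \<in> carrier ?G" if "x \<in> carrier F" "b \<in> I" for x b
    using that by simp
  have h0: "h 0 = \<zero>\<^bsub>P\<^esub>"
    using hom_one [OF h group_free_Abelian_group P.M.a_group] by simp

  have relators: "h w \<in> T \<and> w \<in> carrier ?G" if w: "w \<in> tensor_relators R F ?L'" for w
  proof -
    consider (1) x x' b where "x \<in> carrier F" "x' \<in> carrier F" "b \<in> I"
        "w = frag_of (x \<oplus>\<^bsub>F\<^esub> x', b) - frag_of (x, b) - frag_of (x', b)"
      | (2) x b b' where "x \<in> carrier F" "b \<in> I" "b' \<in> I"
        "w = frag_of (x, b \<oplus>\<^bsub>R\<^esub> b') - frag_of (x, b) - frag_of (x, b')"
      | (3) a x b where "a \<in> carrier R" "x \<in> carrier F" "b \<in> I"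
        "w = frag_of (a \<odot>\<^bsub>F\<^esub> x, b) - frag_of (x, a \<otimes>\<^bsub>R\<^esub> b)"
      using w unfolding tensor_relators_def by simp blast
    then show ?thesis
    proof cases
      case 1
      have xx: "x \<oplus>\<^bsub>F\<^esub> x' \<in> carrier F"
        using 1 by simp
      let ?\<kappa> = "s (x \<oplus>\<^bsub>F\<^esub> x') \<ominus>\<^bsub>P\<^esub> s x \<ominus>\<^bsub>P\<^esub> s x'"
      have "?\<kappa> \<in> carrier P" "f ?\<kappa> = \<zero>\<^bsub>F\<^esub>"
        using 1 xx by (simp_all add: sP fs linear_map_minus [OF Pm Fm fl] F.minus_add_cancel F.minus_eq_zero_iff)
      then have "b \<odot>\<^bsub>P\<^esub> ?\<kappa> \<in> T"
        by (rule T_smult [OF 1(3)])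
      moreover have "h w = b \<odot>\<^bsub>P\<^esub> ?\<kappa>"
        unfolding 1(4) using 1 xx IR
        by (simp add: h_diff G_diff G_of h_of sP P.smult_minus del: carrier_free_Abelian_group_iff)
      moreover have "w \<in> carrier ?G"
        unfolding 1(4) by (intro G_diff G_of xx 1)
      ultimately show ?thesis by simp
    next
      case 2
      have bb: "b \<oplus>\<^bsub>R\<^esub> b' \<in> I"
        using I_add 2 by simp
      have "h w = (b \<odot>\<^bsub>P\<^esub> s x \<oplus>\<^bsub>P\<^esub> b' \<odot>\<^bsub>P\<^esub> s x) \<ominus>\<^bsub>P\<^esub> b \<odot>\<^bsub>P\<^esub> s x \<ominus>\<^bsub>P\<^esub> b' \<odot>\<^bsub>P\<^esub> s x"
        unfolding 2(4) using 2 bb IR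
        by (simp add: h_diff G_diff G_of h_of sP P.smult_add_scalar del: carrier_free_Abelian_group_iff)
      also have "\<dots> = \<zero>\<^bsub>P\<^esub>"
        using 2 IR sP by (simp add: P.minus_add_cancel P.minus_eq_zero_iff)
      finally have "h w \<in> T"
        using T0 by simp
      moreover have "w \<in> carrier ?G"
        unfolding 2(4) by (intro G_diff G_of bb 2)
      ultimately show ?thesis by simp
    next
      case 3
      have ax: "a \<odot>\<^bsub>F\<^esub> x \<in> carrier F" and ab: "a \<otimes>\<^bsub>R\<^esub> b \<in> I"
        using 3 submodule.smult_closed [OF I, of a b] by simp_all
      let ?\<kappa> = "s (a \<odot>\<^bsub>F\<^esub> x) \<ominus>\<^bsub>P\<^esub> a \<odot>\<^bsub>P\<^esub> s x"
      have "?\<kappa> \<in> carrier P" "f ?\<kappa> = \<zero>\<^bsub>F\<^esub>"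
        using 3 ax by (simp_all add: sP fs fD(3) linear_map_minus [OF Pm Fm fl] F.minus_eq_zero_iff)
      then have "b \<odot>\<^bsub>P\<^esub> ?\<kappa> \<in> T"
        by (rule T_smult [OF 3(3)])
      moreover have "h w = b \<odot>\<^bsub>P\<^esub> ?\<kappa>"
        unfolding 3(4) using 3 ax ab IR
        by (simp add: h_diff G_diff G_of h_of sP P.smult_minus P.smult_assoc
            del: carrier_free_Abelian_group_iff)
      moreover have "w \<in> carrier ?G"
        unfolding 3(4) by (intro G_diff G_of ax ab 3)
      ultimately show ?thesis by simp
    qed
  qed
  have relations: "h w \<in> T" if w: "w \<in> tensor_relations R F ?L'" for w
  proof -
    have G0: "0 \<in> carrier ?G" and G_add: "\<And>u v. \<lbrakk>u \<in> carrier ?G; v \<in> carrier ?G\<rbrakk> \<Longrightarrow> u + v \<in> carrier ?G"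
      using keys_add by (auto dest!: subsetD [OF keys_add])
    have "h w \<in> T \<and> w \<in> carrier ?G"
      using w unfolding tensor_relations_def
    proof induction
      case one
      show ?case
        using h0 T0 G0 by (simp only: one_free_Abelian_group simp_thms)
    next
      case (incl w)
      then show ?case by (rule relators)
    next
      case (inv w)
      note w = relators [OF inv]
      have "inv\<^bsub>free_Abelian_group (carrier F \<times> carrier ?L')\<^esub> w = 0 - w"
        using w by simp
      moreover have "h (0 - w) \<in> T"
        using w G0 by (simp only: h_diff h0 T_minus T0)
      moreover have "0 - w \<in> carrier ?G"
        using w G0 by (simp only: G_diff)
      ultimately show ?case
        by (simp only: simp_thms)
    next
      case (eng u v)
      then show ?case
        by (simp only: mult_free_Abelian_group h_add T_add G_add simp_thms)
    qed
    then show ?thesis by blast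
  qed

  define u where "u = (\<Sum>i\<in>S. frag_of (f (p i), c i))"
  have sum_G: "(\<Sum>i\<in>A. frag_of (f (p i), c i)) \<in> carrier ?G \<and>
      h (\<Sum>i\<in>A. frag_of (f (p i), c i)) = (\<Oplus>\<^bsub>P\<^esub>i\<in>A. c i \<odot>\<^bsub>P\<^esub> s (f (p i)))"
    if "finite A" "A \<subseteq> S" for A
    using that
  proof (induction A)
    case empty
    show ?case by (simp add: h0)
  next
    case (insert i A)
    then have y: "f (p i) \<in> carrier F" "c i \<in> I" "c i \<in> carrier R"
      and A: "\<And>j. j \<in> A \<Longrightarrow> f (p j) \<in> carrier F \<and> c j \<in> carrier R"
      using SP S(3) fD(1) cR by auto
    have "(\<Oplus>\<^bsub>P\<^esub>j\<in>insert i A. c j \<odot>\<^bsub>P\<^esub> s (f (p j))) =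
        c i \<odot>\<^bsub>P\<^esub> s (f (p i)) \<oplus>\<^bsub>P\<^esub> (\<Oplus>\<^bsub>P\<^esub>j\<in>A. c j \<odot>\<^bsub>P\<^esub> s (f (p j)))"
      using insert.hyps y A sP by (intro P.M.finsum_insert) auto
    moreover have "frag_of (f (p i), c i) + w \<in> carrier ?G" if "w \<in> carrier ?G" for w
      using that G_of [OF y(1,2)] by (auto dest!: subsetD [OF keys_add])
    ultimately show ?case
      using insert G_of [OF y(1,2)] by (simp add: h_add h_of y del: carrier_free_Abelian_group_iff)
  qed
  have u: "u \<in> carrier ?G" "h u = (\<Oplus>\<^bsub>P\<^esub>i\<in>S. c i \<odot>\<^bsub>P\<^esub> s (f (p i)))"
    using sum_G [OF S(1) order.refl] by (simp_all only: u_def)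

  have "(\<Oplus>\<^bsub>F\<^esub>i\<in>S. c i \<odot>\<^bsub>F\<^esub> f (p i)) = (\<Oplus>\<^bsub>F\<^esub>i\<in>S. f (c i \<odot>\<^bsub>P\<^esub> p i))"
    using SP fD cR by (intro F.M.finsum_cong') auto
  also have "\<dots> = \<zero>\<^bsub>F\<^esub>"
    using linear_map_finsum [OF Pm Fm fl S(1), of "\<lambda>i. c i \<odot>\<^bsub>P\<^esub> p i"] SP cR ker by simp
  finally have fsum: "(\<Oplus>\<^bsub>F\<^esub>i\<in>S. c i \<odot>\<^bsub>F\<^esub> f (p i)) = \<zero>\<^bsub>F\<^esub>" .
  have "u - frag_of (\<zero>\<^bsub>F\<^esub>, \<one>\<^bsub>R\<^esub>) \<in> tensor_relations R F ?L"
    using tensor_regular_collapse [OF Fm S(1), of "\<lambda>i. f (p i)" c] SP fD(1) cR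
    unfolding u_def fsum by blast
  from tensor_relations_diff [OF Fm L.left_module_axioms this
      tensor_regular_collapse [OF Fm finite.emptyI, of "\<lambda>i. f (p i)" c]]
  have "formal_map (\<lambda>b. b) u \<in> tensor_relations R F ?L"
    by (simp add: formal_map_id)
  moreover have "inj_on (tensor_map R F ?L (\<lambda>b. b)) (carrier (tensor_product R F ?L'))"
    using incl by (intro flat_preserves_monomorphisms [OF flat L' L.left_module_axioms])
      (simp add: monomorphisms_def)
  moreover have "u \<in> carrier (free_Abelian_group (carrier F \<times> carrier ?L'))"
    using u(1) by simp
  ultimately have "u \<in> tensor_relations R F ?L'"
    unfolding inj_on_tensor_map_iff [OF Fm L' L.left_module_axioms incl] by blast
  then have "h u \<in> T"
    by (rule relations)
  moreover have "(\<Oplus>\<^bsub>P\<^esub>i\<in>S. c i \<odot>\<^bsub>P\<^esub> (p i \<ominus>\<^bsub>P\<^esub> s (f (p i)))) \<in> T"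
  proof (rule T_sum [OF S(1)], rule T_smult [OF S(3)])
    fix i assume "i \<in> S"
    then show "p i \<ominus>\<^bsub>P\<^esub> s (f (p i)) \<in> carrier P" "f (p i \<ominus>\<^bsub>P\<^esub> s (f (p i))) = \<zero>\<^bsub>F\<^esub>"
      using SP fD(1) sP fs by (simp_all add: linear_map_minus [OF Pm Fm fl] F.minus_eq_zero_iff)
  qed
  moreover have "h u \<oplus>\<^bsub>P\<^esub> (\<Oplus>\<^bsub>P\<^esub>i\<in>S. c i \<odot>\<^bsub>P\<^esub> (p i \<ominus>\<^bsub>P\<^esub> s (f (p i)))) =
      (\<Oplus>\<^bsub>P\<^esub>i\<in>S. c i \<odot>\<^bsub>P\<^esub> p i)"
  proof -
    have fS: "f (p i) \<in> carrier F" if "i \<in> S" for i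
      using that SP fD(1) by blast
    have "h u \<oplus>\<^bsub>P\<^esub> (\<Oplus>\<^bsub>P\<^esub>i\<in>S. c i \<odot>\<^bsub>P\<^esub> (p i \<ominus>\<^bsub>P\<^esub> s (f (p i))))
        = (\<Oplus>\<^bsub>P\<^esub>i\<in>S. c i \<odot>\<^bsub>P\<^esub> s (f (p i)) \<oplus>\<^bsub>P\<^esub> c i \<odot>\<^bsub>P\<^esub> (p i \<ominus>\<^bsub>P\<^esub> s (f (p i))))"
      unfolding u(2) using SP fS sP cR by (intro P.M.finsum_addf [symmetric]) auto
    also have "\<dots> = (\<Oplus>\<^bsub>P\<^esub>i\<in>S. c i \<odot>\<^bsub>P\<^esub> p i)"
      using SP fS sP cR
      by (intro P.M.finsum_cong') (auto simp: P.smult_add_vector [symmetric] P.minus_add_cancel)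
    finally show ?thesis .
  qed
  ultimately show ?thesis
    using T_add by metis
qed

text \<open>
  Villamayor's criterion. Let \<open>I\<close> be the left ideal of the values at \<open>k\<close> of all linear forms on \<open>P\<close>.
  A dual basis shows that \<open>k\<close> lies in \<open>P I\<close>, hence in \<open>K I\<close>. An element of \<open>K I\<close> is a sum of
  products \<open>\<kappa> (\<phi> k)\<close> with \<open>\<kappa> \<in> K\<close> and a linear form \<open>\<phi>\<close>, that is, the value at \<open>k\<close> of an endomorphism
  with image in \<open>K\<close>. Using all linear forms and all such endomorphisms avoids the coordinates of \<open>k\<close>.
\<close>

lemma flat_kernel_fixed:
  fixes P :: "('a, 'c) module" and F :: "('a, 'b) module"
  assumes P: "projective_module R P" and flat: "flat_module R F" and f: "f \<in> epimorphisms R P F"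
    and k: "k \<in> carrier P" "f k = \<zero>\<^bsub>F\<^esub>"
  shows "\<exists>\<theta>\<in>linear_maps R P P. (\<forall>x\<in>carrier P. f (\<theta> x) = \<zero>\<^bsub>F\<^esub>) \<and> \<theta> k = k"
proof -
  interpret P: right_module R P
    using P by (simp add: projective_module_def)
  interpret F: right_module R F
    using flat by (simp add: flat_module_def)
  note Pm = P.right_module_axioms and Fm = F.right_module_axioms
  note RR = right_module_regular [OF P.R.ring_axioms]
  interpret L: left_module R "left_regular R"
    by (rule left_module_regular [OF P.R.ring_axioms])
  have fl: "f \<in> linear_maps R P F"
    using f by (simp add: epimorphisms_def)
  note fD = linear_mapsD [OF fl]
  let ?dual = "linear_maps R P (right_regular R)"
  let ?K = "{\<kappa> \<in> carrier P. f \<kappa> = \<zero>\<^bsub>F\<^esub>}"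
  have K: "submodule ?K R P"
    using submodule_vimage [OF Pm Fm fl F.submodule_zero] by simp
  note KD = P.submoduleD [OF K]
  have const0: "(\<lambda>x. \<zero>\<^bsub>R\<^esub>) \<in> ?dual"
    by (rule linear_mapsI) auto

  define I where "I = {\<phi> k | \<phi>. \<phi> \<in> ?dual}"
  have I: "submodule I R (left_regular R)"
  proof (rule L.left_submoduleI)
    show "I \<subseteq> carrier (left_regular R)"
      using linear_mapsD(1) k(1) by (fastforce simp: I_def)
    show "\<zero>\<^bsub>left_regular R\<^esub> \<in> I"
      using const0 by (auto simp: I_def)
  next
    fix b b' assume "b \<in> I" "b' \<in> I"
    then obtain \<phi> \<phi>' where *: "\<phi> \<in> ?dual" "\<phi>' \<in> ?dual" "b = \<phi> k" "b' = \<phi>' k"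
      by (auto simp: I_def)
    then have "(\<lambda>x. \<phi> x \<oplus>\<^bsub>R\<^esub> \<phi>' x) \<in> ?dual"
      using linear_maps_add [OF RR, of \<phi> P \<phi>'] by simp
    with * show "b \<oplus>\<^bsub>left_regular R\<^esub> b' \<in> I"
      by (auto simp: I_def)
  next
    fix a b assume a: "a \<in> carrier R" and "b \<in> I"
    then obtain \<phi> where *: "\<phi> \<in> ?dual" "b = \<phi> k"
      by (auto simp: I_def)
    have "(\<lambda>x. a \<otimes>\<^bsub>R\<^esub> x) \<in> linear_maps R (right_regular R) (right_regular R)"
      using a by (intro linear_mapsI) (auto simp: P.R.r_distr P.R.m_assoc)
    from linear_maps_compose [OF *(1) this] show "a \<odot>\<^bsub>left_regular R\<^esub> b \<in> I"
      using * by (auto simp: I_def)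
  qed
  define T where "T = {\<theta> k | \<theta>. \<theta> \<in> linear_maps R P P \<and> (\<forall>x\<in>carrier P. f (\<theta> x) = \<zero>\<^bsub>F\<^esub>)}"
  have TP: "t \<in> carrier P" if "t \<in> T" for t
    using that linear_mapsD(1) k(1) by (fastforce simp: T_def)
  have T_smult: "b \<odot>\<^bsub>P\<^esub> \<kappa> \<in> T" if "b \<in> I" "\<kappa> \<in> carrier P" "f \<kappa> = \<zero>\<^bsub>F\<^esub>" for b \<kappa>
  proof -
    obtain \<phi> where \<phi>: "\<phi> \<in> ?dual" "b = \<phi> k"
      using \<open>b \<in> I\<close> by (auto simp: I_def)
    note \<kappa> = that(2,3)
    have "(\<lambda>x. \<phi> x \<odot>\<^bsub>P\<^esub> \<kappa>) \<in> linear_maps R P P"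
      by (rule linear_maps_compose [OF \<phi>(1) P.linear_map_orbit [OF \<kappa>(1)]])
    moreover have "f (\<phi> x \<odot>\<^bsub>P\<^esub> \<kappa>) = \<zero>\<^bsub>F\<^esub>" if "x \<in> carrier P" for x
      using linear_mapsD(1) [OF \<phi>(1) that] fD(3) [OF _ \<kappa>(1)] \<kappa>(2) by (simp add: F.smult_zero_vector)
    ultimately show ?thesis
      unfolding T_def \<phi>(2) by (intro CollectI exI [of _ "\<lambda>x. \<phi> x \<odot>\<^bsub>P\<^esub> \<kappa>"]) simp
  qed
  have T_minus: "t \<ominus>\<^bsub>P\<^esub> t' \<in> T" if tt: "t \<in> T" "t' \<in> T" for t t'
  proof -
    obtain \<theta> where \<theta>: "\<theta> \<in> linear_maps R P P" "\<forall>x\<in>carrier P. f (\<theta> x) = \<zero>\<^bsub>F\<^esub>" "t = \<theta> k"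
      using tt(1) by (auto simp: T_def)
    obtain \<theta>' where \<theta>': "\<theta>' \<in> linear_maps R P P" "\<forall>x\<in>carrier P. f (\<theta>' x) = \<zero>\<^bsub>F\<^esub>" "t' = \<theta>' k"
      using tt(2) by (auto simp: T_def)
    have "f (\<theta> x \<ominus>\<^bsub>P\<^esub> \<theta>' x) = \<zero>\<^bsub>F\<^esub>" if x: "x \<in> carrier P" for x
      using KD(5) [of "\<theta> x" "\<theta>' x"] linear_mapsD(1) [OF \<theta>(1) x] linear_mapsD(1) [OF \<theta>'(1) x]
        bspec [OF \<theta>(2) x] bspec [OF \<theta>'(2) x] by simp
    with linear_maps_minus [OF Pm \<theta>(1) \<theta>'(1)] show ?thesis
      unfolding T_def \<theta>(3) \<theta>'(3)
      by (intro CollectI exI [of _ "\<lambda>x. \<theta> x \<ominus>\<^bsub>P\<^esub> \<theta>' x"]) simp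
  qed
  have "\<zero>\<^bsub>R\<^esub> \<in> I"
    unfolding I_def using const0 by (intro CollectI exI [of _ "\<lambda>x. \<zero>\<^bsub>R\<^esub>"]) simp
  then have T0: "\<zero>\<^bsub>P\<^esub> \<in> T"
    using T_smult [of "\<zero>\<^bsub>R\<^esub>" "\<zero>\<^bsub>P\<^esub>"] KD(2) by (simp add: P.smult_zero_scalar)
  have "subgroup T (add_monoid P)"
  proof (rule P.M.add.subgroupI)
    show "T \<subseteq> carrier P" "T \<noteq> {}"
      using TP T0 by auto
    show "\<ominus>\<^bsub>P\<^esub> t \<in> T" if "t \<in> T" for t
      using T_minus [OF T0 that] TP [OF that] by (simp add: a_minus_def)
    show "t \<oplus>\<^bsub>P\<^esub> t' \<in> T" if "t \<in> T" "t' \<in> T" for t t'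
      using T_minus [OF that(1) T_minus [OF T0 that(2)]] TP [OF that(1)] TP [OF that(2)]
      by (simp add: a_minus_def)
  qed

  obtain \<pi> where \<pi>: "\<And>y. \<pi> y \<in> ?dual"
    and "finite {y. \<pi> y k \<noteq> \<zero>\<^bsub>R\<^esub>}" "{y. \<pi> y k \<noteq> \<zero>\<^bsub>R\<^esub>} \<subseteq> carrier P"
      "(\<Oplus>\<^bsub>P\<^esub>y\<in>{y. \<pi> y k \<noteq> \<zero>\<^bsub>R\<^esub>}. \<pi> y k \<odot>\<^bsub>P\<^esub> y) = k"
    using projective_dual_basis [OF P] k(1) by blast
  then obtain S where S: "finite S" "S \<subseteq> carrier P" "(\<Oplus>\<^bsub>P\<^esub>y\<in>S. \<pi> y k \<odot>\<^bsub>P\<^esub> y) = k"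
    by blast
  have "(\<Oplus>\<^bsub>P\<^esub>y\<in>S. \<pi> y k \<odot>\<^bsub>P\<^esub> y) \<in> T"
  proof (rule flat_kernel_ideal_sums [OF Pm flat f I \<open>subgroup T (add_monoid P)\<close> T_smult S(1)])
    show "\<pi> y k \<in> I" for y
      using \<pi> by (auto simp: I_def)
    show "f (\<Oplus>\<^bsub>P\<^esub>y\<in>S. \<pi> y k \<odot>\<^bsub>P\<^esub> y) = \<zero>\<^bsub>F\<^esub>"
      using S(3) k(2) by simp
  qed (use S(2) in auto)
  then have "k \<in> T"
    using S(3) by simp
  then obtain \<theta> where "\<theta> \<in> linear_maps R P P" "\<forall>x\<in>carrier P. f (\<theta> x) = \<zero>\<^bsub>F\<^esub>" "k = \<theta> k"
    unfolding T_def by blast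
  then show ?thesis
    by (intro bexI [of _ \<theta>]) simp_all
qed

section \<open>\<open>\<delta>\<close>-small submodules and the right socle\<close>

text \<open>
  If \<open>\<pi> k\<close> is not in the socle, some essential right ideal \<open>L\<close> misses it. With \<open>\<alpha> = 1 - \<theta>\<close>, the
  submodules \<open>\<alpha> P\<close> and \<open>K\<close> span \<open>P\<close>, so \<open>\<alpha> P\<close> is a direct summand; projectivity of \<open>P\<close> then lifts the
  projection \<open>e\<close> onto \<open>\<alpha> P\<close> along \<open>\<alpha>\<close>, and one obtains a projection \<open>\<epsilon>\<close> of \<open>P\<close> onto the kernel of
  \<open>\<alpha>\<close>. This kernel contains \<open>k\<close> and lies in \<open>K\<close>. The preimage \<open>W\<close> of \<open>L\<close> under \<open>\<pi> \<circ> \<epsilon>\<close> has a singular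
  quotient, contains the complement \<open>ker \<epsilon>\<close>, and misses \<open>k\<close>: a contradiction to \<open>\<delta>\<close>-smallness of \<open>K\<close>.
\<close>

lemma delta_small_fixed_dual_in_socle:
  fixes P :: "('a, 'c) module"
  assumes P: "projective_module R P" and K: "delta_small R P K"
    and \<theta>: "\<theta> \<in> linear_maps R P P" "\<And>x. x \<in> carrier P \<Longrightarrow> \<theta> x \<in> K"
    and k: "k \<in> carrier P" "\<theta> k = k"
    and \<pi>: "\<pi> \<in> linear_maps R P (right_regular R)"
  shows "\<pi> k \<in> right_socle R"
proof (rule ccontr)
  assume "\<pi> k \<notin> right_socle R"
  interpret P: right_module R P
    using P by (simp add: projective_module_def)
  note Pm = P.right_module_axioms
  note RR = right_module_regular [OF P.R.ring_axioms]
  interpret RR: right_module R "right_regular R" by (rule RR)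
  have Ksub: "submodule K R P"
    using K by (simp add: delta_small_def)
  note \<theta>D = linear_mapsD [OF \<theta>(1)] and \<pi>D = linear_mapsD [OF \<pi>]
  have "\<pi> k \<in> carrier (right_regular R)"
    by (rule \<pi>D(1) [OF k(1)])
  then obtain L where L: "essential_submodule R (right_regular R) L" "\<pi> k \<notin> L"
    using RR.essential_avoiding \<open>\<pi> k \<notin> right_socle R\<close> unfolding right_socle_def by blast
  have Lsub: "submodule L R (right_regular R)"
    using L(1) by (simp add: essential_submodule_def)

  define \<alpha> where "\<alpha> x = x \<ominus>\<^bsub>P\<^esub> \<theta> x" for x
  have \<alpha>: "\<alpha> \<in> linear_maps R P P"
    unfolding \<alpha>_def by (rule linear_maps_minus [OF Pm linear_maps_id \<theta>(1)])
  note \<alpha>D = linear_mapsD [OF \<alpha>]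
  have V: "submodule (\<alpha> ` carrier P) R P"
    by (rule submodule_image [OF Pm Pm \<alpha> P.submodule_carrier])
  have "\<alpha> ` carrier P <+>\<^bsub>P\<^esub> K = carrier P"
  proof
    show "\<alpha> ` carrier P <+>\<^bsub>P\<^esub> K \<subseteq> carrier P"
      using P.submoduleD(1) [OF P.submodule_sum(1) [OF V Ksub]] by blast
    have "x = \<alpha> x \<oplus>\<^bsub>P\<^esub> \<theta> x" if "x \<in> carrier P" for x
      using that \<theta>D(1) by (simp add: \<alpha>_def P.minus_add_cancel)
    then show "carrier P \<subseteq> \<alpha> ` carrier P <+>\<^bsub>P\<^esub> K"
      using \<theta>(2) by (force simp: P.set_add_iff)
  qed
  from P.delta_small_projection [OF K V this]
  obtain e where e: "e \<in> linear_maps R P P" "\<And>x. x \<in> carrier P \<Longrightarrow> e x \<in> \<alpha> ` carrier P"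
      "\<And>x. x \<in> \<alpha> ` carrier P \<Longrightarrow> e x = x"
    by blast
  let ?V = "P\<lparr>carrier := \<alpha> ` carrier P\<rparr>"
  have "\<alpha> \<in> epimorphisms R P ?V" "e \<in> linear_maps R P ?V"
    using \<alpha>D linear_mapsD [OF e(1)] e(2) by (auto simp: epimorphisms_def linear_maps_def)
  from projective_lifting [OF P Pm P.right_submodule_module [OF V] this]
  obtain \<sigma> where \<sigma>: "\<sigma> \<in> linear_maps R P P" "\<forall>x\<in>carrier P. \<alpha> (\<sigma> x) = e x"
    by (rule bexE)
  note \<sigma>D = linear_mapsD [OF \<sigma>(1)]

  define \<epsilon> where "\<epsilon> x = x \<ominus>\<^bsub>P\<^esub> \<sigma> (\<alpha> x)" for x
  have \<epsilon>: "\<epsilon> \<in> linear_maps R P P"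
    unfolding \<epsilon>_def by (intro linear_maps_minus [OF Pm linear_maps_id] linear_maps_compose [OF \<alpha> \<sigma>(1)])
  note \<epsilon>D = linear_mapsD [OF \<epsilon>]
  have \<alpha>\<epsilon>: "\<alpha> (\<epsilon> x) = \<zero>\<^bsub>P\<^esub>" if "x \<in> carrier P" for x
    using that \<alpha>D(1) \<sigma>D(1) \<sigma>(2) e(3)
    by (simp add: \<epsilon>_def linear_map_minus [OF Pm Pm \<alpha>] P.minus_eq_zero_iff)
  have \<epsilon>_fix: "\<epsilon> x = x" if "x \<in> carrier P" "\<alpha> x = \<zero>\<^bsub>P\<^esub>" for x
    using that by (simp add: \<epsilon>_def linear_map_zero [OF Pm Pm \<sigma>(1)] a_minus_def)
  have \<epsilon>K: "\<epsilon> x \<in> K" if x: "x \<in> carrier P" for x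
  proof -
    have "\<epsilon> x = \<theta> (\<epsilon> x)"
      using \<alpha>\<epsilon> [OF x] \<epsilon>D(1) [OF x] \<theta>D(1) by (simp add: \<alpha>_def P.minus_eq_zero_iff)
    then show ?thesis
      using \<theta>(2) [OF \<epsilon>D(1) [OF x]] by simp
  qed
  have \<epsilon>k: "\<epsilon> k = k"
    using k by (intro \<epsilon>_fix) (simp_all add: \<alpha>_def P.minus_eq_zero_iff)

  let ?W = "{x \<in> carrier P. \<pi> (\<epsilon> x) \<in> L}"
  have \<pi>\<epsilon>: "(\<lambda>x. \<pi> (\<epsilon> x)) \<in> linear_maps R P (right_regular R)"
    by (rule linear_maps_compose [OF \<epsilon> \<pi>])
  have W: "submodule ?W R P"
    by (rule submodule_vimage [OF Pm RR \<pi>\<epsilon> Lsub])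
  have "singular_module R (quotient_module R P ?W)"
  proof (rule P.singular_quotientI [OF W])
    fix x assume x: "x \<in> carrier P"
    have "essential_submodule R (right_regular R)
        {r \<in> carrier R. r \<odot>\<^bsub>right_regular R\<^esub> \<pi> (\<epsilon> x) \<in> L}"
      using L(1) linear_mapsD(1) [OF \<pi>\<epsilon> x]
      by (intro RR.essential_residual) (auto simp: essential_submodule_def)
    moreover have "{r \<in> carrier R. r \<odot>\<^bsub>right_regular R\<^esub> \<pi> (\<epsilon> x) \<in> L} = {r \<in> carrier R. r \<odot>\<^bsub>P\<^esub> x \<in> ?W}"
      using x linear_mapsD(3) [OF \<pi>\<epsilon> _ x] by auto
    ultimately show "essential_submodule R (right_regular R) {r \<in> carrier R. r \<odot>\<^bsub>P\<^esub> x \<in> ?W}"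
      by simp
  qed
  moreover have "K <+>\<^bsub>P\<^esub> ?W = carrier P"
  proof
    show "K <+>\<^bsub>P\<^esub> ?W \<subseteq> carrier P"
      using P.submoduleD(1) [OF P.submodule_sum(1) [OF Ksub W]] by blast
    show "carrier P \<subseteq> K <+>\<^bsub>P\<^esub> ?W"
    proof
      fix x assume x: "x \<in> carrier P"
      then have \<epsilon>x: "\<epsilon> x \<in> carrier P" and "\<epsilon> (\<epsilon> x) = \<epsilon> x"
        using \<epsilon>D(1) \<alpha>\<epsilon> \<epsilon>_fix by simp_all
      then have "\<epsilon> (x \<ominus>\<^bsub>P\<^esub> \<epsilon> x) = \<zero>\<^bsub>P\<^esub>"
        using x by (simp add: linear_map_minus [OF Pm Pm \<epsilon>] P.minus_eq_zero_iff)
      then have "x \<ominus>\<^bsub>P\<^esub> \<epsilon> x \<in> ?W"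
        using x \<epsilon>x RR.submoduleD(2) [OF Lsub] linear_map_zero [OF Pm RR \<pi>] by simp
      moreover have "x = \<epsilon> x \<oplus>\<^bsub>P\<^esub> (x \<ominus>\<^bsub>P\<^esub> \<epsilon> x)"
        using x \<epsilon>x by (simp add: P.minus_add_cancel)
      ultimately show "x \<in> K <+>\<^bsub>P\<^esub> ?W"
        unfolding P.set_add_iff using \<epsilon>K [OF x] by blast
    qed
  qed
  ultimately have "?W = carrier P"
    using K W unfolding delta_small_def by blast
  then have "\<pi> (\<epsilon> k) \<in> L"
    using k(1) by blast
  then show False
    using L(2) \<epsilon>k by simp
qed

text \<open>
  Adding an atom \<open>z\<close> enlarges the intersection of the span with \<open>K\<close> by at most one generator \<open>y\<close>. If \<open>\<theta>\<close>
  fixes the old intersection and \<open>\<eta>\<close> fixes \<open>y - \<theta> y\<close>, then \<open>\<theta>'\<close> with \<open>1 - \<theta>' = (1 - \<eta>) (1 - \<theta>)\<close>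
  fixes both.
\<close>

lemma (in right_module) endomorphism_fixing_atom_span:
  assumes K: "submodule K R M"
    and local: "\<And>k. k \<in> K \<Longrightarrow> \<exists>\<theta>\<in>linear_maps R M M. (\<forall>x\<in>carrier M. \<theta> x \<in> K) \<and> \<theta> k = k"
    and B: "finite B" "B \<subseteq> atoms R M"
  shows "\<exists>\<theta>\<in>linear_maps R M M. (\<forall>x\<in>carrier M. \<theta> x \<in> K) \<and>
    (\<forall>x\<in>K \<inter> submodule_span R M B. \<theta> x = x)"
  using B
proof (induction B)
  case empty
  have "submodule_span R M {} \<subseteq> {\<zero>\<^bsub>M\<^esub>}"
    by (rule submodule_span_least [OF submodule_zero]) simp
  moreover have "(\<lambda>x. \<zero>\<^bsub>M\<^esub>) \<in> linear_maps R M M"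
    by (rule linear_mapsI) (auto simp: smult_zero_vector)
  ultimately show ?case
    using submoduleD(2) [OF K] by (intro bexI [of _ "\<lambda>x. \<zero>\<^bsub>M\<^esub>"]) auto
next
  case (insert z B)
  then obtain \<theta> where \<theta>: "\<theta> \<in> linear_maps R M M" "\<forall>x\<in>carrier M. \<theta> x \<in> K"
      "\<forall>x\<in>K \<inter> submodule_span R M B. \<theta> x = x"
    by auto
  have z: "z \<in> atoms R M" "z \<in> carrier M" and BM: "B \<subseteq> carrier M"
    using insert.prems atoms_closed by auto
  let ?N = "submodule_span R M B"
  note N = submodule_span [OF BM]
  note KD = submoduleD [OF K] and ND = submoduleD [OF N] and \<theta>D = linear_mapsD [OF \<theta>(1)]
  have decomp: "\<exists>m\<in>?N. \<exists>r\<in>carrier R. x = m \<oplus>\<^bsub>M\<^esub> r \<odot>\<^bsub>M\<^esub> z"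
    if "x \<in> submodule_span R M (insert z B)" for x
    using subsetD [OF submodule_span_insert [OF z(2) BM] that] unfolding set_add_iff by blast
  show ?case
  proof (cases "K \<inter> submodule_span R M (insert z B) \<subseteq> ?N")
    case True
    with \<theta> show ?thesis
      by (intro bexI [of _ \<theta>]) blast+
  next
    case False
    then obtain y where y: "y \<in> K" "y \<in> submodule_span R M (insert z B)" "y \<notin> ?N"
      by blast
    then obtain m r where m: "m \<in> ?N" and r: "r \<in> carrier R" and yeq: "y = m \<oplus>\<^bsub>M\<^esub> r \<odot>\<^bsub>M\<^esub> z"
      using decomp by blast
    have yM: "y \<in> carrier M" and mM: "m \<in> carrier M"
      using y(1) KD(1) m ND(1) by auto
    have "r \<odot>\<^bsub>M\<^esub> z \<noteq> \<zero>\<^bsub>M\<^esub>"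
      using y(3) yeq m mM by auto
    then obtain q where q: "q \<in> carrier R" "q \<odot>\<^bsub>M\<^esub> (r \<odot>\<^bsub>M\<^esub> z) = z"
      using z(1) r by (auto simp: atoms_def)
    have "y \<ominus>\<^bsub>M\<^esub> \<theta> y \<in> K"
      using KD(5) y(1) \<theta>(2) yM by blast
    from local [OF this] obtain \<eta> where \<eta>: "\<eta> \<in> linear_maps R M M" "\<forall>x\<in>carrier M. \<eta> x \<in> K"
        "\<eta> (y \<ominus>\<^bsub>M\<^esub> \<theta> y) = y \<ominus>\<^bsub>M\<^esub> \<theta> y"
      by blast
    define \<theta>' where "\<theta>' x = \<theta> x \<oplus>\<^bsub>M\<^esub> \<eta> (x \<ominus>\<^bsub>M\<^esub> \<theta> x)" for x
    have \<theta>': "\<theta>' \<in> linear_maps R M M"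
      unfolding \<theta>'_def
      by (intro linear_maps_add [OF right_module_axioms \<theta>(1)] linear_maps_compose [OF _ \<eta>(1)]
          linear_maps_minus [OF right_module_axioms linear_maps_id \<theta>(1)])
    have \<theta>'K: "\<theta>' x \<in> K" if "x \<in> carrier M" for x
      using that \<theta>(2) \<eta>(2) \<theta>D(1) KD(3) by (simp add: \<theta>'_def)
    have fix_N: "\<theta>' x = x" if "x \<in> K" "x \<in> ?N" for x
    proof -
      have "\<theta> x = x" "x \<in> carrier M"
        using that \<theta>(3) KD(1) by auto
      moreover from this have "x \<ominus>\<^bsub>M\<^esub> \<theta> x = \<zero>\<^bsub>M\<^esub>"
        by (simp add: minus_eq_zero_iff)
      ultimately show ?thesis
        by (simp add: \<theta>'_def linear_map_zero [OF right_module_axioms right_module_axioms \<eta>(1)])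
    qed
    have fix_y: "\<theta>' y = y"
      using yM \<theta>D(1) by (simp add: \<theta>'_def \<eta>(3) minus_add_cancel)
    have "\<theta>' x = x" if x: "x \<in> K" "x \<in> submodule_span R M (insert z B)" for x
    proof -
      obtain m' r' where m': "m' \<in> ?N" and r': "r' \<in> carrier R" and xeq: "x = m' \<oplus>\<^bsub>M\<^esub> r' \<odot>\<^bsub>M\<^esub> z"
        using decomp [OF x(2)] by blast
      \<comment> \<open>\<open>q\<close> takes the \<open>z\<close>-part of \<open>y\<close> to \<open>z\<close>, so \<open>x - y q r'\<close> has no \<open>z\<close>-part\<close>
      let ?c = "q \<otimes> r'"
      have c: "?c \<in> carrier R"
        using q(1) r' by simp
      have m'M: "m' \<in> carrier M" and xM: "x \<in> carrier M"
        using m' ND(1) x(1) KD(1) by auto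
      have cM: "?c \<odot>\<^bsub>M\<^esub> m \<in> carrier M" "r' \<odot>\<^bsub>M\<^esub> z \<in> carrier M" "?c \<odot>\<^bsub>M\<^esub> y \<in> carrier M"
        using c mM r' z(2) yM by auto
      have "?c \<odot>\<^bsub>M\<^esub> y = ?c \<odot>\<^bsub>M\<^esub> m \<oplus>\<^bsub>M\<^esub> r' \<odot>\<^bsub>M\<^esub> z"
        using c mM r z(2) q r' by (simp add: yeq smult_add_vector smult_assoc)
      then have "x \<ominus>\<^bsub>M\<^esub> ?c \<odot>\<^bsub>M\<^esub> y = m' \<ominus>\<^bsub>M\<^esub> ?c \<odot>\<^bsub>M\<^esub> m"
        unfolding xeq using add_minus_swap [OF m'M cM(2) cM(1,2)] m'M cM
        by (simp add: minus_eq_zero_iff [THEN iffD2])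
      also have "\<dots> \<in> ?N"
        using ND(4,5) m m' c by blast
      finally have "x \<ominus>\<^bsub>M\<^esub> ?c \<odot>\<^bsub>M\<^esub> y \<in> ?N" .
      moreover have "x \<ominus>\<^bsub>M\<^esub> ?c \<odot>\<^bsub>M\<^esub> y \<in> K"
        using KD(4,5) x(1) y(1) c by blast
      ultimately have "\<theta>' (x \<ominus>\<^bsub>M\<^esub> ?c \<odot>\<^bsub>M\<^esub> y) = x \<ominus>\<^bsub>M\<^esub> ?c \<odot>\<^bsub>M\<^esub> y"
        by (intro fix_N)
      moreover have "\<theta>' (?c \<odot>\<^bsub>M\<^esub> y) = ?c \<odot>\<^bsub>M\<^esub> y"
        using linear_mapsD(3) [OF \<theta>' c yM] fix_y by simp
      ultimately have "\<theta>' ((x \<ominus>\<^bsub>M\<^esub> ?c \<odot>\<^bsub>M\<^esub> y) \<oplus>\<^bsub>M\<^esub> ?c \<odot>\<^bsub>M\<^esub> y) = (x \<ominus>\<^bsub>M\<^esub> ?c \<odot>\<^bsub>M\<^esub> y) \<oplus>\<^bsub>M\<^esub> ?c \<odot>\<^bsub>M\<^esub> y"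
        using linear_mapsD(2) [OF \<theta>', of "x \<ominus>\<^bsub>M\<^esub> ?c \<odot>\<^bsub>M\<^esub> y" "?c \<odot>\<^bsub>M\<^esub> y"] xM cM(3) by simp
      then show ?thesis
        using xM cM(3) by (simp add: minus_add_cancel)
    qed
    with \<theta>' \<theta>'K show ?thesis
      by (intro bexI [of _ \<theta>']) auto
  qed
qed

text \<open>
  Left multiplication by \<open>a\<close> is right linear, hence preserves atoms.
\<close>

lemma right_socle_left_ideal:
  fixes R :: "('a, 'r) ring_scheme" (structure)
  assumes R: "ring R" and a: "a \<in> carrier R" and s: "s \<in> right_socle R"
  shows "a \<otimes> s \<in> right_socle R"
proof -
  note RR = right_module_regular [OF R]
  interpret RR: right_module R "right_regular R" by (rule RR)
  have mult: "(\<lambda>x. a \<otimes> x) \<in> linear_maps R (right_regular R) (right_regular R)"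
    using a by (intro linear_mapsI) (auto simp: RR.R.r_distr RR.R.m_assoc)
  have "submodule_span R (right_regular R) (atoms R (right_regular R)) \<subseteq>
      {x \<in> carrier (right_regular R). a \<otimes> x \<in> right_socle R}"
  proof (rule RR.submodule_span_least)
    show "submodule {x \<in> carrier (right_regular R). a \<otimes> x \<in> right_socle R} R (right_regular R)"
      unfolding right_socle_def by (rule submodule_vimage [OF RR RR mult RR.submodule_socle])
    show "atoms R (right_regular R) \<subseteq> {x \<in> carrier (right_regular R). a \<otimes> x \<in> right_socle R}"
      using atoms_linear_image [OF RR RR mult] RR.atoms_closed RR.atoms_in_socle
      unfolding right_socle_def by blast
  qed
  then show ?thesis
    using s unfolding right_socle_def RR.socle_eq_span_atoms [symmetric] by blast
qed

text \<open>
  This is \<open>V S\<^sub>r = A S\<^sub>r = A T R\<close> for \<open>V = A R\<close> and \<open>S\<^sub>r = T R\<close>, where the first step uses that \<open>S\<^sub>r\<close> is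
  also a left ideal.
\<close>

lemma (in right_module) smult_socle_in_atom_span:
  assumes T: "T \<subseteq> atoms R (right_regular R)" "right_socle R = submodule_span R (right_regular R) T"
    and A: "A \<subseteq> carrier M" and x: "x \<in> submodule_span R M A" and s: "s \<in> right_socle R"
  shows "s \<odot>\<^bsub>M\<^esub> x \<in> submodule_span R M ((\<lambda>(t, y). t \<odot>\<^bsub>M\<^esub> y) ` (T \<times> A))" (is "_ \<in> submodule_span R M ?B")
proof -
  note RR = right_module_regular [OF R.ring_axioms]
  interpret RR: right_module R "right_regular R" by (rule RR)
  have TR: "T \<subseteq> carrier R"
    using T(1) RR.atoms_closed by auto
  have SR: "s \<in> carrier R" if "s \<in> right_socle R" for s
    using RR.submoduleD(1) [OF RR.submodule_socle] that by (simp add: right_socle_def)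
  have "?B \<subseteq> carrier M"
    using TR A by auto
  note B = submodule_span [OF this]
  note BD = submoduleD [OF B]
  let ?H = "{y \<in> carrier M. \<forall>s\<in>right_socle R. s \<odot>\<^bsub>M\<^esub> y \<in> submodule_span R M ?B}"
  have "submodule ?H R M"
  proof (rule submoduleI)
    show "\<zero>\<^bsub>M\<^esub> \<in> ?H"
      using SR BD(2) by (simp add: smult_zero_vector)
    show "u \<oplus>\<^bsub>M\<^esub> v \<in> ?H" if "u \<in> ?H" "v \<in> ?H" for u v
      using that SR BD(3) by (simp add: smult_add_vector)
    show "a \<odot>\<^bsub>M\<^esub> u \<in> ?H" if "a \<in> carrier R" "u \<in> ?H" for a u
    proof -
      have "s \<odot>\<^bsub>M\<^esub> (a \<odot>\<^bsub>M\<^esub> u) \<in> submodule_span R M ?B" if "s \<in> right_socle R" for s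
        using \<open>u \<in> ?H\<close> right_socle_left_ideal [OF R.ring_axioms \<open>a \<in> carrier R\<close> that]
          smult_assoc [OF \<open>a \<in> carrier R\<close> SR [OF that], of u] by auto
      with that show ?thesis by simp
    qed
  qed blast
  moreover have "A \<subseteq> ?H"
  proof
    fix y assume y: "y \<in> A"
    have "T \<subseteq> {s \<in> carrier R. s \<odot>\<^bsub>M\<^esub> y \<in> submodule_span R M ?B}"
      using TR y submodule_span_superset [of ?B] by force
    then have "right_socle R \<subseteq> {s \<in> carrier R. s \<odot>\<^bsub>M\<^esub> y \<in> submodule_span R M ?B}"
      unfolding T(2) using y A by (intro RR.submodule_span_least submodule_residual B) auto
    with y A show "y \<in> ?H"
      by blast
  qed
  ultimately have "submodule_span R M A \<subseteq> ?H"
    by (rule submodule_span_least)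
  with x s show ?thesis
    by blast
qed

text \<open>
  By a dual basis, \<open>k\<close> is a sum of products \<open>y (\<pi> y k)\<close> whose second factors lie in \<open>S\<^sub>r\<close>; applying
  \<open>e\<close>, which fixes \<open>k\<close>, moves the first factors into the span of \<open>A\<close>.
\<close>

lemma locally_fixed_delta_small_in_atom_span:
  fixes P :: "('a, 'c) module"
  assumes P: "projective_module R P" and K: "delta_small R P K"
    and local: "\<And>k. k \<in> K \<Longrightarrow> \<exists>\<theta>\<in>linear_maps R P P. (\<forall>x\<in>carrier P. \<theta> x \<in> K) \<and> \<theta> k = k"
    and T: "T \<subseteq> atoms R (right_regular R)" "right_socle R = submodule_span R (right_regular R) T"
    and A: "A \<subseteq> carrier P"
    and e: "e \<in> linear_maps R P P" "\<And>x. x \<in> carrier P \<Longrightarrow> e x \<in> submodule_span R P A"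
    and k: "k \<in> K" "e k = k"
  shows "k \<in> submodule_span R P ((\<lambda>(t, y). t \<odot>\<^bsub>P\<^esub> y) ` (T \<times> A))" (is "k \<in> submodule_span R P ?B")
proof -
  interpret P: right_module R P
    using P by (simp add: projective_module_def)
  note Pm = P.right_module_axioms
  interpret RR: right_module R "right_regular R"
    by (rule right_module_regular [OF P.R.ring_axioms])
  have "submodule K R P"
    using K by (simp add: delta_small_def)
  then have kP: "k \<in> carrier P"
    using P.submoduleD(1) k(1) by blast
  have "?B \<subseteq> carrier P"
    using T(1) RR.atoms_closed A by auto
  note B = P.submodule_span [OF this]
  obtain \<theta> where \<theta>: "\<theta> \<in> linear_maps R P P" "\<forall>x\<in>carrier P. \<theta> x \<in> K" "\<theta> k = k"
    using local [OF k(1)] by blast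
  obtain \<pi> where \<pi>: "\<And>y. \<pi> y \<in> linear_maps R P (right_regular R)"
    and "finite {y. \<pi> y k \<noteq> \<zero>\<^bsub>R\<^esub>}" "{y. \<pi> y k \<noteq> \<zero>\<^bsub>R\<^esub>} \<subseteq> carrier P"
      "(\<Oplus>\<^bsub>P\<^esub>y\<in>{y. \<pi> y k \<noteq> \<zero>\<^bsub>R\<^esub>}. \<pi> y k \<odot>\<^bsub>P\<^esub> y) = k"
    using projective_dual_basis [OF P] kP by blast
  then obtain S where S: "finite S" "S \<subseteq> carrier P" "(\<Oplus>\<^bsub>P\<^esub>y\<in>S. \<pi> y k \<odot>\<^bsub>P\<^esub> y) = k"
    by blast
  have \<pi>S: "\<pi> y k \<in> right_socle R" "\<pi> y k \<in> carrier R" for y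
    using delta_small_fixed_dual_in_socle [OF P K \<theta>(1) _ kP \<theta>(3) \<pi>] \<theta>(2) linear_mapsD(1) [OF \<pi> kP]
    by simp_all
  have "k = e (\<Oplus>\<^bsub>P\<^esub>y\<in>S. \<pi> y k \<odot>\<^bsub>P\<^esub> y)"
    using S(3) k(2) by simp
  also have "\<dots> = (\<Oplus>\<^bsub>P\<^esub>y\<in>S. e (\<pi> y k \<odot>\<^bsub>P\<^esub> y))"
    using S(2) \<pi>S(2) by (intro linear_map_finsum [OF Pm Pm e(1) S(1)]) auto
  also have "\<dots> \<in> submodule_span R P ?B"
  proof (rule P.submodule_finsum [OF B S(1)])
    fix y assume "y \<in> S"
    then have y: "y \<in> carrier P"
      using S(2) by blast
    show "e (\<pi> y k \<odot>\<^bsub>P\<^esub> y) \<in> submodule_span R P ?B"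
      unfolding linear_mapsD(3) [OF e(1) \<pi>S(2) y]
      by (rule P.smult_socle_in_atom_span [OF T A e(2) [OF y] \<pi>S(1)])
  qed
  finally show ?thesis .
qed

section \<open>Flat modules with a projective \<open>\<delta>\<close>-cover\<close>

theorem proposition2p18:
  fixes R :: "('a, 'r) ring_scheme"
    and F :: "('a, 'b) module"
  assumes "ring R"
    and "finitely_generated R (right_regular R) (right_socle R)"
    and "right_module R F"
    and "finitely_generated R F (carrier F)"
    and "flat_module R F"
    and "\<exists>(P :: ('a, 'c) module) f. projective_delta_cover R P F f"
  shows "projective_module R F"
proof -
  obtain P :: "('a, 'c) module" and f where "projective_delta_cover R P F f"
    using assms(6) by (elim exE) (rule that)
  then have P: "projective_module R P" and f: "f \<in> epimorphisms R P F"
    and small: "delta_small R P (a_kernel P F f)"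
    by (simp_all add: projective_delta_cover_def)
  define K where "K = a_kernel P F f"
  have K_iff: "x \<in> K \<longleftrightarrow> x \<in> carrier P \<and> f x = \<zero>\<^bsub>F\<^esub>" for x
    by (simp add: K_def a_kernel_def')
  note small = small [folded K_def]
  interpret P: right_module R P
    using P by (simp add: projective_module_def)
  interpret F: right_module R F by (rule assms(3))
  note Pm = P.right_module_axioms and Fm = F.right_module_axioms
  interpret RR: right_module R "right_regular R"
    by (rule right_module_regular [OF assms(1)])
  have fl: "f \<in> linear_maps R P F"
    using f by (simp add: epimorphisms_def)
  note fD = linear_mapsD [OF fl]
  have K: "submodule K R P"
    using small by (simp add: delta_small_def)
  note KD = P.submoduleD [OF K]
  have local: "\<exists>\<theta>\<in>linear_maps R P P. (\<forall>x\<in>carrier P. \<theta> x \<in> K) \<and> \<theta> k = k" if "k \<in> K" for k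
  proof -
    have "k \<in> carrier P" "f k = \<zero>\<^bsub>F\<^esub>"
      using that K_iff by simp_all
    from flat_kernel_fixed [OF P assms(5) f this]
    obtain \<theta> where \<theta>: "\<theta> \<in> linear_maps R P P" "(\<forall>x\<in>carrier P. f (\<theta> x) = \<zero>\<^bsub>F\<^esub>) \<and> \<theta> k = k"
      by (rule bexE)
    then have "\<theta> x \<in> K" if "x \<in> carrier P" for x
      using that linear_mapsD(1) [OF \<theta>(1) that] by (simp add: K_iff)
    with \<theta> show ?thesis
      by (intro bexI [of _ \<theta>]) simp_all
  qed

  obtain T where T: "finite T" "T \<subseteq> atoms R (right_regular R)"
      "right_socle R = submodule_span R (right_regular R) T"
    using RR.finitely_generated_socle [folded right_socle_def, OF assms(2)]
    by (elim exE conjE) (rule that)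

  obtain s where "\<forall>y\<in>carrier F. s y \<in> carrier P \<and> f (s y) = y"
    using epimorphism_section [OF f] by (rule exE)
  then have sP: "s y \<in> carrier P" and fs: "f (s y) = y" if "y \<in> carrier F" for y
    using that by simp_all
  obtain G where G: "finite G" "G \<subseteq> carrier F" "carrier F = submodule_span R F G"
    using assms(4) unfolding finitely_generated_def by (elim exE conjE) (rule that)
  define A where "A = s ` G"
  have A: "finite A" "A \<subseteq> carrier P"
    using G(1,2) sP by (auto simp: A_def)
  let ?V = "submodule_span R P A"
  have V: "submodule ?V R P"
    by (rule P.submodule_span [OF A(2)])
  \<comment> \<open>lifting generators of \<open>F\<close> gives a finitely generated submodule of \<open>P\<close> that \<open>f\<close> maps onto \<open>F\<close>\<close>
  have "G \<subseteq> f ` ?V"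
  proof
    fix y assume "y \<in> G"
    then have "s y \<in> ?V" "y = f (s y)"
      using subsetD [OF P.submodule_span_superset, of "s y" A] fs G(2) by (auto simp: A_def)
    then show "y \<in> f ` ?V"
      by (rule rev_image_eqI)
  qed
  then have V_onto: "carrier F \<subseteq> f ` ?V"
    unfolding G(3) by (rule F.submodule_span_least [OF submodule_image [OF Pm Fm fl V]])
  have "?V <+>\<^bsub>P\<^esub> K = carrier P"
  proof
    show "?V <+>\<^bsub>P\<^esub> K \<subseteq> carrier P"
      using P.submoduleD(1) [OF P.submodule_sum(1) [OF V K]] by blast
    show "carrier P \<subseteq> ?V <+>\<^bsub>P\<^esub> K"
    proof
      fix p assume p: "p \<in> carrier P"
      then obtain v where v: "v \<in> ?V" "f p = f v"
        using V_onto fD(1) by blast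
      have vP: "v \<in> carrier P"
        using P.submoduleD(1) [OF V v(1)] .
      have "p \<ominus>\<^bsub>P\<^esub> v \<in> K"
        using p vP v(2) fD(1) by (simp add: K_iff linear_map_minus [OF Pm Fm fl] F.minus_eq_zero_iff)
      moreover have "p = v \<oplus>\<^bsub>P\<^esub> (p \<ominus>\<^bsub>P\<^esub> v)"
        using p vP by (simp add: P.minus_add_cancel)
      ultimately show "p \<in> ?V <+>\<^bsub>P\<^esub> K"
        unfolding P.set_add_iff using v(1) by blast
    qed
  qed
  from P.delta_small_projection [OF small V this]
  obtain e where e: "e \<in> linear_maps R P P"
      "\<forall>x\<in>carrier P. e x \<in> ?V \<and> x \<ominus>\<^bsub>P\<^esub> e x \<in> K" "\<forall>x\<in>?V. e x = x"
    by (elim bexE conjE) (rule that)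
  note eD = linear_mapsD [OF e(1)]
  have eK: "x \<ominus>\<^bsub>P\<^esub> e x \<in> K" if "x \<in> carrier P" for x
    using e(2) that by blast

  let ?B = "(\<lambda>(t, y). t \<odot>\<^bsub>P\<^esub> y) ` (T \<times> A)"
  have "?B \<subseteq> atoms R P"
    using T(2) A(2) atoms_linear_image [OF RR.right_module_axioms Pm P.linear_map_orbit] by auto
  moreover have "finite ?B"
    using T(1) A(1) by simp
  ultimately obtain \<theta> where \<theta>: "\<theta> \<in> linear_maps R P P" "\<forall>x\<in>carrier P. \<theta> x \<in> K"
      "\<forall>x\<in>K \<inter> submodule_span R P ?B. \<theta> x = x"
    using P.endomorphism_fixing_atom_span [OF K local, of ?B] by blast
  note \<theta>D = linear_mapsD [OF \<theta>(1)]

  define \<rho> where "\<rho> x = e x \<ominus>\<^bsub>P\<^esub> \<theta> (e x)" for x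
  have \<rho>: "\<rho> \<in> linear_maps R P P"
    unfolding \<rho>_def by (intro linear_maps_minus [OF Pm e(1)] linear_maps_compose [OF e(1) \<theta>(1)])
  note \<rho>D = linear_mapsD [OF \<rho>]
  have \<rho>K: "\<rho> k = \<zero>\<^bsub>P\<^esub>" if k: "k \<in> K" for k
  proof -
    have kP: "k \<in> carrier P" and ekP: "e k \<in> carrier P"
      using KD(1) k eD(1) by auto
    have "f (k \<ominus>\<^bsub>P\<^esub> e k) = \<zero>\<^bsub>F\<^esub>"
      using eK [OF kP] K_iff by blast
    then have "f (e k) = \<zero>\<^bsub>F\<^esub>"
      using k K_iff kP ekP fD(1) by (simp add: linear_map_minus [OF Pm Fm fl] F.minus_eq_zero_iff)
    then have "e k \<in> K"
      using ekP K_iff by blast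
    moreover have "e (e k) = e k"
      using e(2,3) kP by blast
    ultimately have "e k \<in> submodule_span R P ?B"
      using e(2) by (intro locally_fixed_delta_small_in_atom_span [OF P small local T(2,3) A(2) e(1)]) auto
    with \<open>e k \<in> K\<close> have "\<theta> (e k) = e k"
      using \<theta>(3) by blast
    then show ?thesis
      using ekP by (simp add: \<rho>_def P.minus_eq_zero_iff)
  qed
  have f\<rho>: "f (\<rho> x) = f x" if x: "x \<in> carrier P" for x
  proof -
    have ex: "e x \<in> carrier P" "\<theta> (e x) \<in> carrier P"
      using x eD(1) \<theta>D(1) by auto
    have f0: "f (x \<ominus>\<^bsub>P\<^esub> e x) = \<zero>\<^bsub>F\<^esub>" "f (\<theta> (e x)) = \<zero>\<^bsub>F\<^esub>"
      using eK [OF x] \<theta>(2) ex(1) K_iff by blast+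
    have "f (\<rho> x) = f (e x) \<ominus>\<^bsub>F\<^esub> \<zero>\<^bsub>F\<^esub>"
      using ex f0(2) by (simp add: \<rho>_def linear_map_minus [OF Pm Fm fl])
    also have "\<dots> = f (e x)"
      using ex(1) fD(1) by (simp add: a_minus_def)
    also have "\<dots> = f x"
      using f0(1) x ex(1) fD(1) by (simp add: linear_map_minus [OF Pm Fm fl] F.minus_eq_zero_iff)
    finally show ?thesis .
  qed
  \<comment> \<open>\<open>\<rho>\<close> factors through \<open>f\<close>, which makes \<open>\<rho> \<circ> s\<close> linear although \<open>s\<close> need not be\<close>
  have \<rho>_cong: "\<rho> x = \<rho> y" if "x \<in> carrier P" "y \<in> carrier P" "f x = f y" for x y
  proof -
    have "x \<ominus>\<^bsub>P\<^esub> y \<in> K"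
      using that fD(1) by (simp add: K_iff linear_map_minus [OF Pm Fm fl] F.minus_eq_zero_iff)
    then have "\<rho> (x \<ominus>\<^bsub>P\<^esub> y) = \<zero>\<^bsub>P\<^esub>"
      by (rule \<rho>K)
    then show ?thesis
      using that \<rho>D(1) by (simp add: linear_map_minus [OF Pm Pm \<rho>] P.minus_eq_zero_iff)
  qed
  have "(\<lambda>y. \<rho> (s y)) \<in> linear_maps R F P"
  proof (rule linear_mapsI)
    show "\<rho> (s y) \<in> carrier P" if "y \<in> carrier F" for y
      using that sP \<rho>D(1) by simp
    show "\<rho> (s (y \<oplus>\<^bsub>F\<^esub> z)) = \<rho> (s y) \<oplus>\<^bsub>P\<^esub> \<rho> (s z)" if "y \<in> carrier F" "z \<in> carrier F" for y z
      using that sP fs fD(2) by (subst \<rho>D(2) [symmetric]) (auto intro!: \<rho>_cong)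
    show "\<rho> (s (a \<odot>\<^bsub>F\<^esub> y)) = a \<odot>\<^bsub>P\<^esub> \<rho> (s y)" if "a \<in> carrier R" "y \<in> carrier F" for a y
      using that sP fs fD(3) by (subst \<rho>D(3) [symmetric]) (auto intro!: \<rho>_cong)
  qed
  then show ?thesis
    using projective_retract [OF P Fm fl] f\<rho> sP fs by simp
qed

end
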